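(* Sorted Enum (given a graph database $\mathcal D$ and an RPQ $q$, enumerate $q(\mathcal D)$ in lexicographic order) can be solved with preprocessing time $O(|q|^{2}\log(\overline{\Delta}(\mathcal D)|q|)\,\overline{\Delta}(\mathcal D)\,|\mathcal D|)$ and delay $O(|V_{\mathcal D}|)$.
   Context: $\Sigma$ is a fixed finite alphabet of constant size. A graph database over $\Sigma$ is a pair $\mathcal{D}=(V_{\mathcal D},E_{\mathcal D})$ with a finite node set and arc set $E_{\mathcal D}\subseteq V_{\mathcal D}\times\Sigma\times V_{\mathcal D}$, of size $|\mathcal D|=\max\{|V_{\mathcal D}|,|E_{\mathcal D}|\}$; it is represented by a list of nodes, whose order defines a linear order $\preceq$ on $V_{\mathcal D}$, and per node and letter a list of successors. The degree of a node $u$ is the number of distinct nodes $v$ with $(u,x,v)\in E_{\mathcal D}$ for some $x$; $\overline{\Delta}(\mathcal D)=\frac1{|V_{\mathcal D}|}\sum_{u}\deg(u)$ is the average degree. A path from $u$ to $v$ is a sequence $u=w_0,a_1,w_1,\dots,a_k,w_k=v$ ($k\ge0$) with $(w_{i-1},a_i,w_i)\in E_{\mathcal D}$, labelled by $a_1\cdots a_k$. An RPQ $q$ is a regular expression over $\Sigma$ (built from $\varepsilon$, letters, concatenation, alternation, Kleene plus), $|q|$ its length; $q(\mathcal D)$ is the set of node pairs $(u,v)$ such that some path from $u$ to $v$ is labelled by a word in the language of $q$. Model: RAM with logarithmic word size. Enumeration: preprocessing phase, then enumeration phase outputting every element of $q(\mathcal D)$ exactly once and signalling termination; delay = maximum time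 between start and first output, between consecutive outputs, and between last output and termination. Sorted: outputs appear in lexicographic order with respect to $\preceq$.
   Formalization: The logarithm is read as at least 1, |q| is added to the preprocessing bound (it matters only without arcs), and the delay bound is max(1,|V|), as the literal bounds are zero, negative or undefined on degenerate inputs; nodes are named by natural numbers. *)

theory Defs
  imports Complex_Main "HOL-Library.Cardinality"
begin

section \<open>Graph databases and regular path queries\<close>

record ('v, 'a) graph_db =
  nodes :: "'v set"
  arcs :: "('v \<times> 'a \<times> 'v) set"

definition wf_db :: "('v, 'a) graph_db \<Rightarrow> bool" where
  "wf_db D \<longleftrightarrow> finite (nodes D) \<and> finite (arcs D) \<and> arcs D \<subseteq> nodes D \<times> UNIV \<times> nodes D"

definition db_size :: "('v, 'a) graph_db \<Rightarrow> nat" where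
  "db_size D = max (card (nodes D)) (card (arcs D))"

definition degree :: "('v, 'a) graph_db \<Rightarrow> 'v \<Rightarrow> nat" where
  "degree D u = card {v. \<exists>x. (u, x, v) \<in> arcs D}"

definition avg_degree :: "('v, 'a) graph_db \<Rightarrow> real" where
  "avg_degree D = (1 / real (card (nodes D))) * (\<Sum>u\<in>nodes D. real (degree D u))"

inductive labelled_path :: "('v, 'a) graph_db \<Rightarrow> 'v \<Rightarrow> 'a list \<Rightarrow> 'v \<Rightarrow> bool" for D where
  empty: "u \<in> nodes D \<Longrightarrow> labelled_path D u [] u"
| arc: "(u, a, v) \<in> arcs D \<Longrightarrow> labelled_path D v w t \<Longrightarrow> labelled_path D u (a # w) t"

datatype 'a rpq = Eps | Letter 'a | Cat "'a rpq" "'a rpq" | Alt "'a rpq" "'a rpq" | Plus "'a rpq"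

fun lang :: "'a rpq \<Rightarrow> 'a list set" where
  "lang Eps = {[]}"
| "lang (Letter a) = {[a]}"
| "lang (Cat r s) = {v @ w | v w. v \<in> lang r \<and> w \<in> lang s}"
| "lang (Alt r s) = lang r \<union> lang s"
| "lang (Plus r) = {concat ws | ws. ws \<noteq> [] \<and> set ws \<subseteq> lang r}"

text \<open>The length of a query counts the occurrences of letters, \<open>\<epsilon>\<close> and operators,
  concatenation included.\<close>

fun rpq_length :: "'a rpq \<Rightarrow> nat" where
  "rpq_length Eps = 1"
| "rpq_length (Letter a) = 1"
| "rpq_length (Cat r s) = 1 + rpq_length r + rpq_length s"
| "rpq_length (Alt r s) = 1 + rpq_length r + rpq_length s"
| "rpq_length (Plus r) = 1 + rpq_length r"

definition answers :: "'a rpq \<Rightarrow> ('v, 'a) graph_db \<Rightarrow> ('v \<times> 'v) set" where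
  "answers q D = {(u, v). \<exists>w \<in> lang q. labelled_path D u w v}"


section \<open>Random access machine with bounded words\<close>

text \<open>A program uses finitely many registers and a word-addressed memory. Register operands
  and jump targets are literals; \<open>LOAD r s\<close> and \<open>STORE s r\<close> address the memory through
  register \<open>s\<close>. \<open>READY\<close> ends the preprocessing phase, \<open>EMIT\<close> outputs a pair of words,
  \<open>HALT\<close> signals termination.\<close>

datatype instr =
    SETC nat nat
  | ADD nat nat nat
  | SUB nat nat nat
  | MUL nat nat nat
  | DIV nat nat nat
  | LOAD nat nat
  | STORE nat nat
  | JUMP nat
  | JZERO nat nat
  | READY
  | EMIT nat nat
  | HALT

record config =
  pc :: nat
  reg :: "nat \<Rightarrow> nat"
  mem :: "nat \<Rightarrow> nat"

datatype event = Silent | Ready | Output nat nat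

text \<open>Words have \<open>w\<close> bits. An instruction whose result does not fit into a word is stuck, so
  overflow is never available as a resource.\<close>

definition set_reg :: "nat \<Rightarrow> nat \<Rightarrow> nat \<Rightarrow> config \<Rightarrow> (event \<times> config) option" where
  "set_reg w r x c =
     (if x < 2 ^ w then Some (Silent, c\<lparr>pc := Suc (pc c), reg := (reg c)(r := x)\<rparr>) else None)"

fun exec_instr :: "nat \<Rightarrow> instr \<Rightarrow> config \<Rightarrow> (event \<times> config) option" where
  "exec_instr w (SETC r k) c = set_reg w r k c"
| "exec_instr w (ADD r s t) c = set_reg w r (reg c s + reg c t) c"
| "exec_instr w (SUB r s t) c = set_reg w r (reg c s - reg c t) c"
| "exec_instr w (MUL r s t) c = set_reg w r (reg c s * reg c t) c"
| "exec_instr w (DIV r s t) c = set_reg w r (reg c s div reg c t) c"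
| "exec_instr w (LOAD r s) c = set_reg w r (mem c (reg c s)) c"
| "exec_instr w (STORE s r) c =
     Some (Silent, c\<lparr>pc := Suc (pc c), mem := (mem c)(reg c s := reg c r)\<rparr>)"
| "exec_instr w (JUMP l) c = Some (Silent, c\<lparr>pc := l\<rparr>)"
| "exec_instr w (JZERO r l) c =
     Some (Silent, c\<lparr>pc := (if reg c r = 0 then l else Suc (pc c))\<rparr>)"
| "exec_instr w READY c = Some (Ready, c\<lparr>pc := Suc (pc c)\<rparr>)"
| "exec_instr w (EMIT r s) c = Some (Output (reg c r) (reg c s), c\<lparr>pc := Suc (pc c)\<rparr>)"
| "exec_instr w HALT c = None"

text \<open>\<open>run w P c es\<close>: the computation of \<open>P\<close> from \<open>c\<close> reaches \<open>HALT\<close>, and \<open>es\<close> lists the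
  events of its steps, one per unit of time. Stuck and diverging computations have no run.\<close>

inductive run :: "nat \<Rightarrow> instr list \<Rightarrow> config \<Rightarrow> event list \<Rightarrow> bool" for w P where
  halt: "pc c < length P \<Longrightarrow> P ! pc c = HALT \<Longrightarrow> run w P c []"
| step: "pc c < length P \<Longrightarrow> exec_instr w (P ! pc c) c = Some (e, c') \<Longrightarrow>
     run w P c' es \<Longrightarrow> run w P c (e # es)"

definition init_config :: "nat list \<Rightarrow> config" where
  "init_config xs =
     \<lparr>pc = 0, reg = (\<lambda>_. 0), mem = (\<lambda>i. if i < length xs then xs ! i else 0)\<rparr>"

text \<open>Logarithmic word size: a constant multiple of the logarithm of the input length.\<close>

definition word_size :: "nat \<Rightarrow> nat list \<Rightarrow> nat" where
  "word_size k xs = k * nat \<lceil>log 2 (real (length xs))\<rceil>"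


section \<open>Input representation\<close>

text \<open>A graph database is given by a list of its nodes and, per node and letter, a list of
  successors. The order of the successor lists is arbitrary.\<close>

definition represents ::
    "'v list \<Rightarrow> ('v \<Rightarrow> 'a \<Rightarrow> 'v list) \<Rightarrow> ('v, 'a) graph_db \<Rightarrow> bool" where
  "represents vs succs D \<longleftrightarrow>
     distinct vs \<and> set vs = nodes D \<and>
     (\<forall>u\<in>nodes D. \<forall>x. distinct (succs u x) \<and> set (succs u x) = {v. (u, x, v) \<in> arcs D})"

definition position :: "'v list \<Rightarrow> 'v \<Rightarrow> nat" where
  "position vs u = (LEAST i. i < length vs \<and> vs ! i = u)"

text \<open>Queries are stored as their syntax trees in prefix notation, one word per symbol.\<close>

fun rpq_words :: "('a \<Rightarrow> nat) \<Rightarrow> 'a rpq \<Rightarrow> nat list" where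
  "rpq_words code Eps = [0]"
| "rpq_words code (Cat r s) = 1 # rpq_words code r @ rpq_words code s"
| "rpq_words code (Alt r s) = 2 # rpq_words code r @ rpq_words code s"
| "rpq_words code (Plus r) = 3 # rpq_words code r"
| "rpq_words code (Letter a) = [4 + code a]"

lemma length_rpq_words: "length (rpq_words code q) = rpq_length q"
  by (induction q) auto

text \<open>\<open>code\<close> numbers the letters from \<open>0\<close>, and nodes are identified by their positions in the
  node list. \<open>succ_lists\<close> holds the list for the node at position \<open>i\<close> and the letter with
  number \<open>j\<close> at index \<open>i * CARD('a) + j\<close>. In memory the lists are concatenated, preceded by a
  table in which entry \<open>l\<close> is the offset of list \<open>l\<close> in the concatenation, and a final entry is
  the total length. Hence each list is accessible in constant time.\<close>

definition succ_lists ::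
    "('a::finite \<Rightarrow> nat) \<Rightarrow> 'v list \<Rightarrow> ('v \<Rightarrow> 'a \<Rightarrow> 'v list) \<Rightarrow> nat list list" where
  "succ_lists code vs succs =
     concat (map (\<lambda>u. map (\<lambda>j. map (position vs) (succs u (inv code j))) [0..<CARD('a)]) vs)"

definition offsets :: "'b list list \<Rightarrow> nat list" where
  "offsets xss = map (\<lambda>l. length (concat (take l xss))) [0..<Suc (length xss)]"

definition input_words ::
    "('a::finite \<Rightarrow> nat) \<Rightarrow> 'v list \<Rightarrow> ('v \<Rightarrow> 'a \<Rightarrow> 'v list) \<Rightarrow> 'a rpq \<Rightarrow> nat list" where
  "input_words code vs succs q =
     [length vs, rpq_length q] @ rpq_words code q
       @ offsets (succ_lists code vs succs) @ concat (succ_lists code vs succs)"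


section \<open>Sorted enumeration\<close>

text \<open>The order on nodes given by the node list, and the induced lexicographic order on pairs.\<close>

definition node_le :: "'v list \<Rightarrow> 'v \<Rightarrow> 'v \<Rightarrow> bool" where
  "node_le vs u v \<longleftrightarrow> (\<exists>i j. i \<le> j \<and> j < length vs \<and> vs ! i = u \<and> vs ! j = v)"

definition lex_le :: "'v list \<Rightarrow> 'v \<times> 'v \<Rightarrow> 'v \<times> 'v \<Rightarrow> bool" where
  "lex_le vs p p' \<longleftrightarrow>
     (fst p \<noteq> fst p' \<and> node_le vs (fst p) (fst p')) \<or>
     (fst p = fst p' \<and> node_le vs (snd p) (snd p'))"

text \<open>An event sequence that consists of preprocessing, taking time at most \<open>tp\<close> and producing
  no output, followed by an enumeration phase that outputs exactly \<open>outs\<close>. The entries of \<open>ks\<close>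
  and \<open>k\<close> are the numbers of steps before each output and before termination; the step
  performing the output or halting is counted too.\<close>

definition enumeration :: "event list \<Rightarrow> real \<Rightarrow> real \<Rightarrow> (nat \<times> nat) list \<Rightarrow> bool" where
  "enumeration es tp td outs \<longleftrightarrow>
     (\<exists>p ks k. length ks = length outs \<and>
        es = replicate p Silent @ [Ready]
               @ concat (map2 (\<lambda>k (i, j). replicate k Silent @ [Output i j]) ks outs)
               @ replicate k Silent \<and>
        real (Suc p) \<le> tp \<and> (\<forall>k' \<in> set (ks @ [k]). real (Suc k') \<le> td))"

definition sorted_enum ::
    "('a::finite \<Rightarrow> nat) \<Rightarrow> nat \<Rightarrow> instr list \<Rightarrow> ('v, 'a) graph_db \<Rightarrow> 'v list \<Rightarrow>
      ('v \<Rightarrow> 'a \<Rightarrow> 'v list) \<Rightarrow> 'a rpq \<Rightarrow> real \<Rightarrow> real \<Rightarrow> bool" where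
  "sorted_enum code wc P D vs succs q tp td \<longleftrightarrow>
     (let xs = input_words code vs succs q in
      \<exists>es outs. run (word_size wc xs) P (init_config xs) es \<and>
        enumeration es tp td outs \<and>
        (\<forall>(i, j) \<in> set outs. i < length vs \<and> j < length vs) \<and>
        (let res = map (\<lambda>(i, j). (vs ! i, vs ! j)) outs in
         set res = answers q D \<and> distinct res \<and> sorted_wrt (lex_le vs) res))"

text \<open>The preprocessing bound \<open>|q|\<^sup>2 log(\<Delta>|q|) \<Delta> |D|\<close>, where \<open>\<Delta>\<close> is the average degree, made
  meaningful for all inputs. The logarithm is replaced by \<open>1\<close> where it is smaller, possibly
  negative. The summand \<open>|q|\<close> (the time to read the query) only matters if there are no arcs,
  when the product vanishes; otherwise \<open>\<Delta> |D| \<ge> 1\<close> and the product is at least \<open>|q|\<close>.\<close>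

definition pre_bound :: "('v, 'a) graph_db \<Rightarrow> 'a rpq \<Rightarrow> real" where
  "pre_bound D q = real (rpq_length q) +
     (real (rpq_length q))\<^sup>2 * max 1 (log 2 (avg_degree D * real (rpq_length q)))
       * avg_degree D * real (db_size D)"

text \<open>At least one unit of time is needed to terminate if there are no nodes.\<close>

definition delay_bound :: "('v, 'a) graph_db \<Rightarrow> real" where
  "delay_bound D = real (max 1 (card (nodes D)))"

end

theory Submission
  imports Defs
begin

text \<open>Let \<open>n\<close> and \<open>m\<close> be the numbers of nodes and arcs and \<open>k = (m div n + 1) |q|\<close>. The query is
  turned into an automaton with \<open>2 |q|\<close> states and \<open>O(|q|)\<close> transitions, whose product with the
  database, restricted to the non-isolated nodes, has \<open>O(m |q|) \<le> O(n k)\<close> nodes and edges.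
  Preprocessing computes for every node of the product the first \<open>k\<close> database nodes that it can
  reach in the final state: for the targets in increasing order, search backward and prune at
  the nodes that already have \<open>k\<close> targets. Every node of the product is thus visited at most
  \<open>k\<close> times, which takes time \<open>O(k m |q|) = O(|q|\<^sup>2 m (m / n + 1))\<close>, even without the logarithm.
  A source with fewer than \<open>k\<close> answers can now be listed directly. For a source with at least
  \<open>k\<close> answers, a forward search of \<open>O(n k)\<close> steps is spread over the outputs of the first \<open>k\<close>
  answers, \<open>O(n)\<close> steps before each output; afterwards the remaining answers are known, and are
  found in order by scanning the nodes. An isolated node \<open>u\<close> has at most the answer
  \<open>(u, u)\<close>, depending on whether the query accepts the empty word.\<close>

section \<open>A structured language with arrays\<close>

text \<open>Time is counted in machine steps and an overflow blocks the machine, so both must be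
  controlled throughout. The algorithm is therefore written in a small language whose executions
  carry an exact clock, and a compiler is verified once. Stored values stay below a fixed power X of
  the input length and intermediate results below a fixed power of X, which fits into logarithmic
  words. Memory is zero outside the input, so arrays need no initialisation. Marks are stamps
  (current node plus one), so no search clears the marks of an earlier one. A search is cut into
  units of constant cost, with a potential bounding the units left; this allows the forward search
  to be interrupted anywhere. The choice of k balances two demands. First, n k must dominate m |q|,
  so that k bursts of O(n) units complete a search. Second, k m |q| must fit the preprocessing
  bound: m is at most the alphabet size times the sum of the degrees, hence m (m / n + 1) is at most
  a constant times average degree times database size.\<close>

datatype var = Vn | Vq | Vm | Vs | Vk | Vi | Vsp | Vtc | Vw | Vr1 | Vr2 | Vl | Ve | Vy | Vt | Vv
  | Vec | Vx | Vqh | Vqt | Vst | Vj | Vc | Vu | Vf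

datatype ar = Stk | Nul | Tp | Tl | Td | Flg | Fh | Fn | Ft | Bh | Bn | Bt | Bmk | Ful | Cnt | Lst
  | Que | Fmk | Zer

datatype exp = N nat | V var | Add exp exp | Sub exp exp | Mul exp exp | Div exp exp | Ar ar exp

datatype com = Skip | Assign var exp ("_ ::= _" [80, 61] 61) | Read var exp
  | Store ar exp exp ("_\<langle>_\<rangle> := _" [80, 61, 61] 61)
  | Seq com com (infixr ";;" 60) | If exp com com | While exp com | Rdy | Emit exp exp

record state =
  vars :: "var \<Rightarrow> nat"
  arr :: "ar \<Rightarrow> nat \<Rightarrow> nat"
  clk :: nat
  trace :: "(nat \<times> event) list"

fun eval :: "exp \<Rightarrow> state \<Rightarrow> nat" where
  "eval (N k) s = k"
| "eval (V x) s = vars s x"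
| "eval (Add a b) s = eval a s + eval b s"
| "eval (Sub a b) s = eval a s - eval b s"
| "eval (Mul a b) s = eval a s * eval b s"
| "eval (Div a b) s = eval a s div eval b s"
| "eval (Ar A i) s = arr s A (eval i s)"

text \<open>Code of expressions has no jumps, so one number is both its length and its running
  time.\<close>

fun ecost :: "exp \<Rightarrow> nat" where
  "ecost (N k) = 1"
| "ecost (V x) = 2"
| "ecost (Add a b) = ecost a + ecost b + 1"
| "ecost (Sub a b) = ecost a + ecost b + 1"
| "ecost (Mul a b) = ecost a + ecost b + 1"
| "ecost (Div a b) = ecost a + ecost b + 1"
| "ecost (Ar A i) = ecost i + 6"

abbreviation tick :: "nat \<Rightarrow> state \<Rightarrow> state" where
  "tick k s \<equiv> s\<lparr>clk := clk s + k\<rparr>"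

text \<open>The ghost components \<open>clk\<close> and \<open>trace\<close> record the time since the last event and, for all
  earlier events, the number of silent steps before them. Assigned values must not exceed \<open>X\<close>;
  this is what makes the intermediate results of all expressions fit into a word. Cell
  \<open>i\<close> of array number \<open>A\<close> lives at address \<open>32 * i + A\<close> behind the input \<open>xs\<close>.\<close>

inductive exec :: "nat list \<Rightarrow> nat \<Rightarrow> com \<Rightarrow> state \<Rightarrow> state \<Rightarrow> bool" for xs X where
  Skip: "exec xs X Skip s s"
| Assign: "eval e s \<le> X \<Longrightarrow>
    exec xs X (x ::= e) s (tick (ecost e + 2) (s\<lparr>vars := (vars s)(x := eval e s)\<rparr>))"
| Read: "eval e s < length xs \<Longrightarrow>
    exec xs X (Read x e) s (tick (ecost e + 1) (s\<lparr>vars := (vars s)(x := xs ! eval e s)\<rparr>))"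
| Store: "eval e s \<le> X \<Longrightarrow>
    exec xs X (A\<langle>i\<rangle> := e) s (tick (ecost i + ecost e + 6)
      (s\<lparr>arr := (arr s)(A := (arr s A)(eval i s := eval e s))\<rparr>))"
| Seq: "exec xs X c s s' \<Longrightarrow> exec xs X d s' s'' \<Longrightarrow> exec xs X (c ;; d) s s''"
| IfT: "eval e s \<noteq> 0 \<Longrightarrow> exec xs X c (tick (ecost e + 1) s) s' \<Longrightarrow>
    exec xs X (If e c d) s (tick 1 s')"
| IfF: "eval e s = 0 \<Longrightarrow> exec xs X d (tick (ecost e + 1) s) s' \<Longrightarrow> exec xs X (If e c d) s s'"
| WhileT: "eval e s \<noteq> 0 \<Longrightarrow> exec xs X c (tick (ecost e + 1) s) s' \<Longrightarrow>
    exec xs X (While e c) (tick 1 s') s'' \<Longrightarrow> exec xs X (While e c) s s''"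
| WhileF: "eval e s = 0 \<Longrightarrow> exec xs X (While e c) s (tick (ecost e + 1) s)"
| Rdy: "exec xs X Rdy s (s\<lparr>clk := 0, trace := trace s @ [(clk s, Ready)]\<rparr>)"
| Emit: "exec xs X (Emit a b) s
    (s\<lparr>clk := 0, trace := trace s @ [(clk s + ecost a + ecost b, Output (eval a s) (eval b s))]\<rparr>)"


section \<open>Compilation\<close>

text \<open>Register 0 is reserved for the input length, the base address of all arrays. Registers
  from 30 on form the stack on which expressions are evaluated.\<close>

fun vreg :: "var \<Rightarrow> nat" where
  "vreg Vn = 1" | "vreg Vq = 2" | "vreg Vm = 3" | "vreg Vs = 4" | "vreg Vk = 5" | "vreg Vi = 6"
| "vreg Vsp = 7" | "vreg Vtc = 8" | "vreg Vw = 9" | "vreg Vr1 = 10" | "vreg Vr2 = 11"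
| "vreg Vl = 12" | "vreg Ve = 13" | "vreg Vy = 14" | "vreg Vt = 15" | "vreg Vv = 16"
| "vreg Vec = 17" | "vreg Vx = 18" | "vreg Vqh = 19" | "vreg Vqt = 20" | "vreg Vst = 21"
| "vreg Vj = 22" | "vreg Vc = 23" | "vreg Vu = 24" | "vreg Vf = 25"

fun anum :: "ar \<Rightarrow> nat" where
  "anum Stk = 0" | "anum Nul = 1" | "anum Tp = 2" | "anum Tl = 3" | "anum Td = 4"
| "anum Flg = 5" | "anum Fh = 6" | "anum Fn = 7" | "anum Ft = 8" | "anum Bh = 9" | "anum Bn = 10"
| "anum Bt = 11" | "anum Bmk = 12" | "anum Ful = 13" | "anum Cnt = 14" | "anum Lst = 15"
| "anum Que = 16" | "anum Fmk = 17" | "anum Zer = 18"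

lemma vreg_inj [simp]: "vreg x = vreg y \<longleftrightarrow> x = y"
  by (cases x; cases y) simp_all

lemma vreg_bounds: "0 < vreg x" "vreg x < 30"
  by (cases x; simp)+

lemma vreg_neq [simp]: "vreg x \<noteq> 0" "vreg x \<noteq> 30" "vreg x \<noteq> 31"
  using vreg_bounds[of x] by linarith+

lemma anum_inj [simp]: "anum x = anum y \<longleftrightarrow> x = y"
  by (cases x; cases y) simp_all

lemma anum_less: "anum A < 32"
  by (cases A) simp_all

definition addr_code :: "ar \<Rightarrow> nat \<Rightarrow> instr list" where
  "addr_code A t =
    [SETC (t + 1) 32, MUL t t (t + 1), SETC (t + 1) (anum A), ADD t t (t + 1), ADD t t 0]"

lemma length_addr_code [simp]: "length (addr_code A t) = 5"
  by (simp add: addr_code_def)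

fun ecode :: "exp \<Rightarrow> nat \<Rightarrow> instr list" where
  "ecode (N k) t = [SETC t k]"
| "ecode (V x) t = [SETC t 0, ADD t t (vreg x)]"
| "ecode (Add a b) t = ecode a t @ ecode b (t + 1) @ [ADD t t (t + 1)]"
| "ecode (Sub a b) t = ecode a t @ ecode b (t + 1) @ [SUB t t (t + 1)]"
| "ecode (Mul a b) t = ecode a t @ ecode b (t + 1) @ [MUL t t (t + 1)]"
| "ecode (Div a b) t = ecode a t @ ecode b (t + 1) @ [DIV t t (t + 1)]"
| "ecode (Ar A i) t = ecode i t @ addr_code A t @ [LOAD t t]"

lemma length_ecode [simp]: "length (ecode e t) = ecost e"
  by (induction e arbitrary: t) auto

fun clen :: "com \<Rightarrow> nat" where
  "clen Skip = 0"
| "clen (x ::= e) = ecost e + 2"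
| "clen (Read x e) = ecost e + 1"
| "clen (A\<langle>i\<rangle> := e) = ecost i + ecost e + 6"
| "clen (c ;; d) = clen c + clen d"
| "clen (If e c d) = ecost e + 1 + clen c + 1 + clen d"
| "clen (While e c) = ecost e + 1 + clen c + 1"
| "clen Rdy = 1"
| "clen (Emit a b) = ecost a + ecost b + 1"

text \<open>The argument \<open>p\<close> is the absolute position of the code, needed because jump
  targets are literals. \<open>SETC 31 0\<close> followed by \<open>ADD\<close> is a register move,
  which the machine lacks as an instruction.\<close>

fun code_at :: "com \<Rightarrow> nat \<Rightarrow> instr list" where
  "code_at Skip p = []"
| "code_at (x ::= e) p = ecode e 30 @ [SETC 31 0, ADD (vreg x) 30 31]"
| "code_at (Read x e) p = ecode e 30 @ [LOAD (vreg x) 30]"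
| "code_at (A\<langle>i\<rangle> := e) p = ecode i 30 @ addr_code A 30 @ ecode e 31 @ [STORE 30 31]"
| "code_at (c ;; d) p = code_at c p @ code_at d (p + clen c)"
| "code_at (If e c d) p = ecode e 30 @ [JZERO 30 (p + ecost e + 1 + clen c + 1)] @
     code_at c (p + ecost e + 1) @ [JUMP (p + clen (If e c d))] @
     code_at d (p + ecost e + 1 + clen c + 1)"
| "code_at (While e c) p = ecode e 30 @ [JZERO 30 (p + clen (While e c))] @
     code_at c (p + ecost e + 1) @ [JUMP p]"
| "code_at Rdy p = [READY]"
| "code_at (Emit a b) p = ecode a 30 @ ecode b 31 @ [EMIT 30 31]"

lemma length_code_at [simp]: "length (code_at c p) = clen c"
  by (induction c arbitrary: p) auto

text \<open>If all variables and array cells are at most \<open>X\<close>, then the value of \<open>e\<close> and all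
  intermediate results of its computation are at most \<open>X ^ esize e\<close>.\<close>

fun esize :: "exp \<Rightarrow> nat" where
  "esize (N k) = k + 1"
| "esize (V x) = 1"
| "esize (Add a b) = esize a + esize b"
| "esize (Sub a b) = esize a + esize b"
| "esize (Mul a b) = esize a + esize b"
| "esize (Div a b) = esize a + esize b"
| "esize (Ar A i) = esize i + 12"

fun csize :: "com \<Rightarrow> nat" where
  "csize Skip = 0"
| "csize (x ::= e) = esize e"
| "csize (Read x e) = esize e"
| "csize (A\<langle>i\<rangle> := e) = esize i + esize e + 12"
| "csize (c ;; d) = csize c + csize d"
| "csize (If e c d) = esize e + csize c + csize d"
| "csize (While e c) = esize e + csize c"
| "csize Rdy = 0"
| "csize (Emit a b) = esize a + esize b"

definition bounded :: "nat \<Rightarrow> state \<Rightarrow> bool" where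
  "bounded X s \<longleftrightarrow> (\<forall>x. vars s x \<le> X) \<and> (\<forall>A i. arr s A i \<le> X)"

lemma bounded_clk [simp]: "bounded X (s\<lparr>clk := k\<rparr>) \<longleftrightarrow> bounded X s"
  by (simp add: bounded_def)

lemma esize_pos [simp]: "0 < esize e"
  by (induction e) auto

text \<open>Both powers are at least 2, and the sum of two such numbers is at most their product.
  This lets one exponent absorb sums as well as products.\<close>

lemma power_add_le:
  fixes X :: nat
  assumes "2 \<le> X" "0 < a" "0 < b"
  shows "X ^ a + X ^ b \<le> X ^ (a + b)"
proof -
  have *: "2 \<le> X ^ c" if "0 < c" for c
    using that assms(1) power_increasing[of 1 c X] by simp
  obtain u v where uv: "X ^ a = u + 2" "X ^ b = v + 2"
    using *[OF assms(2)] *[OF assms(3)] by (metis le_Suc_ex add.commute)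
  show ?thesis unfolding power_add uv by (simp add: algebra_simps)
qed

lemma eval_le:
  assumes "2 \<le> X" "bounded X s"
  shows "eval e s \<le> X ^ esize e"
proof (induction e)
  case (N k)
  have "k < 2 ^ k" by (rule less_exp)
  also have "\<dots> \<le> X ^ k" using assms(1) by (rule power_mono) simp
  also have "\<dots> \<le> X ^ (k + 1)" using assms(1) by (intro power_increasing) auto
  finally show ?case by simp
next
  case (V x)
  then show ?case using assms(2) by (simp add: bounded_def)
next
  case (Add a b)
  then show ?case using power_add_le[OF assms(1), of "esize a" "esize b"] by simp
next
  case (Sub a b)
  then show ?case using power_add_le[OF assms(1), of "esize a" "esize b"] by simp
next
  case (Mul a b)
  then show ?case by (simp add: power_add mult_le_mono)
next
  case (Div a b)
  have "eval a s div eval b s \<le> eval a s" by simp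
  then show ?case using Div power_add_le[OF assms(1), of "esize a" "esize b"]
    by (simp del: div_le_dividend)
next
  case (Ar A i)
  have "X ^ 1 \<le> X ^ (esize i + 12)" using assms(1) by (intro power_increasing) auto
  then show ?case using assms(2) unfolding bounded_def by (simp) (meson order_trans)
qed

section \<open>Code fragments inside a program\<close>

definition sits :: "instr list \<Rightarrow> nat \<Rightarrow> instr list \<Rightarrow> bool" where
  "sits P p is \<longleftrightarrow> (\<forall>i<length is. p + i < length P \<and> P ! (p + i) = is ! i)"

lemma sits_append: "sits P p (is @ js) \<longleftrightarrow> sits P p is \<and> sits P (p + length is) js"
proof
  assume *: "sits P p (is @ js)"
  show "sits P p is \<and> sits P (p + length is) js"
    unfolding sits_def
  proof (intro conjI allI impI)
    fix i assume "i < length is"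
    then show "p + i < length P" "P ! (p + i) = is ! i"
      using * unfolding sits_def by (auto simp: nth_append dest: spec[of _ i])
  next
    fix i assume "i < length js"
    then show "p + length is + i < length P" "P ! (p + length is + i) = js ! i"
      using * unfolding sits_def by (auto simp: nth_append ac_simps dest: spec[of _ "length is + i"])
  qed
next
  assume *: "sits P p is \<and> sits P (p + length is) js"
  show "sits P p (is @ js)"
    unfolding sits_def
  proof (intro allI impI)
    fix i assume i: "i < length (is @ js)"
    show "p + i < length P \<and> P ! (p + i) = (is @ js) ! i"
    proof (cases "i < length is")
      case True
      then show ?thesis using * unfolding sits_def by (simp add: nth_append)
    next
      case False
      then show ?thesis using * i unfolding sits_def
        by (auto simp: nth_append dest: conjunct2 spec[of _ "i - length is"])
    qed
  qed
qed

lemma sits_Nil [simp]: "sits P p []"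
  by (simp add: sits_def)

lemma sits_single: "sits P p [i] \<longleftrightarrow> p < length P \<and> P ! p = i"
  by (simp add: sits_def)

lemma sits_Cons: "sits P p (i # is) \<longleftrightarrow> (p < length P \<and> P ! p = i) \<and> sits P (Suc p) is"
  using sits_append[of P p "[i]" "is"] by (simp add: sits_single)

section \<open>Correctness of the compiled code when all stored values are at most X\<close>

locale machine =
  fixes w :: nat and P :: "instr list" and xs :: "nat list" and X :: nat
  assumes X2: "2 \<le> X" and length_le: "length xs \<le> X" and xs_le: "x \<in> set xs \<Longrightarrow> x \<le> X"
begin

text \<open>Phrased through continuations to full runs: composing code pieces becomes appending
  event lists, and no separate step relation is required.\<close>

definition reaches :: "config \<Rightarrow> event list \<Rightarrow> config \<Rightarrow> bool" where
  "reaches c es c' \<longleftrightarrow> (\<forall>fs. run w P c' fs \<longrightarrow> run w P c (es @ fs))"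

lemma reaches_refl [simp]: "reaches c [] c"
  by (simp add: reaches_def)

lemma reaches_reflI: "c = c' \<Longrightarrow> reaches c [] c'"
  by simp

lemma reaches_trans: "reaches c es c' \<Longrightarrow> reaches c' fs c'' \<Longrightarrow> reaches c (es @ fs) c''"
  by (simp add: reaches_def)

lemma reaches_step:
  "pc c < length P \<Longrightarrow> exec_instr w (P ! pc c) c = Some (e, c') \<Longrightarrow> reaches c' es c'' \<Longrightarrow>
   reaches c (e # es) c''"
  by (auto simp: reaches_def intro: run.step)

text \<open>Registers from 30 on are unconstrained, so evaluating an expression preserves the
  simulation.\<close>

definition sim :: "state \<Rightarrow> config \<Rightarrow> bool" where
  "sim s c \<longleftrightarrow> reg c 0 = length xs \<and> (\<forall>x. reg c (vreg x) = vars s x) \<and>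
     (\<forall>A i. mem c (32 * i + anum A + length xs) = arr s A i) \<and> (\<forall>i<length xs. mem c i = xs ! i)"

text \<open>Origin of the 12 in \<open>esize\<close>: the factor 32 is at most \<open>X ^ 5\<close>,
  the array number is absorbed by five more powers, and the base address, at most X, by the
  remaining two.\<close>

lemma addr_le:
  assumes "i \<le> X ^ k" "0 < k"
  shows "32 * i \<le> X ^ (k + 5)" "32 * i + anum A \<le> X ^ (k + 10)"
    "32 * i + anum A + length xs \<le> X ^ (k + 12)" "32 \<le> X ^ (k + 5)" "anum A \<le> X ^ (k + 5)"
proof -
  have "(2::nat) ^ 5 \<le> X ^ 5" using X2 by (rule power_mono) simp
  then have X5: "32 \<le> X ^ 5" by simp
  have mono: "X ^ a \<le> X ^ b" if "a \<le> b" for a b using that X2 by (intro power_increasing) auto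
  have m: "32 * i \<le> X ^ 5 * X ^ k" using X5 assms(1) by (rule mult_le_mono)
  then show a: "32 * i \<le> X ^ (k + 5)" by (simp add: power_add mult.commute)
  show b: "32 \<le> X ^ (k + 5)" using X5 mono[of 5 "k + 5"] by simp
  then show d: "anum A \<le> X ^ (k + 5)" using anum_less[of A] by linarith
  have "32 * i + anum A \<le> X ^ (k + 5) + X ^ 5" using a X5 anum_less[of A] by linarith
  also have "\<dots> \<le> X ^ (k + 5 + 5)" using X2 by (intro power_add_le) auto
  finally show e: "32 * i + anum A \<le> X ^ (k + 10)" by (simp add: add.commute)
  have "32 * i + anum A + length xs \<le> X ^ (k + 10) + X ^ 1" using e length_le by simp
  also have "\<dots> \<le> X ^ (k + 10 + 1)" using X2 by (intro power_add_le) auto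
  also have "\<dots> \<le> X ^ (k + 12)" by (intro mono) simp
  finally show "32 * i + anum A + length xs \<le> X ^ (k + 12)" .
qed

lemma sim_reg: "sim s c \<Longrightarrow> \<forall>j<30. r j = reg c j \<Longrightarrow> sim s (c\<lparr>pc := p, reg := r\<rparr>)"
  using vreg_bounds by (auto simp: sim_def)

lemma addr_code_reaches:
  assumes "sits P (pc c) (addr_code A t)" "reg c t = i" "i \<le> X ^ k" "0 < k" "X ^ (k + 12) < 2 ^ w"
    "reg c 0 = length xs" "30 \<le> t"
  shows "\<exists>r. reaches c (replicate 5 Silent) (c\<lparr>pc := pc c + 5, reg := r\<rparr>) \<and>
    r t = 32 * i + anum A + length xs \<and> (\<forall>j<t. r j = reg c j)"
proof -
  have mono: "X ^ a < 2 ^ w" if "a \<le> k + 12" for a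
    using that X2 assms(5) power_increasing[of a "k + 12" X] by linarith
  note b = addr_le[OF assms(3,4)]
  have b': "32 * i < 2 ^ w" "32 * i + anum A < 2 ^ w" "32 * i + anum A + length xs < 2 ^ w"
    "32 < (2::nat) ^ w" "anum A < 2 ^ w"
    using b(1,4) b(2,3,5)[of A] mono[of "k + 5"] mono[of "k + 10"] mono[of "k + 12"] by linarith+
  let ?r = "(reg c)(t := 32 * i + anum A + length xs, Suc t := anum A)"
  have "reaches c (replicate 5 Silent) (c\<lparr>pc := pc c + 5, reg := ?r\<rparr>)"
    using assms(1,2,6,7) b'
    by (auto simp: addr_code_def sits_Cons set_reg_def numeral_eq_Suc mult.commute fun_upd_twist
        intro!: reaches_step)
  then show ?thesis by (intro exI[of _ ?r]) (simp)
qed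


lemma power_word_mono: "X ^ k < 2 ^ w \<Longrightarrow> j \<le> k \<Longrightarrow> X ^ j < 2 ^ w"
  using X2 power_increasing[of j k X] by linarith

text \<open>The pattern shared by the four operators: the right operand is evaluated one register
  higher and thus preserves the left value in register \<open>t\<close>.\<close>

lemma ecode_binop_reaches:
  assumes "reaches c (replicate m Silent) (c\<lparr>pc := pc c + m, reg := r\<rparr>)" "\<forall>j<t. r j = reg c j"
    and "reaches (c\<lparr>pc := pc c + m, reg := r\<rparr>) (replicate n Silent) (c\<lparr>pc := pc c + m + n, reg := r'\<rparr>)"
    "\<forall>j<Suc t. r' j = r j"
    and "sits P (pc c + m + n) [i]" "y < 2 ^ w"
    "\<And>c'. reg c' = r' \<Longrightarrow> exec_instr w i c' = set_reg w t y c'"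
  shows "\<exists>r. reaches c (replicate (m + n + 1) Silent) (c\<lparr>pc := pc c + (m + n + 1), reg := r\<rparr>) \<and>
    r t = y \<and> (\<forall>j<t. r j = reg c j)"
proof -
  let ?c = "c\<lparr>pc := pc c + m + n, reg := r'\<rparr>"
  have "reaches ?c [Silent] (?c\<lparr>pc := pc c + (m + n + 1), reg := r'(t := y)\<rparr>)"
    using assms(5-) by (intro reaches_step[OF _ _ reaches_refl]) (auto simp: sits_single set_reg_def)
  from reaches_trans[OF assms(1) reaches_trans[OF assms(3) this]]
  have "reaches c (replicate (m + n + 1) Silent) (c\<lparr>pc := pc c + (m + n + 1), reg := r'(t := y)\<rparr>)"
    using replicate_add[of m "n + 1" Silent] replicate_add[of n 1 Silent] by simp
  then show ?thesis using assms(2,4) by (intro exI[of _ "r'(t := y)"]) simp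
qed

text \<open>The clause on registers below \<open>t\<close> is the stack discipline that carries the
  induction; it also shows that program variables survive.\<close>

lemma ecode_reaches:
  assumes "bounded X s"
  shows "sits P (pc c) (ecode e t) \<Longrightarrow> sim s c \<Longrightarrow> 30 \<le> t \<Longrightarrow> X ^ esize e < 2 ^ w \<Longrightarrow>
    \<exists>r. reaches c (replicate (ecost e) Silent) (c\<lparr>pc := pc c + ecost e, reg := r\<rparr>) \<and>
      r t = eval e s \<and> (\<forall>j<t. r j = reg c j)"
proof (induction e arbitrary: t c)
  case (N k)
  have "k < 2 ^ w" using eval_le[OF X2 assms, of "N k"] N by simp
  then show ?case using N
    by (intro exI[of _ "(reg c)(t := k)"])
      (auto simp: sits_single set_reg_def fun_upd_def intro!: reaches_step)
next
  case (V x)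
  have "vars s x < 2 ^ w" using eval_le[OF X2 assms, of "V x"] V by simp
  then show ?case using V vreg_bounds[of x]
    by (intro exI[of _ "(reg c)(t := vars s x)"])
      (auto simp: sits_Cons set_reg_def sim_def numeral_2_eq_2 fun_eq_iff 
          intro!: reaches_step reaches_reflI)
next
  case (Ar A i)
  have w: "X ^ (esize i + 12) < 2 ^ w" using Ar.prems by simp
  then have "X ^ esize i < 2 ^ w"
    using X2 power_increasing[of "esize i" "esize i + 12" X] by linarith
  then obtain r where r: "reaches c (replicate (ecost i) Silent) (c\<lparr>pc := pc c + ecost i, reg := r\<rparr>)"
    "r t = eval i s" "\<forall>j<t. r j = reg c j"
    using Ar.IH[of c t] Ar.prems by (auto simp: sits_append)
  let ?c = "c\<lparr>pc := pc c + ecost i, reg := r\<rparr>"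
  obtain r' where r': "reaches ?c (replicate 5 Silent) (?c\<lparr>pc := pc ?c + 5, reg := r'\<rparr>)"
    "r' t = 32 * eval i s + anum A + length xs" "\<forall>j<t. r' j = reg ?c j"
    using addr_code_reaches[of ?c A t "eval i s" "esize i"] eval_le[OF X2 assms, of i] w Ar.prems r
    by (auto simp: sits_append sim_def)
  let ?c' = "?c\<lparr>pc := pc ?c + 5, reg := r'\<rparr>"
  have ld: "arr s A (eval i s) < 2 ^ w"
    using eval_le[OF X2 assms, of "Ar A i"] Ar.prems by (metis eval.simps(7) le_less_trans)
  let ?r = "r'(t := arr s A (eval i s))"
  have "reaches ?c' [Silent] (?c'\<lparr>pc := pc ?c' + 1, reg := ?r\<rparr>)"
    using Ar.prems r'(2) ld
    by (intro reaches_step[where c'="?c'\<lparr>pc := pc ?c' + 1, reg := ?r\<rparr>"])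
      (auto simp: sits_append sits_Cons sits_single set_reg_def sim_def numeral_eq_Suc)
  from reaches_trans[OF r(1) reaches_trans[OF r'(1) this]]
  have "reaches c (replicate (ecost (Ar A i)) Silent) (c\<lparr>pc := pc c + ecost (Ar A i), reg := ?r\<rparr>)"
    using replicate_add[of "ecost i" 6 Silent] by (simp add: numeral_eq_Suc)
  moreover have "?r t = eval (Ar A i) s" "\<forall>j<t. ?r j = reg c j" using r r' by auto
  ultimately show ?case by (intro exI[of _ ?r] conjI)
next
  case (Add a b)
  have "X ^ esize a < 2 ^ w" "X ^ esize b < 2 ^ w"
    using power_word_mono[of "esize a + esize b"] Add.prems by simp_all
  note w = this
  obtain r where r: "reaches c (replicate (ecost a) Silent) (c\<lparr>pc := pc c + ecost a, reg := r\<rparr>)"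
    "r t = eval a s" "\<forall>j<t. r j = reg c j"
    using Add.IH(1)[of c t] Add.prems w by (auto simp: sits_append)
  moreover obtain r' where "reaches (c\<lparr>pc := pc c + ecost a, reg := r\<rparr>) (replicate (ecost b) Silent)
      (c\<lparr>pc := pc c + ecost a + ecost b, reg := r'\<rparr>)"
    "r' (Suc t) = eval b s" "\<forall>j<Suc t. r' j = r j"
    using Add.IH(2)[of "c\<lparr>pc := pc c + ecost a, reg := r\<rparr>" "Suc t"] Add.prems w r sim_reg[of s c r]
    by (auto simp: sits_append)
  moreover have "eval (Add a b) s < 2 ^ w"
    using eval_le[OF X2 assms, of "Add a b"] Add.prems by (metis le_less_trans)
  ultimately show ?case
    using Add.prems ecode_binop_reaches[of c "ecost a" r t "ecost b" r' "ADD t t (Suc t)" "eval (Add a b) s"]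
    by (auto simp: sits_append ac_simps)
next
  case (Sub a b)
  have "X ^ esize a < 2 ^ w" "X ^ esize b < 2 ^ w"
    using power_word_mono[of "esize a + esize b"] Sub.prems by simp_all
  note w = this
  obtain r where r: "reaches c (replicate (ecost a) Silent) (c\<lparr>pc := pc c + ecost a, reg := r\<rparr>)"
    "r t = eval a s" "\<forall>j<t. r j = reg c j"
    using Sub.IH(1)[of c t] Sub.prems w by (auto simp: sits_append)
  moreover obtain r' where "reaches (c\<lparr>pc := pc c + ecost a, reg := r\<rparr>) (replicate (ecost b) Silent)
      (c\<lparr>pc := pc c + ecost a + ecost b, reg := r'\<rparr>)"
    "r' (Suc t) = eval b s" "\<forall>j<Suc t. r' j = r j"
    using Sub.IH(2)[of "c\<lparr>pc := pc c + ecost a, reg := r\<rparr>" "Suc t"] Sub.prems w r sim_reg[of s c r]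
    by (auto simp: sits_append)
  moreover have "eval (Sub a b) s < 2 ^ w"
    using eval_le[OF X2 assms, of "Sub a b"] Sub.prems by (metis le_less_trans)
  ultimately show ?case
    using Sub.prems ecode_binop_reaches[of c "ecost a" r t "ecost b" r' "SUB t t (Suc t)" "eval (Sub a b) s"]
    by (auto simp: sits_append ac_simps)
next
  case (Mul a b)
  have "X ^ esize a < 2 ^ w" "X ^ esize b < 2 ^ w"
    using power_word_mono[of "esize a + esize b"] Mul.prems by simp_all
  note w = this
  obtain r where r: "reaches c (replicate (ecost a) Silent) (c\<lparr>pc := pc c + ecost a, reg := r\<rparr>)"
    "r t = eval a s" "\<forall>j<t. r j = reg c j"
    using Mul.IH(1)[of c t] Mul.prems w by (auto simp: sits_append)
  moreover obtain r' where "reaches (c\<lparr>pc := pc c + ecost a, reg := r\<rparr>) (replicate (ecost b) Silent)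
      (c\<lparr>pc := pc c + ecost a + ecost b, reg := r'\<rparr>)"
    "r' (Suc t) = eval b s" "\<forall>j<Suc t. r' j = r j"
    using Mul.IH(2)[of "c\<lparr>pc := pc c + ecost a, reg := r\<rparr>" "Suc t"] Mul.prems w r sim_reg[of s c r]
    by (auto simp: sits_append)
  moreover have "eval (Mul a b) s < 2 ^ w"
    using eval_le[OF X2 assms, of "Mul a b"] Mul.prems by (metis le_less_trans)
  ultimately show ?case
    using Mul.prems ecode_binop_reaches[of c "ecost a" r t "ecost b" r' "MUL t t (Suc t)" "eval (Mul a b) s"]
    by (auto simp: sits_append ac_simps)
next
  case (Div a b)
  have "X ^ esize a < 2 ^ w" "X ^ esize b < 2 ^ w"
    using power_word_mono[of "esize a + esize b"] Div.prems by simp_all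
  note w = this
  obtain r where r: "reaches c (replicate (ecost a) Silent) (c\<lparr>pc := pc c + ecost a, reg := r\<rparr>)"
    "r t = eval a s" "\<forall>j<t. r j = reg c j"
    using Div.IH(1)[of c t] Div.prems w by (auto simp: sits_append)
  moreover obtain r' where "reaches (c\<lparr>pc := pc c + ecost a, reg := r\<rparr>) (replicate (ecost b) Silent)
      (c\<lparr>pc := pc c + ecost a + ecost b, reg := r'\<rparr>)"
    "r' (Suc t) = eval b s" "\<forall>j<Suc t. r' j = r j"
    using Div.IH(2)[of "c\<lparr>pc := pc c + ecost a, reg := r\<rparr>" "Suc t"] Div.prems w r sim_reg[of s c r]
    by (auto simp: sits_append)
  moreover have "eval (Div a b) s < 2 ^ w"
    using eval_le[OF X2 assms, of "Div a b"] Div.prems by (metis le_less_trans)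
  ultimately show ?case
    using Div.prems ecode_binop_reaches[of c "ecost a" r t "ecost b" r' "DIV t t (Suc t)" "eval (Div a b) s"]
    by (auto simp: sits_append ac_simps)
qed

lemma bounded_exec: "exec xs X c s s' \<Longrightarrow> bounded X s \<Longrightarrow> bounded X s'"
  by (induction rule: exec.induct) (auto simp: bounded_def intro: xs_le)

text \<open>Expands the ghost clock and trace into the event list of the machine.\<close>

definition hist :: "state \<Rightarrow> event list" where
  "hist s = concat (map (\<lambda>(k, e). replicate k Silent @ [e]) (trace s)) @ replicate (clk s) Silent"

lemma hist_tick: "trace s' = trace s \<Longrightarrow> clk s' = clk s + k \<Longrightarrow> hist s' = hist s @ replicate k Silent"
  by (simp add: hist_def replicate_add)

lemma sim_clk [simp]: "sim (s\<lparr>clk := k\<rparr>) c \<longleftrightarrow> sim s c"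
  by (simp add: sim_def)

lemma cond_reaches:
  assumes "bounded X s" "sits P (pc c) (ecode e 30 @ [JZERO 30 l])" "sim s c" "X ^ esize e < 2 ^ w"
  shows "\<exists>c'. reaches c (replicate (ecost e + 1) Silent) c' \<and> sim s c' \<and>
    pc c' = (if eval e s = 0 then l else pc c + ecost e + 1)"
proof -
  obtain r where r: "reaches c (replicate (ecost e) Silent) (c\<lparr>pc := pc c + ecost e, reg := r\<rparr>)"
    "r 30 = eval e s" "\<forall>j<30. r j = reg c j"
    using ecode_reaches[OF assms(1), of c e 30] assms by (auto simp: sits_append)
  let ?c = "c\<lparr>pc := pc c + ecost e, reg := r\<rparr>"
  let ?c' = "c\<lparr>pc := if eval e s = 0 then l else pc c + ecost e + 1, reg := r\<rparr>"
  have "reaches ?c [Silent] ?c'"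
    using assms(2) r(2) by (intro reaches_step[OF _ _ reaches_refl]) (auto simp: sits_append sits_single)
  from reaches_trans[OF r(1) this] show ?thesis
    using sim_reg[OF assms(3) r(3)] by (intro exI[of _ ?c']) (simp add: replicate_append_same)
qed

lemma jump_reaches:
  assumes "sits P (pc c) [JUMP l]"
  shows "reaches c [Silent] (c\<lparr>pc := l\<rparr>)"
  using assms by (intro reaches_step[OF _ _ reaches_refl]) (auto simp: sits_single)

lemma compile_Assign:
  assumes "bounded X s" "sits P (pc c) (code_at (x ::= e) (pc c))" "sim s c" "X ^ esize e < 2 ^ w"
  shows "\<exists>c'. reaches c (replicate (ecost e + 2) Silent) c' \<and> pc c' = pc c + (ecost e + 2) \<and>
    sim (s\<lparr>vars := (vars s)(x := eval e s)\<rparr>) c'"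
proof -
  obtain r where r: "reaches c (replicate (ecost e) Silent) (c\<lparr>pc := pc c + ecost e, reg := r\<rparr>)"
    "r 30 = eval e s" "\<forall>j<30. r j = reg c j"
    using ecode_reaches[OF assms(1), of c e 30] assms by (auto simp: sits_append)
  let ?c = "c\<lparr>pc := pc c + ecost e, reg := r\<rparr>"
  let ?c' = "c\<lparr>pc := pc c + (ecost e + 2), reg := r(31 := 0, vreg x := eval e s)\<rparr>"
  have "eval e s < 2 ^ w" using eval_le[OF X2 assms(1), of e] assms(4) by linarith
  then have "reaches ?c [Silent, Silent] ?c'"
    using assms(2) r(2) vreg_bounds[of x]
    by (intro reaches_step[OF _ _ reaches_step[OF _ _ reaches_refl]])
      (auto simp: sits_append sits_Cons sits_single set_reg_def)
  from reaches_trans[OF r(1) this] show ?thesis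
    using r(2,3) assms(3) vreg_bounds replicate_add[of "ecost e" 2 Silent]
    by (intro exI[of _ ?c'])
      (auto simp: sim_def numeral_2_eq_2 replicate_append_same less_imp_neq)
qed

lemma compile_Read:
  assumes "bounded X s" "sits P (pc c) (code_at (Read x e) (pc c))" "sim s c" "X ^ esize e < 2 ^ w"
    "eval e s < length xs"
  shows "\<exists>c'. reaches c (replicate (ecost e + 1) Silent) c' \<and> pc c' = pc c + (ecost e + 1) \<and>
    sim (s\<lparr>vars := (vars s)(x := xs ! eval e s)\<rparr>) c'"
proof -
  obtain r where r: "reaches c (replicate (ecost e) Silent) (c\<lparr>pc := pc c + ecost e, reg := r\<rparr>)"
    "r 30 = eval e s" "\<forall>j<30. r j = reg c j"
    using ecode_reaches[OF assms(1), of c e 30] assms by (auto simp: sits_append)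
  let ?c = "c\<lparr>pc := pc c + ecost e, reg := r\<rparr>"
  let ?c' = "c\<lparr>pc := pc c + (ecost e + 1), reg := r(vreg x := xs ! eval e s)\<rparr>"
  have "xs ! eval e s \<le> X ^ 1" using xs_le assms(5) by simp
  also have "X ^ 1 < 2 ^ w" using power_word_mono[OF assms(4), of 1] esize_pos[of e] by (simp add: Suc_le_eq)
  finally have "reaches ?c [Silent] ?c'"
    using assms(2,3,5) r(2)
    by (intro reaches_step[OF _ _ reaches_refl])
      (auto simp: sits_append sits_Cons sits_single set_reg_def sim_def)
  from reaches_trans[OF r(1) this] show ?thesis
    using r(2,3) assms(3) vreg_bounds replicate_add[of "ecost e" 1 Silent]
    by (intro exI[of _ ?c']) (auto simp: sim_def replicate_append_same less_imp_neq)
qed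

lemma ecode2_reaches:
  assumes "bounded X s" "sits P (pc c) (ecode a 30 @ ecode b 31)" "sim s c"
    "X ^ (esize a + esize b) < 2 ^ w"
  shows "\<exists>r. reaches c (replicate (ecost a + ecost b) Silent)
      (c\<lparr>pc := pc c + ecost a + ecost b, reg := r\<rparr>) \<and>
    r 30 = eval a s \<and> r 31 = eval b s \<and> (\<forall>j<30. r j = reg c j)"
proof -
  have w: "X ^ esize a < 2 ^ w" "X ^ esize b < 2 ^ w"
    using power_word_mono[OF assms(4)] by simp_all
  obtain r where r: "reaches c (replicate (ecost a) Silent) (c\<lparr>pc := pc c + ecost a, reg := r\<rparr>)"
    "r 30 = eval a s" "\<forall>j<30. r j = reg c j"
    using ecode_reaches[OF assms(1), of c a 30] assms w by (auto simp: sits_append)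
  let ?c = "c\<lparr>pc := pc c + ecost a, reg := r\<rparr>"
  obtain r' where r': "reaches ?c (replicate (ecost b) Silent) (?c\<lparr>pc := pc ?c + ecost b, reg := r'\<rparr>)"
    "r' 31 = eval b s" "\<forall>j<31. r' j = reg ?c j"
    using ecode_reaches[OF assms(1), of ?c b 31] assms w sim_reg[OF assms(3) r(3)]
    by (auto simp: sits_append)
  from reaches_trans[OF r(1) r'(1)] show ?thesis
    using r r' by (intro exI[of _ r']) (simp add: replicate_add)
qed

lemma compile_Store:
  assumes "bounded X s" "sits P (pc c) (code_at (A\<langle>i\<rangle> := e) (pc c))" "sim s c"
    "X ^ (esize i + esize e + 12) < 2 ^ w"
  shows "\<exists>c'. reaches c (replicate (ecost i + ecost e + 6) Silent) c' \<and>
    pc c' = pc c + (ecost i + ecost e + 6) \<and>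
    sim (s\<lparr>arr := (arr s)(A := (arr s A)(eval i s := eval e s))\<rparr>) c'"
proof -
  have w: "X ^ esize i < 2 ^ w" "X ^ esize e < 2 ^ w" "X ^ (esize i + 12) < 2 ^ w"
    using power_word_mono[OF assms(4)] by simp_all
  obtain r where r: "reaches c (replicate (ecost i) Silent) (c\<lparr>pc := pc c + ecost i, reg := r\<rparr>)"
    "r 30 = eval i s" "\<forall>j<30. r j = reg c j"
    using ecode_reaches[OF assms(1), of c i 30] assms w by (auto simp: sits_append)
  let ?c = "c\<lparr>pc := pc c + ecost i, reg := r\<rparr>"
  obtain r' where r': "reaches ?c (replicate 5 Silent) (?c\<lparr>pc := pc ?c + 5, reg := r'\<rparr>)"
    "r' 30 = 32 * eval i s + anum A + length xs" "\<forall>j<30. r' j = reg ?c j"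
    using addr_code_reaches[of ?c A 30 "eval i s" "esize i"] eval_le[OF X2 assms(1), of i] assms w r
    by (auto simp: sits_append sim_def)
  let ?c' = "?c\<lparr>pc := pc ?c + 5, reg := r'\<rparr>"
  have s: "sim s ?c'" using sim_reg[OF assms(3), of r' "pc ?c + 5"] r(3) r'(3) by simp
  obtain r'' where r'': "reaches ?c' (replicate (ecost e) Silent) (?c'\<lparr>pc := pc ?c' + ecost e, reg := r''\<rparr>)"
    "r'' 31 = eval e s" "\<forall>j<31. r'' j = reg ?c' j"
    using ecode_reaches[OF assms(1), of ?c' e 31] assms w s by (auto simp: sits_append ac_simps)
  let ?c'' = "?c'\<lparr>pc := pc ?c' + ecost e, reg := r''\<rparr>"
  let ?d = "?c''\<lparr>pc := pc ?c'' + 1, mem := (mem c)(32 * eval i s + anum A + length xs := eval e s)\<rparr>"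
  have "reaches ?c'' [Silent] ?d"
    using assms(2) r'(2) r''(2,3)
    by (intro reaches_step[OF _ _ reaches_refl])
      (auto simp: sits_append sits_Cons sits_single ac_simps)
  have "replicate (ecost i + ecost e + 6) Silent =
      replicate (ecost i) Silent @ replicate 5 Silent @ replicate (ecost e) Silent @ [Silent]"
    by (rule replicate_eqI[symmetric]) auto
  then have 1: "reaches c (replicate (ecost i + ecost e + 6) Silent) ?d"
    using reaches_trans[OF r(1) reaches_trans[OF r'(1) reaches_trans[OF r''(1) \<open>reaches _ [Silent] _\<close>]]]
    by simp
  \<comment> \<open>Array numbers are remainders modulo 32, so distinct cells never share an
    address.\<close>
  have inj: "32 * j + anum B = 32 * k + anum A \<longleftrightarrow> j = k \<and> B = A" for j k B
  proof
    assume "32 * j + anum B = 32 * k + anum A"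
    then have "anum B = anum A" using anum_less[of A] anum_less[of B] by presburger
    then show "j = k \<and> B = A" using \<open>32 * j + anum B = 32 * k + anum A\<close> by simp
  qed simp
  have "sim (s\<lparr>arr := (arr s)(A := (arr s A)(eval i s := eval e s))\<rparr>) ?d"
    using s r''(3) less_trans[OF vreg_bounds(2), of 31] unfolding sim_def
    by (auto simp: inj)
  then show ?thesis using 1 by (intro exI[of _ ?d]) simp
qed

text \<open>Induction over the big-step execution, so only terminating computations have to be
  simulated. The equation for \<open>hist\<close> transfers running time and outputs together, and
  the bound on \<open>X ^ csize c\<close> excludes every stuck instruction.\<close>

theorem compile:
  "exec xs X c s s' \<Longrightarrow> bounded X s \<Longrightarrow> sim s g \<Longrightarrow> sits P (pc g) (code_at c (pc g)) \<Longrightarrow>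
   X ^ csize c < 2 ^ w \<Longrightarrow>
   \<exists>g' es. reaches g es g' \<and> sim s' g' \<and> pc g' = pc g + clen c \<and> hist s' = hist s @ es"
proof (induction arbitrary: g rule: exec.induct)
  case (Skip s)
  then show ?case by (intro exI[of _ g] exI[of _ "[]"]) simp
next
  case (Assign e s x)
  then obtain c' where "reaches g (replicate (ecost e + 2) Silent) c'" "pc c' = pc g + (ecost e + 2)"
    "sim (s\<lparr>vars := (vars s)(x := eval e s)\<rparr>) c'"
    using compile_Assign[of s g x e] by auto
  moreover have "sim (tick (ecost e + 2) (s\<lparr>vars := (vars s)(x := eval e s)\<rparr>)) c'"
    using calculation(3) by (simp only: sim_clk)
  moreover have "hist (tick (ecost e + 2) (s\<lparr>vars := (vars s)(x := eval e s)\<rparr>)) = hist s @ replicate (ecost e + 2) Silent"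
    by (rule hist_tick) simp_all
  ultimately show ?case unfolding clen.simps by (intro exI conjI)
next
  case (Read e s x)
  then obtain c' where "reaches g (replicate (ecost e + 1) Silent) c'" "pc c' = pc g + (ecost e + 1)"
    "sim (s\<lparr>vars := (vars s)(x := xs ! eval e s)\<rparr>) c'"
    using compile_Read[of s g x e] by auto
  moreover have "sim (tick (ecost e + 1) (s\<lparr>vars := (vars s)(x := xs ! eval e s)\<rparr>)) c'"
    using calculation(3) by (simp only: sim_clk)
  moreover have "hist (tick (ecost e + 1) (s\<lparr>vars := (vars s)(x := xs ! eval e s)\<rparr>)) = hist s @ replicate (ecost e + 1) Silent"
    by (rule hist_tick) simp_all
  ultimately show ?case unfolding clen.simps by (intro exI conjI)
next
  case (Store e s A i)
  then obtain c' where "reaches g (replicate (ecost i + ecost e + 6) Silent) c'"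
    "pc c' = pc g + (ecost i + ecost e + 6)"
    "sim (s\<lparr>arr := (arr s)(A := (arr s A)(eval i s := eval e s))\<rparr>) c'"
    using compile_Store[of s g A i e] by auto
  moreover have "sim (tick (ecost i + ecost e + 6) (s\<lparr>arr := (arr s)(A := (arr s A)(eval i s := eval e s))\<rparr>)) c'"
    using calculation(3) by (simp only: sim_clk)
  moreover have "hist (tick (ecost i + ecost e + 6) (s\<lparr>arr := (arr s)(A := (arr s A)(eval i s := eval e s))\<rparr>)) = hist s @ replicate (ecost i + ecost e + 6) Silent"
    by (rule hist_tick) simp_all
  ultimately show ?case unfolding clen.simps by (intro exI conjI)
next
  case (Seq c s s' d s'')
  have w: "X ^ csize c < 2 ^ w" "X ^ csize d < 2 ^ w" using power_word_mono[OF Seq.prems(4)] by simp_all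
  obtain g' es where 1: "reaches g es g'" "sim s' g'" "pc g' = pc g + clen c" "hist s' = hist s @ es"
    using Seq.IH(1)[of g] Seq.prems w by (auto simp: sits_append)
  obtain g'' fs where 2: "reaches g' fs g''" "sim s'' g''" "pc g'' = pc g' + clen d"
    "hist s'' = hist s' @ fs"
    using Seq.IH(2)[of g'] Seq.prems w 1 bounded_exec[OF Seq.hyps(1)] by (auto simp: sits_append)
  show ?case using 1 2 reaches_trans[OF 1(1) 2(1)]
    by (intro exI[of _ g''] exI[of _ "es @ fs"]) simp
next
  case (IfT e s c s' d)
  have w: "X ^ esize e < 2 ^ w" "X ^ csize c < 2 ^ w" using power_word_mono[OF IfT.prems(4)] by simp_all
  obtain g1 where 1: "reaches g (replicate (ecost e + 1) Silent) g1" "sim s g1" "pc g1 = pc g + ecost e + 1"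
    using cond_reaches[OF IfT.prems(1), of g e "pc g + ecost e + 1 + clen c + 1"] IfT.prems IfT.hyps w
    by (auto simp: sits_append sits_Cons sits_single)
  obtain g2 es where 2: "reaches g1 es g2" "sim s' g2" "pc g2 = pc g1 + clen c"
    "hist s' = hist (tick (ecost e + 1) s) @ es"
    using IfT.IH[of g1] IfT.prems w 1 by (auto simp: sits_append sits_Cons ac_simps)
  let ?g = "g2\<lparr>pc := pc g + clen (If e c d)\<rparr>"
  have 3: "reaches g2 [Silent] ?g"
    using IfT.prems(3) 1(3) 2(3) by (intro jump_reaches) (auto simp: sits_append sits_Cons sits_single ac_simps)
  have "sim (tick 1 s') ?g" using 2(2) by (simp add: sim_def)
  moreover have "hist (tick 1 s') = hist s @ (replicate (ecost e + 1) Silent @ es @ [Silent])"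
    using 2(4) hist_tick[of "tick 1 s'" s' 1] hist_tick[of "tick (ecost e + 1) s" s "ecost e + 1"] by simp
  ultimately show ?case using reaches_trans[OF 1(1) reaches_trans[OF 2(1) 3]] by (intro exI[of _ ?g]) auto
next
  case (IfF e s d s' c)
  have w: "X ^ esize e < 2 ^ w" "X ^ csize d < 2 ^ w" using power_word_mono[OF IfF.prems(4)] by simp_all
  obtain g1 where 1: "reaches g (replicate (ecost e + 1) Silent) g1" "sim s g1"
    "pc g1 = pc g + ecost e + 1 + clen c + 1"
    using cond_reaches[OF IfF.prems(1), of g e "pc g + ecost e + 1 + clen c + 1"] IfF.prems IfF.hyps w
    by (auto simp: sits_append sits_Cons sits_single)
  obtain g2 es where 2: "reaches g1 es g2" "sim s' g2" "pc g2 = pc g1 + clen d"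
    "hist s' = hist (tick (ecost e + 1) s) @ es"
    using IfF.IH[of g1] IfF.prems w 1 by (auto simp: sits_append sits_Cons ac_simps)
  have "hist s' = hist s @ (replicate (ecost e + 1) Silent @ es)"
    using 2(4) hist_tick[of "tick (ecost e + 1) s" s "ecost e + 1"] by simp
  then show ?case using reaches_trans[OF 1(1) 2(1)] 1 2 by (intro exI[of _ g2]) auto
next
  case (WhileT e s c s' s'')
  have w: "X ^ esize e < 2 ^ w" "X ^ csize c < 2 ^ w" using power_word_mono[OF WhileT.prems(4)] by simp_all
  obtain g1 where 1: "reaches g (replicate (ecost e + 1) Silent) g1" "sim s g1" "pc g1 = pc g + ecost e + 1"
    using cond_reaches[OF WhileT.prems(1), of g e "pc g + clen (While e c)"] WhileT.prems WhileT.hyps w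
    by (auto simp: sits_append sits_Cons sits_single)
  obtain g2 es where 2: "reaches g1 es g2" "sim s' g2" "pc g2 = pc g1 + clen c"
    "hist s' = hist (tick (ecost e + 1) s) @ es"
    using WhileT.IH(1)[of g1] WhileT.prems w 1 by (auto simp: sits_append sits_Cons ac_simps)
  let ?g = "g2\<lparr>pc := pc g\<rparr>"
  have 3: "reaches g2 [Silent] ?g"
    using WhileT.prems(3) 1(3) 2(3)
    by (intro jump_reaches) (auto simp: sits_append sits_Cons sits_single ac_simps)
  have "sim (tick 1 s') ?g" using 2(2) by (simp add: sim_def)
  moreover have "bounded X (tick 1 s')" using bounded_exec[OF WhileT.hyps(2)] WhileT.prems(1) by simp
  ultimately obtain g3 fs where 4: "reaches ?g fs g3" "sim s'' g3" "pc g3 = pc g + clen (While e c)"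
    "hist s'' = hist (tick 1 s') @ fs"
    using WhileT.IH(2)[of ?g] WhileT.prems(3,4) by auto
  have "hist s'' = hist s @ (replicate (ecost e + 1) Silent @ es @ [Silent] @ fs)"
    using 2(4) 4(4) hist_tick[of "tick 1 s'" s' 1] hist_tick[of "tick (ecost e + 1) s" s "ecost e + 1"]
    by simp
  then show ?case using reaches_trans[OF 1(1) reaches_trans[OF 2(1) reaches_trans[OF 3 4(1)]]] 4
    by (intro exI[of _ g3]) auto
next
  case (WhileF e s c)
  have w: "X ^ esize e < 2 ^ w" using power_word_mono[OF WhileF.prems(4)] by simp
  obtain g1 where 1: "reaches g (replicate (ecost e + 1) Silent) g1" "sim s g1"
    "pc g1 = pc g + clen (While e c)"
    using cond_reaches[OF WhileF.prems(1), of g e "pc g + clen (While e c)"] WhileF.prems WhileF.hyps w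
    by (auto simp: sits_append sits_Cons sits_single)
  then show ?case using hist_tick[of "tick (ecost e + 1) s" s "ecost e + 1"]
    by (intro exI[of _ g1] exI[of _ "replicate (ecost e + 1) Silent"]) simp
next
  case (Rdy s)
  have "reaches g [Ready] (g\<lparr>pc := pc g + 1\<rparr>)"
    using Rdy.prems(3) by (intro reaches_step[OF _ _ reaches_refl]) (auto simp: sits_single)
  then show ?case using Rdy.prems(2)
    by (intro exI[of _ "g\<lparr>pc := pc g + 1\<rparr>"] exI[of _ "[Ready]"]) (auto simp: sim_def hist_def)
next
  case (Emit a b s)
  obtain r where r: "reaches g (replicate (ecost a + ecost b) Silent)
      (g\<lparr>pc := pc g + ecost a + ecost b, reg := r\<rparr>)"
    "r 30 = eval a s" "r 31 = eval b s" "\<forall>j<30. r j = reg g j"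
    using ecode2_reaches[OF Emit.prems(1), of g a b] Emit.prems by (auto simp: sits_append)
  let ?g = "g\<lparr>pc := pc g + ecost a + ecost b, reg := r\<rparr>"
  let ?g' = "g\<lparr>pc := pc g + ecost a + ecost b + 1, reg := r\<rparr>"
  have "reaches ?g [Output (eval a s) (eval b s)] ?g'"
    using Emit.prems(3) r by (intro reaches_step[OF _ _ reaches_refl]) (auto simp: sits_append sits_single ac_simps)
  from reaches_trans[OF r(1) this]
  show ?case using sim_reg[OF Emit.prems(2) r(4)]
    by (intro exI[of _ ?g'] exI[of _ "replicate (ecost a + ecost b) Silent @ [Output (eval a s) (eval b s)]"])
      (auto simp: hist_def sim_def replicate_add)
qed

end

section \<open>Weakest preconditions\<close>

text \<open>Asks for an execution to exist, so termination and the bounds on assigned values become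
  proof obligations.\<close>

definition wp :: "nat list \<Rightarrow> nat \<Rightarrow> com \<Rightarrow> (state \<Rightarrow> bool) \<Rightarrow> state \<Rightarrow> bool" where
  "wp xs X c Q s \<longleftrightarrow> (\<exists>s'. exec xs X c s s' \<and> Q s')"

inductive_cases SkipE: "exec xs X Skip s s'"
inductive_cases AssignE: "exec xs X (x ::= e) s s'"
inductive_cases ReadE: "exec xs X (Read x e) s s'"
inductive_cases StoreE: "exec xs X (A\<langle>i\<rangle> := e) s s'"
inductive_cases SeqE: "exec xs X (c ;; d) s s'"
inductive_cases IfE: "exec xs X (If e c d) s s'"
inductive_cases RdyE: "exec xs X Rdy s s'"
inductive_cases EmitE: "exec xs X (Emit a b) s s'"

lemma exec_iffs:
  "exec xs X Skip s s' \<longleftrightarrow> s' = s"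
  "exec xs X (x ::= e) s s' \<longleftrightarrow> eval e s \<le> X \<and>
     s' = tick (ecost e + 2) (s\<lparr>vars := (vars s)(x := eval e s)\<rparr>)"
  "exec xs X (Read x e) s s' \<longleftrightarrow> eval e s < length xs \<and>
     s' = tick (ecost e + 1) (s\<lparr>vars := (vars s)(x := xs ! eval e s)\<rparr>)"
  "exec xs X (A\<langle>i\<rangle> := e) s s' \<longleftrightarrow> eval e s \<le> X \<and>
     s' = tick (ecost i + ecost e + 6) (s\<lparr>arr := (arr s)(A := (arr s A)(eval i s := eval e s))\<rparr>)"
  "exec xs X (c ;; d) s s' \<longleftrightarrow> (\<exists>s1. exec xs X c s s1 \<and> exec xs X d s1 s')"
  "exec xs X (If e c d) s s' \<longleftrightarrow>
     (if eval e s = 0 then exec xs X d (tick (ecost e + 1) s) s'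
      else \<exists>s1. exec xs X c (tick (ecost e + 1) s) s1 \<and> s' = tick 1 s1)"
  "exec xs X Rdy s s' \<longleftrightarrow> s' = s\<lparr>clk := 0, trace := trace s @ [(clk s, Ready)]\<rparr>"
  "exec xs X (Emit a b) s s' \<longleftrightarrow> s' =
     s\<lparr>clk := 0, trace := trace s @ [(clk s + ecost a + ecost b, Output (eval a s) (eval b s))]\<rparr>"
  subgoal by (rule iffI, erule SkipE, assumption, hypsubst, rule exec.Skip)
  subgoal by (rule iffI, erule AssignE, simp, clarify, erule exec.Assign)
  subgoal by (rule iffI, erule ReadE, simp, clarify, erule exec.Read)
  subgoal by (rule iffI, erule StoreE, simp, clarify, erule exec.Store)
  subgoal by (rule iffI, erule SeqE, (rule exI, rule conjI, assumption+), clarify, erule exec.Seq)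
  subgoal by (cases "eval e s = 0") (auto elim!: IfE intro: exec.IfT[simplified] exec.IfF[simplified])
  subgoal by (rule iffI, erule RdyE, simp, hypsubst, rule exec.Rdy)
  subgoal by (rule iffI, erule EmitE, simp, hypsubst, rule exec.Emit)
  done

lemma wp_simps [simp]:
  "wp xs X Skip Q s \<longleftrightarrow> Q s"
  "wp xs X (x ::= e) Q s \<longleftrightarrow> eval e s \<le> X \<and>
     Q (tick (ecost e + 2) (s\<lparr>vars := (vars s)(x := eval e s)\<rparr>))"
  "wp xs X (Read x e) Q s \<longleftrightarrow> eval e s < length xs \<and>
     Q (tick (ecost e + 1) (s\<lparr>vars := (vars s)(x := xs ! eval e s)\<rparr>))"
  "wp xs X (A\<langle>i\<rangle> := e) Q s \<longleftrightarrow> eval e s \<le> X \<and>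
     Q (tick (ecost i + ecost e + 6) (s\<lparr>arr := (arr s)(A := (arr s A)(eval i s := eval e s))\<rparr>))"
  "wp xs X (c ;; d) Q s \<longleftrightarrow> wp xs X c (wp xs X d Q) s"
  "wp xs X (If e c d) Q s \<longleftrightarrow>
     (if eval e s = 0 then wp xs X d Q (tick (ecost e + 1) s)
      else wp xs X c (\<lambda>s'. Q (tick 1 s')) (tick (ecost e + 1) s))"
  "wp xs X Rdy Q s \<longleftrightarrow> Q (s\<lparr>clk := 0, trace := trace s @ [(clk s, Ready)]\<rparr>)"
  "wp xs X (Emit a b) Q s \<longleftrightarrow>
     Q (s\<lparr>clk := 0, trace := trace s @ [(clk s + ecost a + ecost b, Output (eval a s) (eval b s))]\<rparr>)"
  by (auto simp add: wp_def exec_iffs)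

lemma wp_mono: "wp xs X c Q s \<Longrightarrow> (\<And>s'. Q s' \<Longrightarrow> Q' s') \<Longrightarrow> wp xs X c Q' s"
  by (auto simp: wp_def)

lemma wp_WhileF: "eval e s = 0 \<Longrightarrow> Q (tick (ecost e + 1) s) \<Longrightarrow> wp xs X (While e c) Q s"
  unfolding wp_def by (blast intro: exec.WhileF)

lemma wp_WhileT:
  "eval e s \<noteq> 0 \<Longrightarrow> wp xs X c (\<lambda>s'. wp xs X (While e c) Q (tick 1 s')) (tick (ecost e + 1) s) \<Longrightarrow>
   wp xs X (While e c) Q s"
  unfolding wp_def by (blast intro: exec.WhileT)

text \<open>The invariant is indexed by the number of completed rounds, which is known in advance;
  it thereby serves as variant and carries a time bound that grows with the index. The
  \<open>tick 1\<close> is the jump back.\<close>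

lemma wp_for:
  assumes "I 0 s"
    and "\<And>i s. i < k \<Longrightarrow> I i s \<Longrightarrow>
      eval e s \<noteq> 0 \<and> wp xs X c (\<lambda>s'. I (Suc i) (tick 1 s')) (tick (ecost e + 1) s)"
    and "\<And>s. I k s \<Longrightarrow> eval e s = 0 \<and> Q (tick (ecost e + 1) s)"
  shows "wp xs X (While e c) Q s"
proof -
  have "wp xs X (While e c) Q s" if "I i s" "i \<le> k" for i s
    using that
  proof (induction "k - i" arbitrary: i s)
    case 0
    then show ?case using assms(3)[of s] by (auto intro: wp_WhileF)
  next
    case (Suc d)
    then have *: "eval e s \<noteq> 0" "wp xs X c (\<lambda>s'. I (Suc i) (tick 1 s')) (tick (ecost e + 1) s)"
      using assms(2)[of i s] by auto
    show ?case
    proof (rule wp_WhileT[OF *(1)], rule wp_mono[OF *(2)])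
      fix s' assume "I (Suc i) (tick 1 s')"
      moreover have "d = k - Suc i" "Suc i \<le> k" using Suc.hyps(2) by auto
      ultimately show "wp xs X (While e c) Q (tick 1 s')" using Suc.hyps(1) by blast
    qed
  qed
  then show ?thesis using assms(1) by blast
qed

section \<open>Frame conditions: what a command leaves unchanged\<close>

fun mvars :: "com \<Rightarrow> var set" where
  "mvars (x ::= e) = {x}"
| "mvars (Read x e) = {x}"
| "mvars (c ;; d) = mvars c \<union> mvars d"
| "mvars (If e c d) = mvars c \<union> mvars d"
| "mvars (While e c) = mvars c"
| "mvars _ = {}"

fun marrs :: "com \<Rightarrow> ar set" where
  "marrs (A\<langle>i\<rangle> := e) = {A}"
| "marrs (c ;; d) = marrs c \<union> marrs d"
| "marrs (If e c d) = marrs c \<union> marrs d"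
| "marrs (While e c) = marrs c"
| "marrs _ = {}"

fun silent :: "com \<Rightarrow> bool" where
  "silent (c ;; d) \<longleftrightarrow> silent c \<and> silent d"
| "silent (If e c d) \<longleftrightarrow> silent c \<and> silent d"
| "silent (While e c) \<longleftrightarrow> silent c"
| "silent Rdy \<longleftrightarrow> False"
| "silent (Emit a b) \<longleftrightarrow> False"
| "silent _ \<longleftrightarrow> True"

definition frame :: "com \<Rightarrow> state \<Rightarrow> state \<Rightarrow> bool" where
  "frame c s s' \<longleftrightarrow> (\<forall>x. x \<notin> mvars c \<longrightarrow> vars s' x = vars s x) \<and>
     (\<forall>A. A \<notin> marrs c \<longrightarrow> arr s' A = arr s A) \<and> (silent c \<longrightarrow> trace s' = trace s)"

lemma exec_frame: "exec xs X c s s' \<Longrightarrow> frame c s s'"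
  by (induction rule: exec.induct) (auto simp: frame_def)

lemma wp_frame: "wp xs X c Q s \<Longrightarrow> wp xs X c (\<lambda>s'. Q s' \<and> frame c s s') s"
  by (auto simp: wp_def dest: exec_frame)

lemma wp_bounded:
  "wp xs X c Q s \<Longrightarrow> bounded X s \<Longrightarrow> (\<And>x. x \<in> set xs \<Longrightarrow> x \<le> X) \<Longrightarrow>
   wp xs X c (\<lambda>s'. Q s' \<and> bounded X s') s"
  unfolding wp_def
proof (elim exE conjE)
  fix s' assume *: "exec xs X c s s'" "Q s'" "bounded X s" "\<And>x. x \<in> set xs \<Longrightarrow> x \<le> X"
  have "bounded X s'" using *(1,3)
    by (induction rule: exec.induct) (auto simp: bounded_def intro: *(4))
  then show "\<exists>s'. exec xs X c s s' \<and> Q s' \<and> bounded X s'" using * by blast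
qed

section \<open>Graph search\<close>

text \<open>Successor lists are stored as linked lists; \<open>0\<close> is the null pointer and cell \<open>i\<close> has
  pointer \<open>Suc i\<close>.\<close>

fun adjl :: "nat \<Rightarrow> (nat \<Rightarrow> nat) \<Rightarrow> (nat \<Rightarrow> nat) \<Rightarrow> nat \<Rightarrow> nat list \<Rightarrow> bool" where
  "adjl c nx tg h [] \<longleftrightarrow> h = 0"
| "adjl c nx tg h (y # ys) \<longleftrightarrow> 0 < h \<and> h \<le> c \<and> tg (h - 1) = y \<and> adjl c nx tg (nx (h - 1)) ys"

lemma adjl_Suc: "adjl c nx tg h ys \<Longrightarrow> adjl (Suc c) (nx(c := i)) (tg(c := j)) h ys"
  by (induction ys arbitrary: h) auto

text \<open>\<open>F\<close> holds the pruned nodes: the nodes with a full list in the backward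
  searches, none in the forward searches.\<close>

definition reach :: "(nat \<Rightarrow> nat list) \<Rightarrow> nat set \<Rightarrow> nat \<Rightarrow> nat set" where
  "reach nb F r = {x. r \<notin> F \<and> (r, x) \<in> {(a, b). b \<in> set (nb a) \<and> b \<notin> F}\<^sup>*}"

text \<open>The number of units of a complete search of \<open>R\<close>: one for taking each node
  from the queue, one for each entry of its list.\<close>

definition weight :: "(nat \<Rightarrow> nat list) \<Rightarrow> nat set \<Rightarrow> nat" where
  "weight nb R = (\<Sum>x\<in>R. Suc (length (nb x)))"

text \<open>Breadth-first search without reference to a state: \<open>ql\<close> is the queue
  including its processed prefix of length \<open>h\<close>, \<open>ys\<close> the unread rest of
  the current adjacency list, and \<phi> bounds the number of units left.\<close>

definition ainv :: "(nat \<Rightarrow> nat list) \<Rightarrow> nat set \<Rightarrow> nat \<Rightarrow> nat \<Rightarrow> nat list \<Rightarrow> nat \<Rightarrow> nat list \<Rightarrow> bool" where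
  "ainv nb F r \<phi> ql h ys \<longleftrightarrow> h \<le> length ql \<and> distinct ql \<and> set ql \<subseteq> reach nb F r \<and>
     (r \<notin> F \<longrightarrow> r \<in> set ql) \<and> (\<forall>j<h. set (nb (ql ! j)) \<subseteq> F \<union> set ql \<union> set ys) \<and>
     (\<forall>y\<in>set ys. y \<notin> F \<longrightarrow> y \<in> reach nb F r) \<and>
     length ys + weight nb (reach nb F r - set (take h ql)) \<le> \<phi>"

definition add_new :: "nat set \<Rightarrow> nat \<Rightarrow> nat list \<Rightarrow> nat list" where
  "add_new F y ql = (if y \<in> F \<or> y \<in> set ql then ql else ql @ [y])"

lemma reach_step: "x \<in> reach nb F r \<Longrightarrow> y \<in> set (nb x) \<Longrightarrow> y \<notin> F \<Longrightarrow> y \<in> reach nb F r"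
  by (auto simp: reach_def intro: rtrancl_into_rtrancl)

lemma ainv_start: "ainv nb F r (weight nb (reach nb F r)) (add_new F r []) 0 []"
  by (auto simp: ainv_def add_new_def reach_def)

lemma ainv_arc: "ainv nb F r \<phi> ql h (y # ys) \<Longrightarrow> ainv nb F r (\<phi> - 1) (add_new F y ql) h ys"
  unfolding ainv_def add_new_def by (auto simp: nth_append)

text \<open>Taking out a node releases its weight \<open>Suc (length (nb x))\<close>; all but one of
  it pays for the list that becomes current.\<close>

lemma ainv_pop:
  assumes "ainv nb F r \<phi> ql h []" "h < length ql" "finite (reach nb F r)"
  shows "ainv nb F r (\<phi> - 1) ql (Suc h) (nb (ql ! h))"
proof -
  let ?A = "reach nb F r - set (take h ql)"
  have x: "ql ! h \<in> ?A"
  proof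
    show "ql ! h \<in> reach nb F r" using assms(1) nth_mem[OF assms(2)] unfolding ainv_def by blast
    show "ql ! h \<notin> set (take h ql)"
      using assms(1,2) by (auto simp: ainv_def in_set_conv_nth nth_eq_iff_index_eq)
  qed
  have "reach nb F r - set (take (Suc h) ql) = ?A - {ql ! h}"
    using assms(2) by (auto simp: take_Suc_conv_app_nth)
  moreover have "weight nb ?A = Suc (length (nb (ql ! h))) + weight nb (?A - {ql ! h})"
    unfolding weight_def using x assms(3) by (intro sum.remove) auto
  ultimately have "length (nb (ql ! h)) + weight nb (reach nb F r - set (take (Suc h) ql)) \<le> \<phi> - 1"
    using assms(1) unfolding ainv_def by (elim conjE) simp
  moreover have "\<forall>j<Suc h. set (nb (ql ! j)) \<subseteq> F \<union> set ql \<union> set (nb (ql ! h))"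
    using assms(1) by (auto simp: ainv_def less_Suc_eq)
  moreover have "\<forall>y\<in>set (nb (ql ! h)). y \<notin> F \<longrightarrow> y \<in> reach nb F r"
    using x by (blast intro: reach_step)
  ultimately show ?thesis using assms(1,2) by (simp add: ainv_def)
qed

text \<open>The finished queue contains the unblocked root and is closed under unblocked
  edges.\<close>

lemma ainv_done:
  assumes "ainv nb F r \<phi> ql (length ql) []"
  shows "set ql = reach nb F r"
proof
  show "set ql \<subseteq> reach nb F r" using assms by (simp add: ainv_def)
  show "reach nb F r \<subseteq> set ql"
  proof
    fix x assume "x \<in> reach nb F r"
    then have "r \<notin> F" "(r, x) \<in> {(a, b). b \<in> set (nb a) \<and> b \<notin> F}\<^sup>*" by (auto simp: reach_def)
    from this(2) show "x \<in> set ql"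
    proof (induction rule: rtrancl_induct)
      case base
      then show ?case using assms \<open>r \<notin> F\<close> by (simp add: ainv_def)
    next
      case (step y z)
      then obtain j where "j < length ql" "ql ! j = y" by (auto simp: in_set_conv_nth)
      then show ?case using step(2) assms by (auto simp: ainv_def)
    qed
  qed
qed

text \<open>Every unprocessed node has positive weight, so exhausted potential forces the search to
  be finished. Hence the forward search may be regarded as complete after a fixed number of units,
  without any test.\<close>

lemma ainv_0:
  assumes "ainv nb F r 0 ql h ys" "finite (reach nb F r)"
  shows "ys = []" "h = length ql"
proof -
  show "ys = []" using assms by (simp add: ainv_def)
  have "reach nb F r - set (take h ql) = {}"
    using assms sum_eq_0_iff[of "reach nb F r - set (take h ql)" "\<lambda>x. Suc (length (nb x))"]
    unfolding ainv_def weight_def by auto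
  then have *: "set ql \<subseteq> set (take h ql)" using assms(1) by (auto simp: ainv_def)
  have "length ql = card (set ql)" using assms(1) by (simp add: ainv_def distinct_card)
  also have "\<dots> \<le> card (set (take h ql))" using * by (intro card_mono) auto
  also have "\<dots> \<le> h" by (rule order_trans[OF card_length]) simp
  finally show "h = length ql" using assms(1) by (simp add: ainv_def)
qed

lemma ainv_length: "ainv nb F r \<phi> ql h ys \<Longrightarrow> finite (reach nb F r) \<Longrightarrow> length ql \<le> card (reach nb F r)"
  by (metis ainv_def card_mono distinct_card)

text \<open>A mark counts only if it equals the current stamp \<open>Vst\<close>. Older marks are
  smaller, so the truncated difference is nonzero exactly for nodes not yet seen.\<close>

definition visit :: "ar \<Rightarrow> ar \<Rightarrow> com" where
  "visit Mk Fu = If (Ar Fu (V Vy)) Skip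
     (If (Sub (V Vst) (Ar Mk (V Vy)))
       (Mk\<langle>V Vy\<rangle> := V Vst;; Que\<langle>V Vqt\<rangle> := V Vy;; Vqt ::= Add (V Vqt) (N 1)) Skip)"

text \<open>Free of loops, hence of constant cost. The last \<open>Skip\<close> lets a finished
  search absorb surplus units.\<close>

definition search_unit :: "ar \<Rightarrow> ar \<Rightarrow> ar \<Rightarrow> ar \<Rightarrow> ar \<Rightarrow> com" where
  "search_unit H Nx T Mk Fu = If (V Ve)
     (Vy ::= Ar T (Sub (V Ve) (N 1));; Ve ::= Ar Nx (Sub (V Ve) (N 1));; visit Mk Fu)
     (If (Sub (V Vqt) (V Vqh))
       (Vx ::= Ar Que (V Vqh);; Vqh ::= Add (V Vqh) (N 1);; Ve ::= Ar H (V Vx)) Skip)"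

definition search_start :: "ar \<Rightarrow> ar \<Rightarrow> com" where
  "search_start Mk Fu =
     (Vqh ::= N 0;; Vqt ::= N 0;; Ve ::= N 0;; Vst ::= Add (V Vv) (N 1);; visit Mk Fu)"

lemma modifies_visit:
  "mvars (visit Mk Fu) = {Vqt}" "marrs (visit Mk Fu) = {Mk, Que}" "silent (visit Mk Fu)"
  by (auto simp: visit_def)

lemma modifies_search:
  "mvars (search_unit H Nx T Mk Fu) = {Vy, Ve, Vqt, Vx, Vqh}"
  "marrs (search_unit H Nx T Mk Fu) = {Mk, Que}" "silent (search_unit H Nx T Mk Fu)"
  "mvars (search_start Mk Fu) = {Vqt, Vqh, Ve, Vst}"
  "marrs (search_start Mk Fu) = {Mk, Que}" "silent (search_start Mk Fu)"
  by (auto simp: search_unit_def search_start_def modifies_visit)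

section \<open>The search invariant on program states\<close>

abbreviation supp :: "(nat \<Rightarrow> nat) \<Rightarrow> nat set" where
  "supp f \<equiv> {x. f x \<noteq> 0}"

definition marked :: "ar \<Rightarrow> nat \<Rightarrow> state \<Rightarrow> nat list \<Rightarrow> bool" where
  "marked Mk st s ql \<longleftrightarrow> vars s Vst = st \<and> (\<forall>y. arr s Mk y \<le> st) \<and>
     (\<forall>y. arr s Mk y = st \<longleftrightarrow> y \<in> set ql) \<and> vars s Vqt = length ql \<and>
     (\<forall>j<length ql. arr s Que j = ql ! j)"

definition graph_rep :: "ar \<Rightarrow> ar \<Rightarrow> ar \<Rightarrow> nat \<Rightarrow> (nat \<Rightarrow> nat list) \<Rightarrow> state \<Rightarrow> bool" where
  "graph_rep H Nx T c nb s \<longleftrightarrow> (\<forall>x. adjl c (arr s Nx) (arr s T) (arr s H x) (nb x))"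

definition sinv ::
    "ar \<Rightarrow> ar \<Rightarrow> ar \<Rightarrow> ar \<Rightarrow> ar \<Rightarrow> nat \<Rightarrow> (nat \<Rightarrow> nat list) \<Rightarrow> nat \<Rightarrow> nat \<Rightarrow> nat \<Rightarrow> state \<Rightarrow> bool" where
  "sinv H Nx T Mk Fu c nb r st \<phi> s \<longleftrightarrow> graph_rep H Nx T c nb s \<and> (\<exists>ql ys. marked Mk st s ql \<and>
     adjl c (arr s Nx) (arr s T) (vars s Ve) ys \<and> ainv nb (supp (arr s Fu)) r \<phi> ql (vars s Vqh) ys)"

lemma sinvI:
  "graph_rep H Nx T c nb s \<Longrightarrow> marked Mk st s ql \<Longrightarrow> adjl c (arr s Nx) (arr s T) (vars s Ve) ys \<Longrightarrow>
   ainv nb (supp (arr s Fu)) r \<phi> ql (vars s Vqh) ys \<Longrightarrow> sinv H Nx T Mk Fu c nb r st \<phi> s"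
  by (auto simp: sinv_def)

text \<open>Used twice: for the backward searches with \<open>Ful\<close> as blocked nodes, and for
  the forward searches with \<open>Zer\<close>, an array that is never written and so blocks
  nothing.\<close>

locale search_arrays =
  fixes H Nx T Mk Fu :: ar
  assumes arrays: "{H, Nx, T, Fu} \<inter> {Mk, Que} = {}" "Mk \<noteq> Que"
begin

lemma visit:
  assumes "marked Mk st s ql" "length ql < X" "bounded X s"
  shows "wp xs X (visit Mk Fu) (\<lambda>s'. marked Mk st s' (add_new (supp (arr s Fu)) (vars s Vy) ql) \<and>
    clk s' \<le> clk s + 50) s"
proof -
  have "vars s Vy \<le> X" "vars s Vst \<le> X" using assms(3) by (auto simp: bounded_def)
  note b = this
  consider "arr s Fu (vars s Vy) \<noteq> 0" | "arr s Fu (vars s Vy) = 0" "vars s Vy \<in> set ql"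
    | "arr s Fu (vars s Vy) = 0" "vars s Vy \<notin> set ql" by blast
  then show ?thesis
  proof cases
    case 1
    then show ?thesis using assms(1) by (simp add: visit_def marked_def add_new_def)
  next
    case 2
    then have "vars s Vst - arr s Mk (vars s Vy) = 0" using assms(1) unfolding marked_def by (metis diff_self_eq_0)
    then show ?thesis using assms(1) 2 by (simp add: visit_def marked_def add_new_def)
  next
    case 3
    then have "arr s Mk (vars s Vy) < vars s Vst"
      using assms(1) by (auto simp: marked_def order_less_le)
    then show ?thesis
      using assms(1,2) 3 b arrays by (auto simp: visit_def marked_def add_new_def nth_append less_Suc_eq)
  qed
qed

lemma sinv_clk [simp]: "sinv H Nx T Mk Fu c nb r st \<phi> (s\<lparr>clk := k\<rparr>) \<longleftrightarrow> sinv H Nx T Mk Fu c nb r st \<phi> s"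
  by (simp add: sinv_def graph_rep_def marked_def)

lemma unit:
  assumes "sinv H Nx T Mk Fu c nb r st \<phi> s" "finite (reach nb (supp (arr s Fu)) r)"
    "card (reach nb (supp (arr s Fu)) r) < X" "bounded X s"
  shows "wp xs X (search_unit H Nx T Mk Fu) (\<lambda>s'. sinv H Nx T Mk Fu c nb r st (\<phi> - 1) s' \<and>
    clk s' \<le> clk s + 90) s"
proof -
  let ?F = "supp (arr s Fu)"
  obtain ql ys where g: "graph_rep H Nx T c nb s"
    and q: "marked Mk st s ql" "adjl c (arr s Nx) (arr s T) (vars s Ve) ys"
      "ainv nb ?F r \<phi> ql (vars s Vqh) ys"
    using assms(1) by (auto simp: sinv_def)
  have len: "length ql < X" using ainv_length[OF q(3) assms(2)] assms(3) by simp
  show ?thesis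
  proof (cases ys)
    case (Cons y ys')
    let ?e = "vars s Ve"
    let ?s = "s\<lparr>vars := (vars s)(Vy := y, Ve := arr s Nx (?e - 1)), clk := 27 + clk s\<rparr>"
    have e: "?e \<noteq> 0" "arr s T (?e - 1) = y" "adjl c (arr s Nx) (arr s T) (arr s Nx (?e - 1)) ys'"
      using q(2) Cons by auto
    have b: "bounded X ?s" "y \<le> X" "arr s Nx (?e - 1) \<le> X"
      using assms(4) e(2) by (auto simp: bounded_def)
    have "marked Mk st ?s ql" using q(1) by (auto simp: marked_def)
    from wp_frame[OF visit[OF this len b(1), of xs]]
    have "wp xs X (visit Mk Fu) (\<lambda>s'. sinv H Nx T Mk Fu c nb r st (\<phi> - 1) (tick 1 s') \<and>
      clk s' + 1 \<le> clk s + 90) ?s"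
    proof (rule wp_mono, elim conjE)
      fix s' assume s': "marked Mk st s' (add_new (supp (arr ?s Fu)) (vars ?s Vy) ql)"
        "clk s' \<le> clk ?s + 50" "frame (visit Mk Fu) ?s s'"
      have fr: "arr s' A = arr s A" if "A \<in> {H, Nx, T, Fu}" for A
      proof -
        have "A \<notin> marrs (visit Mk Fu)" using arrays that by (auto simp: modifies_visit)
        then show ?thesis using s'(3) by (simp add: frame_def)
      qed
      have fv: "vars s' Ve = arr s Nx (?e - 1)" "vars s' Vqh = vars s Vqh"
        using s'(3) by (simp_all add: frame_def modifies_visit)
      show "sinv H Nx T Mk Fu c nb r st (\<phi> - 1) (tick 1 s') \<and> clk s' + 1 \<le> clk s + 90"
      proof (intro conjI sinvI[where ql = "add_new ?F y ql" and ys = ys'])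
        show "graph_rep H Nx T c nb (tick 1 s')" using g by (simp add: graph_rep_def fr)
        show "marked Mk st (tick 1 s') (add_new ?F y ql)" using s'(1) by (simp add: marked_def)
        show "adjl c (arr (tick 1 s') Nx) (arr (tick 1 s') T) (vars (tick 1 s') Ve) ys'"
          using e(3) by (simp add: fr fv)
        show "ainv nb (supp (arr (tick 1 s') Fu)) r (\<phi> - 1) (add_new ?F y ql) (vars (tick 1 s') Vqh) ys'"
          using ainv_arc q(3) Cons by (simp add: fr fv)
      qed (use s'(2) in simp)
    qed
    then show ?thesis using e b by (simp add: search_unit_def)
  next
    case Nil
    then have e: "vars s Ve = 0" using q(2) by simp
    show ?thesis
    proof (cases "vars s Vqh < length ql")
      case True
      have x: "arr s Que (vars s Vqh) = ql ! vars s Vqh" using True q(1) by (simp add: marked_def)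
      have b: "arr s Que (vars s Vqh) \<le> X" "vars s Vqh + 1 \<le> X" "\<And>x. arr s H x \<le> X"
        using assms(4) len True by (auto simp: bounded_def)
      show ?thesis
        using e True b q(1) ainv_pop[of nb ?F r \<phi> ql "vars s Vqh"] q(3) Nil assms(2) g
        unfolding search_unit_def
        by (auto simp: graph_rep_def marked_def x intro!: sinvI[where ql = ql and ys = "nb (ql ! vars s Vqh)"])
    next
      case False
      then have "vars s Vqh = vars s Vqt" "vars s Vqh = length ql"
        using q(1,3) by (auto simp: marked_def ainv_def)
      \<comment> \<open>A finished search has no weight left, so the potential may be lowered
        although nothing happens.\<close>
      moreover have "ainv nb ?F r (\<phi> - 1) ql (vars s Vqh) []"
      proof -
        have i: "ainv nb ?F r \<phi> ql (length ql) []" using q(3) Nil \<open>vars s Vqh = length ql\<close> by simp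
        have "weight nb (reach nb ?F r - set ql) = 0" using ainv_done[OF i] by (simp add: weight_def)
        then show ?thesis using i \<open>vars s Vqh = length ql\<close> by (simp add: ainv_def)
      qed
      ultimately have "sinv H Nx T Mk Fu c nb r st (\<phi> - 1) s"
        using q(2) Nil by (intro sinvI[OF g q(1)]) auto
      then show ?thesis using e \<open>vars s Vqh = vars s Vqt\<close> by (simp add: search_unit_def)
    qed
  qed
qed

text \<open>All old marks are at most \<open>Vv\<close>, hence below the new stamp
  \<open>Suc (vars s Vv)\<close>; no node counts as visited.\<close>

lemma start:
  assumes "graph_rep H Nx T c nb s" "\<And>y. arr s Mk y \<le> vars s Vv" "bounded X s" "vars s Vv < X"
  shows "wp xs X (search_start Mk Fu) (\<lambda>s'. sinv H Nx T Mk Fu c nb (vars s Vy) (Suc (vars s Vv))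
    (weight nb (reach nb (supp (arr s Fu)) (vars s Vy))) s' \<and> clk s' \<le> clk s + 90) s"
proof -
  let ?s = "s\<lparr>vars := (vars s)(Vqh := 0, Vqt := 0, Ve := 0, Vst := Suc (vars s Vv)), clk := 15 + clk s\<rparr>"
  have "marked Mk (Suc (vars s Vv)) ?s []"
    using assms(2) by (auto simp: marked_def le_Suc_eq) (metis Suc_n_not_le_n)
  moreover have b: "bounded X ?s" "0 < X" using assms(3,4) by (auto simp: bounded_def)
  ultimately have "wp xs X (visit Mk Fu) (\<lambda>s'. (marked Mk (Suc (vars s Vv)) s'
      (add_new (supp (arr ?s Fu)) (vars ?s Vy) []) \<and> clk s' \<le> clk ?s + 50) \<and> frame (visit Mk Fu) ?s s') ?s"
    by (intro wp_frame visit) simp_all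
  then have "wp xs X (visit Mk Fu) (\<lambda>s'. sinv H Nx T Mk Fu c nb (vars s Vy) (Suc (vars s Vv))
    (weight nb (reach nb (supp (arr s Fu)) (vars s Vy))) s' \<and> clk s' \<le> clk s + 90) ?s"
  proof (rule wp_mono, elim conjE)
    fix s' assume s': "marked Mk (Suc (vars s Vv)) s' (add_new (supp (arr ?s Fu)) (vars ?s Vy) [])"
        "clk s' \<le> clk ?s + 50" "frame (visit Mk Fu) ?s s'"
    have fr: "arr s' A = arr s A" if "A \<in> {H, Nx, T, Fu}" for A
    proof -
      have "A \<notin> marrs (visit Mk Fu)" using arrays that by (auto simp: modifies_visit)
      then show ?thesis using s'(3) by (simp add: frame_def)
    qed
    have fv: "vars s' Ve = 0" "vars s' Vqh = 0"
      using s'(3) by (simp_all add: frame_def modifies_visit)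
    show "sinv H Nx T Mk Fu c nb (vars s Vy) (Suc (vars s Vv))
        (weight nb (reach nb (supp (arr s Fu)) (vars s Vy))) s' \<and> clk s' \<le> clk s + 90"
    proof (intro conjI sinvI[where ql = "add_new (supp (arr s Fu)) (vars s Vy) []" and ys = "[]"])
      show "graph_rep H Nx T c nb s'" using assms(1) by (simp add: graph_rep_def fr)
      show "marked Mk (Suc (vars s Vv)) s' (add_new (supp (arr s Fu)) (vars s Vy) [])"
        using s'(1) by simp
      show "ainv nb (supp (arr s' Fu)) (vars s Vy) (weight nb (reach nb (supp (arr s Fu)) (vars s Vy)))
        (add_new (supp (arr s Fu)) (vars s Vy) []) (vars s' Vqh) []"
        using ainv_start by (simp add: fr fv)
    qed (use s'(2) fv in simp_all)
  qed
  then show ?thesis using assms(4) b by (simp add: search_start_def)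
qed

text \<open>Two ways to recognise the end: the potential is used up, as after all bursts of a
  forward search, or the loop test of a backward search finds nothing left to do.\<close>

lemma sinv_done:
  assumes "sinv H Nx T Mk Fu c nb r st \<phi> s" "\<phi> = 0 \<or> vars s Ve + (vars s Vqt - vars s Vqh) = 0"
    "finite (reach nb (supp (arr s Fu)) r)"
  shows "\<exists>ql. marked Mk st s ql \<and> set ql = reach nb (supp (arr s Fu)) r \<and> distinct ql \<and>
    vars s Ve + (vars s Vqt - vars s Vqh) = 0"
proof -
  let ?F = "supp (arr s Fu)"
  obtain ql ys where q: "marked Mk st s ql" "adjl c (arr s Nx) (arr s T) (vars s Ve) ys"
      "ainv nb ?F r \<phi> ql (vars s Vqh) ys"
    using assms(1) by (auto simp: sinv_def)
  have "ys = [] \<and> vars s Vqh = length ql \<and> vars s Ve = 0"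
  proof (cases "\<phi> = 0")
    case True
    then show ?thesis using ainv_0[of nb ?F r ql "vars s Vqh" ys] q assms(3) by auto
  next
    case False
    then have 0: "vars s Ve = 0" "vars s Vqt \<le> vars s Vqh" using assms(2) by simp_all
    then have "ys = []" using q(2) by (cases ys) auto
    then show ?thesis using 0 q(1,3) by (simp add: marked_def ainv_def)
  qed
  then have 1: "ys = []" "vars s Vqh = length ql" "vars s Ve = 0" by simp_all
  have 2: "ainv nb ?F r \<phi> ql (length ql) []" using q(3) 1 by simp
  have "vars s Vqt = vars s Vqh" using q(1) 1(2) by (simp add: marked_def)
  moreover have "distinct ql" using 2 by (simp add: ainv_def)
  ultimately show ?thesis using q(1) ainv_done[OF 2] 1(3) by (intro exI[of _ ql]) simp
qed

end

section \<open>Queries as relations and as automata\<close>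

text \<open>Query semantics on node positions by relation algebra instead of words;
  \<open>G c\<close> is the arc relation of the letter with number \<open>c\<close>.\<close>

fun rel :: "nat \<Rightarrow> (nat \<Rightarrow> (nat \<times> nat) set) \<Rightarrow> ('a \<Rightarrow> nat) \<Rightarrow> 'a rpq \<Rightarrow> (nat \<times> nat) set" where
  "rel n G cd Eps = Id_on {..<n}"
| "rel n G cd (Letter a) = G (cd a)"
| "rel n G cd (Cat r s) = rel n G cd r O rel n G cd s"
| "rel n G cd (Alt r s) = rel n G cd r \<union> rel n G cd s"
| "rel n G cd (Plus r) = (rel n G cd r)\<^sup>+"

lemma labelled_path_append:
  "labelled_path D u v t \<Longrightarrow> labelled_path D t w x \<Longrightarrow> labelled_path D u (v @ w) x"
  by (induction rule: labelled_path.induct) (auto intro: labelled_path.arc)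

lemma labelled_path_nodes:
  "labelled_path D u w v \<Longrightarrow> wf_db D \<Longrightarrow> u \<in> nodes D \<and> v \<in> nodes D"
  by (induction rule: labelled_path.induct) (auto simp: wf_db_def)

lemma labelled_path_appendE:
  assumes "labelled_path D u (v @ w) x" "wf_db D"
  shows "\<exists>t. labelled_path D u v t \<and> labelled_path D t w x"
  using assms(1)
proof (induction v arbitrary: u)
  case Nil
  then show ?case using labelled_path_nodes[OF Nil assms(2)] by (auto intro: labelled_path.empty)
next
  case (Cons a v)
  from Cons.prems obtain y where "(u, a, y) \<in> arcs D" "labelled_path D y (v @ w) x"
    by (auto elim: labelled_path.cases)
  then show ?case using Cons.IH[of y] by (blast intro: labelled_path.arc)
qed

lemma answers_Eps: "answers Eps D = Id_on (nodes D)"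
  by (auto simp: answers_def intro: labelled_path.empty elim: labelled_path.cases)

lemma answers_Letter: "wf_db D \<Longrightarrow> answers (Letter a) D = {(u, v). (u, a, v) \<in> arcs D}"
  unfolding answers_def wf_db_def
  by (auto elim!: labelled_path.cases[of D _ "a # _"] labelled_path.cases[of D _ "[]"]
      intro!: labelled_path.arc labelled_path.empty)

lemma answers_Cat: "wf_db D \<Longrightarrow> answers (Cat r s) D = answers r D O answers s D"
  unfolding answers_def
  by (auto dest!: labelled_path_appendE intro: labelled_path_append)

lemma answers_Plus:
  assumes "wf_db D"
  shows "answers (Plus r) D = (answers r D)\<^sup>+"
proof (intro equalityI subrelI)
  fix u v assume "(u, v) \<in> answers (Plus r) D"
  then obtain ws where "ws \<noteq> []" "set ws \<subseteq> lang r" "labelled_path D u (concat ws) v"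
    by (auto simp: answers_def)
  then show "(u, v) \<in> (answers r D)\<^sup>+"
  proof (induction ws arbitrary: u)
    case (Cons w ws)
    then obtain t where t: "labelled_path D u w t" "labelled_path D t (concat ws) v"
      using labelled_path_appendE[OF _ assms, of u w "concat ws" v] by auto
    then have ut: "(u, t) \<in> answers r D" using Cons.prems by (auto simp: answers_def)
    show ?case
    proof (cases "ws = []")
      case True
      then have "t = v" using t(2) by (auto elim: labelled_path.cases)
      then show ?thesis using ut by blast
    next
      case False
      then show ?thesis using Cons.IH[of t] Cons.prems t(2) ut by (auto intro: trancl_into_trancl2)
    qed
  qed simp
next
  fix u v assume "(u, v) \<in> (answers r D)\<^sup>+"
  then show "(u, v) \<in> answers (Plus r) D"
  proof (induction rule: trancl_induct)
    case (base v)
    then obtain w where "w \<in> lang r" "labelled_path D u w v" by (auto simp: answers_def)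
    then show ?case unfolding answers_def by (auto intro!: exI[of _ "[w]"] bexI[of _ w])
  next
    case (step v x)
    then obtain ws w where "ws \<noteq> []" "set ws \<subseteq> lang r" "labelled_path D u (concat ws) v"
      "w \<in> lang r" "labelled_path D v w x" by (auto simp: answers_def)
    then have "labelled_path D u (concat (ws @ [w])) x" "set (ws @ [w]) \<subseteq> lang r"
      by (auto intro: labelled_path_append)
    then have "concat (ws @ [w]) \<in> lang (Plus r)" by (auto intro!: exI[of _ "ws @ [w]"])
    then show ?case using \<open>labelled_path D u (concat (ws @ [w])) x\<close> unfolding answers_def by blast
  qed
qed

lemma rel_subset: "(\<And>c. G c \<subseteq> {..<n} \<times> {..<n}) \<Longrightarrow> rel n G cd r \<subseteq> {..<n} \<times> {..<n}"
proof (induction r)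
  case (Plus r)
  then show ?case by (simp add: trancl_subset_Sigma)
qed auto

text \<open>Injectivity makes two consecutive image steps meet in the same preimage. Needed both for
  naming nodes by positions and for encoding product nodes as numbers.\<close>

lemma image_trancl:
  assumes "inj_on f A" "R \<subseteq> A \<times> A"
  shows "map_prod f f ` R\<^sup>+ = (map_prod f f ` R)\<^sup>+"
proof (intro equalityI subsetI)
  fix p assume "p \<in> map_prod f f ` R\<^sup>+"
  then obtain x y where p: "p = (f x, f y)" and xy: "(x, y) \<in> R\<^sup>+" by auto
  from xy have "(f x, f y) \<in> (map_prod f f ` R)\<^sup>+"
  proof (induction rule: trancl_induct)
    case (base y)
    then show ?case by (auto intro!: r_into_trancl rev_image_eqI)
  next
    case (step y z)
    then show ?case by (metis (no_types) map_prod_imageI trancl.trancl_into_trancl)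
  qed
  then show "p \<in> (map_prod f f ` R)\<^sup>+" using p by simp
next
  fix p assume "p \<in> (map_prod f f ` R)\<^sup>+"
  then obtain a b where p: "p = (a, b)" and ab: "(a, b) \<in> (map_prod f f ` R)\<^sup>+" by (cases p) auto
  from ab have "\<exists>x y. a = f x \<and> b = f y \<and> (x, y) \<in> R\<^sup>+"
  proof (induction rule: trancl_induct)
    case (base y)
    then show ?case by auto
  next
    case (step b c)
    then obtain x y where xy: "a = f x" "b = f y" "(x, y) \<in> R\<^sup>+" by blast
    obtain y' z where yz: "b = f y'" "c = f z" "(y', z) \<in> R" using step(2) by auto
    have "y \<in> A" using xy(3) trancl_subset_Sigma[OF assms(2)] by auto
    moreover have "y' \<in> A" using yz(3) assms(2) by auto
    ultimately have "y' = y" using assms(1) xy(2) yz(1) by (auto dest: inj_onD)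
    then show ?case using xy yz by (blast intro: trancl_into_trancl)
  qed
  then show "p \<in> map_prod f f ` R\<^sup>+" using p by auto
qed

lemma image_relcomp:
  assumes "inj_on f A" "R \<subseteq> A \<times> A" "S \<subseteq> A \<times> A"
  shows "map_prod f f ` (R O S) = map_prod f f ` R O map_prod f f ` S"
proof (intro equalityI subsetI)
  fix p assume "p \<in> map_prod f f ` R O map_prod f f ` S"
  then obtain x y y' z where "p = (f x, f z)" "(x, y) \<in> R" "f y = f y'" "(y', z) \<in> S" by auto
  moreover then have "y = y'" using assms by (auto dest: inj_onD)
  ultimately show "p \<in> map_prod f f ` (R O S)" by auto
qed (auto intro!: relcompI rev_image_eqI)

lemma answers_eq_rel:
  assumes "wf_db D" "set vs = nodes D" "distinct vs"
    "\<And>a. G (cd a) = {(i, j). i < length vs \<and> j < length vs \<and> (vs ! i, a, vs ! j) \<in> arcs D}"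
    "\<And>c. G c \<subseteq> {..<length vs} \<times> {..<length vs}"
  shows "answers r D = map_prod ((!) vs) ((!) vs) ` rel (length vs) G cd r"
proof -
  have inj: "inj_on ((!) vs) {..<length vs}" using assms(3) by (simp add: inj_on_nth)
  have sub: "rel (length vs) G cd r \<subseteq> {..<length vs} \<times> {..<length vs}" for r
    using assms(5) by (rule rel_subset)
  show ?thesis
  proof (induction r)
    case Eps
    show ?case unfolding answers_Eps assms(2)[symmetric]
    proof (intro equalityI subsetI)
      fix p assume "p \<in> Id_on (set vs)"
      then obtain i where "i < length vs" "p = map_prod ((!) vs) ((!) vs) (i, i)"
        by (auto simp: in_set_conv_nth)
      then show "p \<in> map_prod ((!) vs) ((!) vs) ` rel (length vs) G cd Eps"
        by (intro image_eqI[of _ _ "(i, i)"]) auto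
    qed auto
  next
    case (Letter a)
    show ?case
    proof (intro equalityI subsetI)
      fix p assume "p \<in> answers (Letter a) D"
      then obtain u v where "p = (u, v)" "(u, a, v) \<in> arcs D"
        using answers_Letter[OF assms(1)] by auto
      moreover then have "u \<in> set vs" "v \<in> set vs" using assms(1,2) by (auto simp: wf_db_def)
      then obtain i j where "i < length vs" "vs ! i = u" "j < length vs" "vs ! j = v"
        by (auto simp: in_set_conv_nth)
      ultimately show "p \<in> map_prod ((!) vs) ((!) vs) ` rel (length vs) G cd (Letter a)"
        by (intro image_eqI[of _ _ "(i, j)"]) (auto simp: assms(4))
    qed (auto simp: assms(4) answers_Letter[OF assms(1)])
  next
    case (Cat r s)
    then show ?case using answers_Cat[OF assms(1)] image_relcomp[OF inj sub sub] by simp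
  next
    case (Alt r s)
    moreover have "answers (Alt r s) D = answers r D \<union> answers s D" by (auto simp: answers_def)
    ultimately show ?case by (simp add: image_Un)
  next
    case (Plus r)
    then show ?case using answers_Plus[OF assms(1)] image_trancl[OF inj sub] by simp
  qed
qed

fun nullable :: "'a rpq \<Rightarrow> bool" where
  "nullable Eps \<longleftrightarrow> True"
| "nullable (Letter a) \<longleftrightarrow> False"
| "nullable (Cat r s) \<longleftrightarrow> nullable r \<and> nullable s"
| "nullable (Alt r s) \<longleftrightarrow> nullable r \<or> nullable s"
| "nullable (Plus r) \<longleftrightarrow> nullable r"

text \<open>Without arcs leaving \<open>u\<close>, only the empty word labels a path from
  it.\<close>

lemma rel_isolated:
  assumes "u < n" "\<And>c v. (u, v) \<notin> G c"
  shows "(u, v) \<in> rel n G cd r \<longleftrightarrow> v = u \<and> nullable r"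
proof (induction r arbitrary: v)
  case Eps
  then show ?case using assms(1) by auto
next
  case (Plus r)
  have "(u, v) \<in> (rel n G cd r)\<^sup>+ \<Longrightarrow> v = u \<and> nullable r"
    by (induction rule: trancl_induct) (auto simp: Plus)
  moreover have "nullable r \<Longrightarrow> (u, u) \<in> (rel n G cd r)\<^sup>+" using Plus by blast
  ultimately show ?case by auto
qed (use assms in auto)

text \<open>The automaton has the states \<open>2 * i\<close> and \<open>2 * i + 1\<close> for entering and leaving the
  subexpression whose prefix notation starts at position \<open>i\<close>. Label \<open>0\<close> stands for \<open>\<epsilon>\<close>.\<close>

fun transitions :: "('a \<Rightarrow> nat) \<Rightarrow> 'a rpq \<Rightarrow> nat \<Rightarrow> (nat \<times> nat \<times> nat) list" where
  "transitions cd Eps i = [(2 * i, 0, 2 * i + 1)]"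
| "transitions cd (Letter a) i = [(2 * i, Suc (cd a), 2 * i + 1)]"
| "transitions cd (Cat r s) i = (let j = i + 1; k = i + 1 + rpq_length r in
     transitions cd s k @ transitions cd r j @
     [(2 * i, 0, 2 * j), (2 * j + 1, 0, 2 * k), (2 * k + 1, 0, 2 * i + 1)])"
| "transitions cd (Alt r s) i = (let j = i + 1; k = i + 1 + rpq_length r in
     transitions cd s k @ transitions cd r j @
     [(2 * i, 0, 2 * j), (2 * i, 0, 2 * k), (2 * j + 1, 0, 2 * i + 1), (2 * k + 1, 0, 2 * i + 1)])"
| "transitions cd (Plus r) i = (let j = i + 1 in transitions cd r j @
     [(2 * i, 0, 2 * j), (2 * j + 1, 0, 2 * i + 1), (2 * j + 1, 0, 2 * j)])"

lemma rpq_length_pos [simp]: "0 < rpq_length r"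
  by (induction r) auto

text \<open>The worst case is alternation, which contributes four transitions of its own.\<close>

lemma length_transitions: "length (transitions cd r i) \<le> 4 * rpq_length r"
proof (induction r arbitrary: i)
  case (Cat r s)
  show ?case using Cat(1)[of "Suc i"] Cat(2)[of "Suc (i + rpq_length r)"] by (simp add: Let_def)
next
  case (Alt r s)
  show ?case using Alt(1)[of "Suc i"] Alt(2)[of "Suc (i + rpq_length r)"] by (simp add: Let_def)
next
  case (Plus r)
  show ?case using Plus[of "Suc i"] by (simp add: Let_def)
qed auto

lemma transitions_states:
  "(p, l, p') \<in> set (transitions cd r i) \<Longrightarrow>
   {p, p'} \<subseteq> {2 * i..<2 * (i + rpq_length r)} \<and> (l = 0 \<or> (\<exists>a. l = Suc (cd a)))"
proof (induction r arbitrary: i)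
  case (Cat r s)
  show ?case using Cat.prems Cat.IH(1)[of "i + 1"] Cat.IH(2)[of "i + 1 + rpq_length r"]
      rpq_length_pos[of r] rpq_length_pos[of s]
    by (auto simp: Let_def simp del: rpq_length_pos)
next
  case (Alt r s)
  show ?case using Alt.prems Alt.IH(1)[of "i + 1"] Alt.IH(2)[of "i + 1 + rpq_length r"]
      rpq_length_pos[of r] rpq_length_pos[of s]
    by (auto simp: Let_def simp del: rpq_length_pos)
next
  case (Plus r)
  show ?case using Plus.prems Plus.IH[of "i + 1"] rpq_length_pos[of r]
    by (auto simp: Let_def simp del: rpq_length_pos)
qed auto

text \<open>Restricting the \<epsilon>-edges to \<open>W\<close>, the end points of arcs, keeps
  their number proportional to the number of arcs rather than of nodes.\<close>

definition prod_edges ::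
    "(nat \<times> nat \<times> nat) set \<Rightarrow> (nat \<Rightarrow> (nat \<times> nat) set) \<Rightarrow> nat set \<Rightarrow> ((nat \<times> nat) \<times> nat \<times> nat) set" where
  "prod_edges T G W = {((v, p), (v', p')). \<exists>l. (p, l, p') \<in> T \<and>
     (if l = 0 then v' = v \<and> v \<in> W else (v, v') \<in> G (l - 1))}"

lemma prod_edges_eps: "(p, 0, p') \<in> T \<Longrightarrow> v \<in> W \<Longrightarrow> ((v, p), (v, p')) \<in> (prod_edges T G W)\<^sup>*"
  by (rule r_into_rtrancl) (auto simp: prod_edges_def)

lemma prod_edges_letter:
  "(p, Suc c, p') \<in> T \<Longrightarrow> (v, v') \<in> G c \<Longrightarrow> ((v, p), (v', p')) \<in> (prod_edges T G W)\<^sup>*"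
  unfolding prod_edges_def by (rule r_into_rtrancl) (simp, rule exI[of _ "Suc c"], simp)

text \<open>Completeness of the automaton. The transitions need only be contained in
  \<open>T\<close>, so the induction hypotheses for subexpressions yield paths in the automaton of
  the whole query.\<close>

lemma rel_imp_prod_edges:
  assumes "\<And>c. G c \<subseteq> W \<times> W"
  shows "set (transitions cd r i) \<subseteq> T \<Longrightarrow> (u, v) \<in> rel n G cd r \<Longrightarrow> u \<in> W \<Longrightarrow>
    v \<in> W \<and> ((u, 2 * i), (v, 2 * i + 1)) \<in> (prod_edges T G W)\<^sup>*"
proof (induction r arbitrary: i u v)
  case Eps
  then show ?case by (auto intro: prod_edges_eps)
next
  case (Letter a)
  then have "(u, v) \<in> G (cd a)" by simp
  moreover from this have "v \<in> W" using assms[of "cd a"] by blast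
  moreover have "(2 * i, Suc (cd a), 2 * i + 1) \<in> T" using Letter.prems(1) by simp
  ultimately show ?case by (blast intro: prod_edges_letter)
next
  case (Cat r s)
  let ?j = "i + 1" and ?k = "i + 1 + rpq_length r"
  obtain t where t: "(u, t) \<in> rel n G cd r" "(t, v) \<in> rel n G cd s" using Cat.prems by auto
  have 1: "t \<in> W \<and> ((u, 2 * ?j), (t, 2 * ?j + 1)) \<in> (prod_edges T G W)\<^sup>*"
    using Cat.IH(1)[of ?j] Cat.prems t by (auto simp: Let_def)
  have 2: "v \<in> W \<and> ((t, 2 * ?k), (v, 2 * ?k + 1)) \<in> (prod_edges T G W)\<^sup>*"
    using Cat.IH(2)[of ?k] Cat.prems t 1 by (auto simp: Let_def)
  have "((u, 2 * i), (u, 2 * ?j)) \<in> (prod_edges T G W)\<^sup>*"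
    "((t, 2 * ?j + 1), (t, 2 * ?k)) \<in> (prod_edges T G W)\<^sup>*"
    "((v, 2 * ?k + 1), (v, 2 * i + 1)) \<in> (prod_edges T G W)\<^sup>*"
    using Cat.prems 1 2 by (auto simp: Let_def intro!: prod_edges_eps)
  then show ?case using 1 2 by (meson rtrancl_trans)
next
  case (Alt r s)
  let ?j = "i + 1" and ?k = "i + 1 + rpq_length r"
  have e: "((u, 2 * i), (u, 2 * ?j)) \<in> (prod_edges T G W)\<^sup>*"
    "((u, 2 * i), (u, 2 * ?k)) \<in> (prod_edges T G W)\<^sup>*"
    "v \<in> W \<Longrightarrow> ((v, 2 * ?j + 1), (v, 2 * i + 1)) \<in> (prod_edges T G W)\<^sup>*"
    "v \<in> W \<Longrightarrow> ((v, 2 * ?k + 1), (v, 2 * i + 1)) \<in> (prod_edges T G W)\<^sup>*"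
    using Alt.prems by (auto simp: Let_def intro!: prod_edges_eps)
  from Alt.prems(2) consider "(u, v) \<in> rel n G cd r" | "(u, v) \<in> rel n G cd s" by auto
  then show ?case
  proof cases
    case 1
    then have "v \<in> W \<and> ((u, 2 * ?j), (v, 2 * ?j + 1)) \<in> (prod_edges T G W)\<^sup>*"
      using Alt.IH(1)[of ?j] Alt.prems by (auto simp: Let_def)
    then show ?thesis using e(1,3) by (meson rtrancl_trans)
  next
    case 2
    then have "v \<in> W \<and> ((u, 2 * ?k), (v, 2 * ?k + 1)) \<in> (prod_edges T G W)\<^sup>*"
      using Alt.IH(2)[of ?k] Alt.prems by (auto simp: Let_def)
    then show ?thesis using e(2,4) by (meson rtrancl_trans)
  qed
next
  case (Plus r)
  let ?j = "i + 1"
  have IH: "v \<in> W \<and> ((u, 2 * ?j), (v, 2 * ?j + 1)) \<in> (prod_edges T G W)\<^sup>*"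
    if "(u, v) \<in> rel n G cd r" "u \<in> W" for u v
    using Plus.IH[of ?j] Plus.prems that by (auto simp: Let_def)
  have e: "((x, 2 * i), (x, 2 * ?j)) \<in> (prod_edges T G W)\<^sup>*"
    "((x, 2 * ?j + 1), (x, 2 * ?j)) \<in> (prod_edges T G W)\<^sup>*"
    "((x, 2 * ?j + 1), (x, 2 * i + 1)) \<in> (prod_edges T G W)\<^sup>*" if "x \<in> W" for x
    using Plus.prems that by (auto simp: Let_def intro!: prod_edges_eps)
  have "(u, v) \<in> (rel n G cd r)\<^sup>+" using Plus.prems(2) by simp
  then have "v \<in> W \<and> ((u, 2 * ?j), (v, 2 * ?j + 1)) \<in> (prod_edges T G W)\<^sup>*"
  proof (induction rule: trancl_induct)
    case (base y)
    then show ?case using IH Plus.prems(3) by blast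
  next
    case (step y z)
    then show ?case using IH e(2) by (meson rtrancl_trans)
  qed
  then show ?case using e Plus.prems(3) by (meson rtrancl_trans)
qed

text \<open>\<open>pre r i Y p\<close> is the set of nodes in which the automaton of \<open>r\<close> can be in state \<open>p\<close>
  when it is entered from its context in the nodes \<open>Y\<close>.\<close>

fun pre :: "nat \<Rightarrow> (nat \<Rightarrow> (nat \<times> nat) set) \<Rightarrow> ('a \<Rightarrow> nat) \<Rightarrow> 'a rpq \<Rightarrow> nat \<Rightarrow> nat set \<Rightarrow> nat \<Rightarrow> nat set"
where
  "pre n G cd Eps i Y p = Y"
| "pre n G cd (Letter a) i Y p = (if p = 2 * i then Y else G (cd a) `` Y)"
| "pre n G cd (Cat r s) i Y p =
     (if p = 2 * i then Y else if p = 2 * i + 1 then rel n G cd (Cat r s) `` Y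
      else if p < 2 * (i + 1 + rpq_length r) then pre n G cd r (i + 1) Y p
      else pre n G cd s (i + 1 + rpq_length r) (rel n G cd r `` Y) p)"
| "pre n G cd (Alt r s) i Y p =
     (if p = 2 * i then Y else if p = 2 * i + 1 then rel n G cd (Alt r s) `` Y
      else if p < 2 * (i + 1 + rpq_length r) then pre n G cd r (i + 1) Y p
      else pre n G cd s (i + 1 + rpq_length r) Y p)"
| "pre n G cd (Plus r) i Y p =
     (if p = 2 * i then Y else if p = 2 * i + 1 then rel n G cd (Plus r) `` Y
      else pre n G cd r (i + 1) ((rel n G cd r)\<^sup>* `` Y) p)"

lemma pre_in [simp]: "pre n G cd r i Y (2 * i) = Y"
  by (cases r) auto

text \<open>\<open>Eps\<close> denotes the identity on \<open>{..<n}\<close>, so its image of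
  \<open>Y\<close> is \<open>Y\<close> only because \<open>Y\<close> stays inside that
  range.\<close>

lemma pre_out: "Y \<subseteq> {..<n} \<Longrightarrow> pre n G cd r i Y (Suc (2 * i)) = rel n G cd r `` Y"
  by (cases r) auto

text \<open>Soundness without decomposing paths: \<open>pre\<close> assigns to each state a set of
  nodes that every transition respects, so it contains all that is reachable, and at the exit state
  it is the image under the relation of the expression.\<close>

lemma pre_closed:
  assumes "\<And>c. G c \<subseteq> {..<n} \<times> {..<n}"
  shows "(p, l, p') \<in> set (transitions cd r i) \<Longrightarrow> Y \<subseteq> {..<n} \<Longrightarrow> v \<in> pre n G cd r i Y p \<Longrightarrow>
    (if l = 0 then v' = v else (v, v') \<in> G (l - 1)) \<Longrightarrow> v' \<in> pre n G cd r i Y p'"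
proof (induction r arbitrary: i Y)
  case (Cat r s)
  let ?j = "i + 1" and ?k = "i + 1 + rpq_length r"
  have Z: "rel n G cd r `` Y \<subseteq> {..<n}" using rel_subset[of G n cd r, OF assms] by auto
  have o: "pre n G cd r ?j Y (Suc (2 * ?j)) = rel n G cd r `` Y"
    "pre n G cd s ?k (rel n G cd r `` Y) (Suc (2 * ?k)) = rel n G cd s `` (rel n G cd r `` Y)"
    by (rule pre_out, fact)+
  consider "(p, l, p') \<in> set (transitions cd s ?k)" | "(p, l, p') \<in> set (transitions cd r ?j)"
    | "(p, l, p') = (2 * i, 0, 2 * ?j)" | "(p, l, p') = (2 * ?j + 1, 0, 2 * ?k)"
    | "(p, l, p') = (2 * ?k + 1, 0, 2 * i + 1)" using Cat.prems(1) by (auto simp: Let_def)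
  then show ?case
  proof cases
    case 1
    then show ?thesis using transitions_states[OF 1] Cat.IH(2)[OF 1 Z] Cat.prems(3,4) by (auto split: if_splits)
  next
    case 2
    then show ?thesis using transitions_states[OF 2] Cat.IH(1)[OF 2 Cat.prems(2)] Cat.prems(3,4)
      by (auto split: if_splits)
  next
    case 3
    then show ?thesis using Cat.prems(3,4) pre_in[of n G cd r ?j Y] rpq_length_pos[of r] by auto
  next
    case 4
    then show ?thesis using Cat.prems(3,4) o(1) pre_in[of n G cd s ?k "rel n G cd r `` Y"] rpq_length_pos[of r]
      by auto
  next
    case 5
    then show ?thesis using Cat.prems(3,4) o(2) by auto
  qed
next
  case (Alt r s)
  let ?j = "i + 1" and ?k = "i + 1 + rpq_length r"
  have o: "pre n G cd r ?j Y (Suc (2 * ?j)) = rel n G cd r `` Y"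
    "pre n G cd s ?k Y (Suc (2 * ?k)) = rel n G cd s `` Y"
    by (rule pre_out, fact)+
  consider "(p, l, p') \<in> set (transitions cd s ?k)" | "(p, l, p') \<in> set (transitions cd r ?j)"
    | "(p, l, p') = (2 * i, 0, 2 * ?j)" | "(p, l, p') = (2 * i, 0, 2 * ?k)"
    | "(p, l, p') = (2 * ?j + 1, 0, 2 * i + 1)" | "(p, l, p') = (2 * ?k + 1, 0, 2 * i + 1)"
    using Alt.prems(1) by (auto simp: Let_def)
  then show ?case
  proof cases
    case 1
    then show ?thesis using transitions_states[OF 1] Alt.IH(2)[OF 1 Alt.prems(2)] Alt.prems(3,4)
      by (auto split: if_splits)
  next
    case 2
    then show ?thesis using transitions_states[OF 2] Alt.IH(1)[OF 2 Alt.prems(2)] Alt.prems(3,4)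
      by (auto split: if_splits)
  next
    case 3
    then show ?thesis using Alt.prems(3,4) pre_in[of n G cd r ?j Y] rpq_length_pos[of r] by auto
  next
    case 4
    then show ?thesis using Alt.prems(3,4) pre_in[of n G cd s ?k Y] rpq_length_pos[of r] by auto
  next
    case 5
    then show ?thesis using Alt.prems(3,4) o(1) rpq_length_pos[of r] by auto
  next
    case 6
    then show ?thesis using Alt.prems(3,4) o(2) by auto
  qed
next
  case (Plus r)
  \<comment> \<open>The transition back to the entry feeds results in again, so the inner expression
    is entered from the closure of \<open>Y\<close>.\<close>
  let ?j = "i + 1" and ?Z = "(rel n G cd r)\<^sup>* `` Y"
  have Z: "?Z \<subseteq> {..<n}"
    using Plus.prems(2) trancl_subset_Sigma[OF rel_subset[of G n cd r, OF assms]]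
    by (auto simp: rtrancl_eq_or_trancl)
  have o: "pre n G cd r ?j ?Z (Suc (2 * ?j)) = (rel n G cd r)\<^sup>+ `` Y"
    using pre_out[OF Z, of G cd r ?j] by (auto simp: trancl_unfold_right)
  consider "(p, l, p') \<in> set (transitions cd r ?j)"
    | "(p, l, p') = (2 * i, 0, 2 * ?j)" | "(p, l, p') = (2 * ?j + 1, 0, 2 * i + 1)"
    | "(p, l, p') = (2 * ?j + 1, 0, 2 * ?j)" using Plus.prems(1) by (auto simp: Let_def)
  then show ?case
  proof cases
    case 1
    then show ?thesis using transitions_states[OF 1] Plus.IH[OF 1 Z] Plus.prems(3,4) by (auto split: if_splits)
  next
    case 2
    then show ?thesis using Plus.prems(3,4) pre_in[of n G cd r ?j ?Z] by auto
  next
    case 3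
    then show ?thesis using Plus.prems(3,4) o by auto
  next
    case 4
    then show ?thesis using Plus.prems(3,4) o pre_in[of n G cd r ?j ?Z] by (auto simp: trancl_into_rtrancl)
  qed
qed (auto split: if_splits)

theorem rel_iff_prod_edges:
  assumes "\<And>c. G c \<subseteq> W \<times> W" "W \<subseteq> {..<n}" "u \<in> W"
  shows "(u, v) \<in> rel n G cd r \<longleftrightarrow> ((u, 0), (v, 1)) \<in> (prod_edges (set (transitions cd r 0)) G W)\<^sup>*"
proof
  assume "(u, v) \<in> rel n G cd r"
  then show "((u, 0), (v, 1)) \<in> (prod_edges (set (transitions cd r 0)) G W)\<^sup>*"
    using rel_imp_prod_edges[of G W cd r 0 _ u v n] assms(1,3) by auto
next
  have G: "G c \<subseteq> {..<n} \<times> {..<n}" for c using assms(1)[of c] assms(2) by blast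
  have *: "fst x \<in> pre n G cd r 0 {u} (snd x)"
    if "((u, 0), x) \<in> (prod_edges (set (transitions cd r 0)) G W)\<^sup>*" for x
    using that
  proof (induction rule: rtrancl_induct)
    case base
    then show ?case using pre_in[of n G cd r 0 "{u}"] by simp
  next
    case (step x y)
    then obtain l where l: "(snd x, l, snd y) \<in> set (transitions cd r 0)"
      "if l = 0 then fst y = fst x else (fst x, fst y) \<in> G (l - 1)"
      by (auto simp: prod_edges_def split: if_splits)
    have "{u} \<subseteq> {..<n}" using assms(2,3) by auto
    from pre_closed[of G n, OF G l(1) this step.IH l(2)] show ?case .
  qed
  from *[of "(v, 1)"] show "((u, 0), (v, 1)) \<in> (prod_edges (set (transitions cd r 0)) G W)\<^sup>* \<Longrightarrow>
    (u, v) \<in> rel n G cd r"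
    using pre_out[of "{u}" n G cd r 0] assms(2,3) by auto
qed

section \<open>The product graph\<close>

text \<open>Reversed because a new edge is put at the head of its linked list.\<close>

definition nbr :: "(nat \<times> nat) list \<Rightarrow> nat \<Rightarrow> nat list" where
  "nbr es x = rev (map snd (filter (\<lambda>e. fst e = x) es))"

lemma nbr_Nil [simp]: "nbr [] x = []"
  by (simp add: nbr_def)

lemma nbr_append: "nbr (es @ [(x, y)]) = (nbr es)(x := y # nbr es x)"
  by (auto simp: nbr_def)

lemma set_nbr [simp]: "set (nbr es x) = {y. (x, y) \<in> set es}"
  by (force simp: nbr_def)

lemma in_set_swap [simp]: "(x, y) \<in> prod.swap ` E \<longleftrightarrow> (y, x) \<in> E"
  by force

lemma sum_length_nbr: "finite U \<Longrightarrow> (\<Sum>x\<in>U. length (nbr es x)) \<le> length es"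
proof (induction es rule: rev_induct)
  case (snoc e es)
  have "(\<Sum>x\<in>U. length (nbr (es @ [e]) x)) = (\<Sum>x\<in>U. length (nbr es x) + (if x = fst e then 1 else 0))"
    by (cases e) (auto simp: nbr_append intro!: sum.cong)
  also have "\<dots> = (\<Sum>x\<in>U. length (nbr es x)) + (if fst e \<in> U then 1 else 0)"
    using snoc.prems by (simp add: sum.distrib)
  finally show ?case using snoc.IH[OF snoc.prems] by simp
qed simp

lemma weight_nbr: "finite U \<Longrightarrow> weight (nbr es) U \<le> card U + length es"
  using sum_length_nbr[of U es] by (simp add: weight_def sum.distrib sum_Suc)

lemma weight_mono: "U \<subseteq> U' \<Longrightarrow> finite U' \<Longrightarrow> weight nb U \<le> weight nb U'"
  unfolding weight_def by (rule sum_mono2) auto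

lemma reach_forward: "reach (nbr es) {} r = {x. (r, x) \<in> (set es)\<^sup>*}"
  by (simp add: reach_def)

text \<open>If \<open>F\<close> is closed under predecessors, a path that starts outside
  \<open>F\<close> never enters it. Pruning at \<open>F\<close> therefore loses only the nodes of
  \<open>F\<close> themselves.\<close>

lemma reach_backward:
  assumes "\<And>x y. (x, y) \<in> set es \<Longrightarrow> y \<in> F \<Longrightarrow> x \<in> F"
  shows "reach (nbr (map prod.swap es)) F r = {x. x \<notin> F \<and> (x, r) \<in> (set es)\<^sup>*}"
proof (intro equalityI subsetI)
  fix x assume "x \<in> reach (nbr (map prod.swap es)) F r"
  then have "r \<notin> F" "(r, x) \<in> {(a, b). b \<in> set (nbr (map prod.swap es) a) \<and> b \<notin> F}\<^sup>*"
    by (simp_all add: reach_def)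
  from this(2) show "x \<in> {x. x \<notin> F \<and> (x, r) \<in> (set es)\<^sup>*}"
  proof (induction rule: rtrancl_induct)
    case base
    then show ?case using \<open>r \<notin> F\<close> by simp
  next
    case (step y z)
    then show ?case by (auto intro: converse_rtrancl_into_rtrancl)
  qed
next
  fix x assume "x \<in> {x. x \<notin> F \<and> (x, r) \<in> (set es)\<^sup>*}"
  then have "(x, r) \<in> (set es)\<^sup>*" "x \<notin> F" by auto
  then show "x \<in> reach (nbr (map prod.swap es)) F r"
  proof (induction rule: converse_rtrancl_induct)
    case base
    then show ?case by (simp add: reach_def)
  next
    case (step y z)
    then have "z \<notin> F" using assms by blast
    from step.IH[OF this] show ?case by (rule reach_step) (use step in simp_all)
  qed
qed

text \<open>The product node for node \<open>v\<close> and state \<open>p\<close> is encoded as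
  \<open>v * S + p\<close>. The order of the list is the one in which the program creates the
  edges.\<close>

definition lab_edges ::
    "nat \<Rightarrow> (nat \<times> nat \<times> nat) list \<Rightarrow> (nat \<times> nat \<times> nat) list \<Rightarrow> (nat \<times> nat) list" where
  "lab_edges S ts as = concat (map (\<lambda>(v, a, y).
     map (\<lambda>(p, l, p'). (v * S + p, y * S + p')) (filter (\<lambda>(p, l, p'). l = Suc a) ts)) as)"

definition eps_edges :: "nat \<Rightarrow> (nat \<times> nat \<times> nat) list \<Rightarrow> nat list \<Rightarrow> (nat \<times> nat) list" where
  "eps_edges S ts vs = concat (map (\<lambda>v.
     map (\<lambda>(p, l, p'). (v * S + p, v * S + p')) (filter (\<lambda>(p, l, p'). l = 0) ts)) vs)"

lemma length_lab_edges: "length (lab_edges S ts as) \<le> length ts * length as"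
proof (induction as)
  case (Cons a as)
  obtain v b y where "a = (v, b, y)" by (cases a) auto
  then have "length (lab_edges S ts (a # as)) =
      length (filter (\<lambda>(p, l, p'). l = Suc b) ts) + length (lab_edges S ts as)"
    by (simp add: lab_edges_def)
  also have "\<dots> \<le> length ts + length ts * length as" by (intro add_mono length_filter_le Cons.IH)
  finally show ?case by simp
qed (simp add: lab_edges_def)

lemma length_eps_edges: "length (eps_edges S ts vs) \<le> length ts * length vs"
proof (induction vs)
  case (Cons v vs)
  have "length (eps_edges S ts (v # vs)) =
      length (filter (\<lambda>(p, l, p'). l = 0) ts) + length (eps_edges S ts vs)"
    by (simp add: eps_edges_def)
  also have "\<dots> \<le> length ts + length ts * length vs" by (intro add_mono length_filter_le Cons.IH)
  finally show ?case by simp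
qed (simp add: eps_edges_def)

lemma encode_eq_iff:
  fixes S :: nat
  assumes "p < S" "p' < S"
  shows "v * S + p = v' * S + p' \<longleftrightarrow> v = v' \<and> p = p'"
proof
  assume *: "v * S + p = v' * S + p'"
  have "(v * S + p) div S = v" "(v' * S + p') div S = v'" using assms by auto
  then show "v = v' \<and> p = p'" using * by simp
qed simp

lemma rtrancl_encode:
  fixes S :: nat
  assumes "\<And>v p v' p'. ((v, p), (v', p')) \<in> R \<Longrightarrow> p < S \<and> p' < S"
    and E: "E = map_prod (\<lambda>(v, p). v * S + p) (\<lambda>(v, p). v * S + p) ` R"
    and p: "p < S" "p' < S"
  shows "(u * S + p, v * S + p') \<in> E\<^sup>* \<longleftrightarrow> ((u, p), (v, p')) \<in> R\<^sup>*"
proof -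
  let ?f = "\<lambda>(v, p). v * S + p" and ?A = "UNIV \<times> {..<S}"
  have inj: "inj_on ?f ?A" by (auto simp: inj_on_def encode_eq_iff)
  have R: "R \<subseteq> ?A \<times> ?A" using assms(1) by fastforce
  have "(u * S + p, v * S + p') \<in> E\<^sup>+ \<longleftrightarrow> ((u, p), (v, p')) \<in> R\<^sup>+"
  proof
    assume "(u * S + p, v * S + p') \<in> E\<^sup>+"
    then obtain x y where xy: "(x, y) \<in> R\<^sup>+" "?f x = ?f (u, p)" "?f y = ?f (v, p')"
      unfolding E image_trancl[OF inj R, symmetric] by auto
    moreover have "x \<in> ?A" "y \<in> ?A" using xy(1) trancl_subset_Sigma[OF R] by blast+
    ultimately have "x = (u, p)" "y = (v, p')" using p by (auto simp: encode_eq_iff)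
    then show "((u, p), (v, p')) \<in> R\<^sup>+" using xy(1) by simp
  next
    assume "((u, p), (v, p')) \<in> R\<^sup>+"
    then show "(u * S + p, v * S + p') \<in> E\<^sup>+"
      unfolding E image_trancl[OF inj R, symmetric] by (force intro: rev_image_eqI)
  qed
  then show ?thesis using p by (auto simp: rtrancl_eq_or_trancl encode_eq_iff)
qed

section \<open>The product graph of a given input\<close>

locale query_input =
  fixes cd :: "'a \<Rightarrow> nat" and r :: "'a rpq" and n A :: nat and xss :: "nat list list"
  assumes length_xss: "length xss = n * A"
    and xss_less: "ys \<in> set xss \<Longrightarrow> y \<in> set ys \<Longrightarrow> y < n"
    and cd_less: "cd a < A"
begin

abbreviation "q \<equiv> rpq_length r"
definition "m = length (concat xss)"
definition "S = 2 * q"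
definition "K = (m div n + 1) * q"
definition "ts = transitions cd r 0"
definition "arc_list = concat (map (\<lambda>l. map (\<lambda>y. (l div A, l mod A, y)) (xss ! l)) [0..<n * A])"
definition "G c = {(v, y). (v, c, y) \<in> set arc_list}"
definition "W = fst ` set arc_list \<union> (snd \<circ> snd) ` set arc_list"
definition "edges = lab_edges S ts arc_list @ eps_edges S ts (filter (\<lambda>v. v \<in> W) [0..<n])"
definition "U = (\<lambda>(v, p). v * S + p) ` (W \<times> {..<S})"
definition "Rel = rel n G cd r"
text \<open>State 1 is the exit of the whole query, hence the offset 1. The bound \<open>v\<close>
  reflects that targets are processed in increasing order.\<close>

definition "tgts v x = filter (\<lambda>t. (x, t * S + 1) \<in> (set edges)\<^sup>*) [0..<v]"
definition "row u = filter (\<lambda>v. (u, v) \<in> Rel) [0..<n]"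

lemma S_pos: "1 < S" "0 < S"
  using rpq_length_pos[of r] unfolding S_def by linarith+

lemma K_pos: "0 < K"
  by (simp add: K_def)

lemma A_pos: "0 < A"
  using cd_less[of undefined] by simp

lemma length_arc_list: "length arc_list = m"
proof -
  have "length arc_list = sum_list (map (\<lambda>l. length (xss ! l)) [0..<length xss])"
    by (simp add: arc_list_def length_concat length_xss comp_def)
  also have "map (\<lambda>l. length (xss ! l)) [0..<length xss] = map length xss"
    by (rule nth_equalityI) auto
  finally show ?thesis by (simp add: m_def length_concat)
qed

lemma arc_list_less: "(v, a, y) \<in> set arc_list \<Longrightarrow> v < n \<and> a < A \<and> y < n"
  using A_pos xss_less[OF nth_mem] length_xss by (auto simp: arc_list_def less_mult_imp_div_less)

lemma W_less: "v \<in> W \<Longrightarrow> v < n"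
  using arc_list_less by (force simp: W_def)

lemma finite_W: "finite W"
  by (simp add: W_def)

lemma card_W: "card W \<le> 2 * m"
proof -
  have "W = set (map fst arc_list) \<union> set (map (snd \<circ> snd) arc_list)" by (simp add: W_def)
  then have "card W \<le> card (set (map fst arc_list)) + card (set (map (snd \<circ> snd) arc_list))"
    using card_Un_le by metis
  also have "\<dots> \<le> m + m"
    using card_length[of "map fst arc_list"] card_length[of "map (snd \<circ> snd) arc_list"]
    by (intro add_mono) (simp_all add: length_arc_list)
  finally show ?thesis by simp
qed

lemma G_subset_W: "G c \<subseteq> W \<times> W"
  by (force simp: G_def W_def)

lemma G_subset: "G c \<subseteq> {..<n} \<times> {..<n}"
  using G_subset_W[of c] W_less by blast

lemma length_ts: "length ts \<le> 4 * q"
  unfolding ts_def by (rule length_transitions)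

lemma ts_less: "(p, l, p') \<in> set ts \<Longrightarrow> p < S \<and> p' < S \<and> l \<le> A"
  unfolding ts_def using transitions_states[of p l p' cd r 0] cd_less by (auto simp: S_def Suc_le_eq)

lemma length_W_list: "length (filter (\<lambda>v. v \<in> W) [0..<n]) = card W"
proof -
  have "length (filter (\<lambda>v. v \<in> W) [0..<n]) = card (set (filter (\<lambda>v. v \<in> W) [0..<n]))"
    by (rule distinct_card[symmetric]) simp
  also have "set (filter (\<lambda>v. v \<in> W) [0..<n]) = W" using W_less by auto
  finally show ?thesis .
qed

text \<open>At most \<open>4 * q\<close> transitions combine with \<open>m\<close> arcs and with at
  most \<open>2 * m\<close> non-isolated nodes.\<close>

lemma length_edges: "length edges \<le> 12 * q * m"
proof -
  have "length edges \<le> length ts * m + length ts * card W"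
    using length_lab_edges[of S ts arc_list] length_eps_edges[of S ts "filter (\<lambda>v. v \<in> W) [0..<n]"]
    by (simp add: edges_def length_arc_list length_W_list)
  also have "\<dots> \<le> 4 * q * m + 4 * q * (2 * m)"
    using length_ts card_W by (intro add_mono mult_le_mono) auto
  finally show ?thesis by simp
qed

lemma set_edges:
  "set edges = map_prod (\<lambda>(v, p). v * S + p) (\<lambda>(v, p). v * S + p) ` prod_edges (set ts) G W"
proof (intro equalityI subsetI)
  fix e assume "e \<in> set edges"
  then consider (lab) v a y p p' where "(v, a, y) \<in> set arc_list" "(p, Suc a, p') \<in> set ts"
      "e = (v * S + p, y * S + p')"
    | (eps) v p p' where "v \<in> W" "(p, 0, p') \<in> set ts" "e = (v * S + p, v * S + p')"
    by (auto simp: edges_def lab_edges_def eps_edges_def)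
  then show "e \<in> map_prod (\<lambda>(v, p). v * S + p) (\<lambda>(v, p). v * S + p) ` prod_edges (set ts) G W"
  proof cases
    case lab
    then have "((v, p), (y, p')) \<in> prod_edges (set ts) G W"
      by (auto simp: prod_edges_def G_def intro!: exI[of _ "Suc a"])
    then show ?thesis using lab by (intro image_eqI[of _ _ "((v, p), (y, p'))"]) auto
  next
    case eps
    then have "((v, p), (v, p')) \<in> prod_edges (set ts) G W" by (auto simp: prod_edges_def)
    then show ?thesis using eps by (intro image_eqI[of _ _ "((v, p), (v, p'))"]) auto
  qed
next
  fix e assume "e \<in> map_prod (\<lambda>(v, p). v * S + p) (\<lambda>(v, p). v * S + p) ` prod_edges (set ts) G W"
  then obtain v p y p' where e: "e = (v * S + p, y * S + p')" "((v, p), (y, p')) \<in> prod_edges (set ts) G W"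
    by auto
  then obtain l where l: "(p, l, p') \<in> set ts" "if l = 0 then y = v \<and> v \<in> W else (v, y) \<in> G (l - 1)"
    by (auto simp: prod_edges_def)
  show "e \<in> set edges"
  proof (cases l)
    case 0
    then have "v \<in> set (filter (\<lambda>v. v \<in> W) [0..<n])" "y = v" using l(2) W_less by auto
    then have "e \<in> set (eps_edges S ts (filter (\<lambda>v. v \<in> W) [0..<n]))"
      using 0 l(1) e(1) unfolding eps_edges_def
      by (auto intro!: bexI[of _ v] image_eqI[of _ _ "(p, 0, p')"])
    then show ?thesis by (simp add: edges_def)
  next
    case (Suc a)
    then have "(v, a, y) \<in> set arc_list" using l(2) by (simp add: G_def)
    then have "e \<in> set (lab_edges S ts arc_list)"
      using Suc l(1) e(1) unfolding lab_edges_def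
      by (auto intro!: bexI[of _ "(v, a, y)"] image_eqI[of _ _ "(p, Suc a, p')"])
    then show ?thesis by (simp add: edges_def)
  qed
qed

lemma edges_U: "(x, y) \<in> set edges \<Longrightarrow> x \<in> U \<and> y \<in> U"
proof -
  assume "(x, y) \<in> set edges"
  then obtain v p v' p' where *: "x = v * S + p" "y = v' * S + p'"
    "((v, p), (v', p')) \<in> prod_edges (set ts) G W" by (auto simp: set_edges)
  then have "p < S" "p' < S" "v \<in> W" "v' \<in> W"
    using ts_less G_subset_W by (fastforce simp: prod_edges_def split: if_splits)+
  then show ?thesis using * by (auto simp: U_def intro!: image_eqI[of _ _ "(_, _)"])
qed

lemma U_iff: "v * S + p \<in> U \<longleftrightarrow> v \<in> W" if "p < S"
  using that by (auto simp: U_def encode_eq_iff intro!: image_eqI[of _ _ "(v, p)"])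

lemma U_less: "x \<in> U \<Longrightarrow> x < n * S"
proof -
  assume "x \<in> U"
  then obtain v p where x: "x = v * S + p" "v < n" "p < S" using W_less by (auto simp: U_def)
  then have "v * S + p < Suc v * S" by simp
  also have "\<dots> \<le> n * S" using x(2) by (intro mult_le_mono) auto
  finally show ?thesis using x by simp
qed

lemma finite_U: "finite U"
  by (simp add: U_def finite_W)

lemma card_U: "card U \<le> 4 * q * m"
proof -
  have "card U \<le> card (W \<times> {..<S})" unfolding U_def using finite_W by (intro card_image_le) auto
  also have "\<dots> \<le> (2 * m) * S" using card_W by (simp add: card_cartesian_product)
  finally show ?thesis by (simp add: S_def ac_simps)
qed

lemma rtrancl_edges_U: "(x, y) \<in> (set edges)\<^sup>* \<Longrightarrow> x \<in> U \<longleftrightarrow> y \<in> U"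
  by (induction rule: rtrancl_induct) (auto dest: edges_U)

lemma Rel_iff: "u \<in> W \<Longrightarrow> (u, v) \<in> Rel \<longleftrightarrow> (u * S, v * S + 1) \<in> (set edges)\<^sup>*"
proof -
  assume u: "u \<in> W"
  have "(u * S + 0, v * S + 1) \<in> (set edges)\<^sup>* \<longleftrightarrow> ((u, 0), (v, 1)) \<in> (prod_edges (set ts) G W)\<^sup>*"
    using S_pos ts_less
    by (intro rtrancl_encode[OF _ set_edges]) (auto simp: prod_edges_def dest: ts_less)
  then show ?thesis
    using rel_iff_prod_edges[where G = G and W = W and n = n and cd = cd and r = r, OF G_subset_W _ u] W_less
    by (auto simp: Rel_def ts_def)
qed

lemma row_W: "u \<in> W \<Longrightarrow> row u = tgts n (u * S)"
  using Rel_iff by (auto simp: row_def tgts_def)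

lemma row_isolated: "u < n \<Longrightarrow> u \<notin> W \<Longrightarrow> row u = (if nullable r then [u] else [])"
proof -
  assume u: "u < n" "u \<notin> W"
  then have "(u, v) \<notin> G c" for c v using G_subset_W[of c] by auto
  then have *: "(u, v) \<in> Rel \<longleftrightarrow> v = u \<and> nullable r" for v
    unfolding Rel_def using rel_isolated[OF u(1)] by metis
  have "filter (\<lambda>v. v = u) [0..<k] = (if u < k then [u] else [])" for k
    by (induction k) auto
  then show ?thesis using u(1) by (simp add: row_def *)
qed

lemma tgts_Suc: "tgts (Suc v) x = tgts v x @ (if (x, v * S + 1) \<in> (set edges)\<^sup>* then [v] else [])"
  by (simp add: tgts_def)

lemma tgts_Suc_isolated: "x \<in> U \<Longrightarrow> v \<notin> W \<Longrightarrow> tgts (Suc v) x = tgts v x"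
  using rtrancl_edges_U[of x "v * S + 1"] U_iff[of 1 v] S_pos by (auto simp: tgts_Suc)

text \<open>Whatever a node reaches is also reached by its predecessors. So the nodes with a full
  list are closed under predecessors, as pruning requires.\<close>

lemma length_tgts_mono: "(x, y) \<in> set edges \<Longrightarrow> length (tgts v y) \<le> length (tgts v x)"
proof -
  assume "(x, y) \<in> set edges"
  then have "(x, t) \<in> (set edges)\<^sup>*" if "(y, t) \<in> (set edges)\<^sup>*" for t
    using that by (rule converse_rtrancl_into_rtrancl)
  then show ?thesis unfolding tgts_def by (induct v rule: nat_induct) auto
qed

text \<open>A pruned backward search from target \<open>v\<close> visits exactly the nodes that
  still lack targets and do reach \<open>v\<close>.\<close>

lemma reach_pruned:
  assumes "\<And>x. x \<in> U \<Longrightarrow> cnt x = min K (length (tgts v x))" "\<And>x. x \<notin> U \<Longrightarrow> cnt x = 0"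
  shows "reach (nbr (map prod.swap edges)) {x. K \<le> cnt x} (v * S + 1) =
    {x. cnt x < K \<and> (x, v * S + 1) \<in> (set edges)\<^sup>*}"
proof -
  have "reach (nbr (map prod.swap edges)) {x. K \<le> cnt x} (v * S + 1) =
    {x. x \<notin> {x. K \<le> cnt x} \<and> (x, v * S + 1) \<in> (set edges)\<^sup>*}"
  proof (rule reach_backward)
    fix x y assume *: "(x, y) \<in> set edges" "y \<in> {x. K \<le> cnt x}"
    then show "x \<in> {x. K \<le> cnt x}"
      using edges_U[OF *(1)] length_tgts_mono[OF *(1), of v] assms(1)[of x] assms(1)[of y] by simp
  qed
  then show ?thesis by (simp add: not_le)
qed

lemma weight_edges_le: "weight (nbr edges) U \<le> 16 * q * m"
  using weight_nbr[OF finite_U, of edges] card_U length_edges by simp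

lemma weight_swap_edges_le: "weight (nbr (map prod.swap edges)) U \<le> 16 * q * m"
  using weight_nbr[OF finite_U, of "map prod.swap edges"] card_U length_edges by simp

end

section \<open>Parsing the query\<close>

definition add_trans :: "exp \<Rightarrow> exp \<Rightarrow> exp \<Rightarrow> com" where
  "add_trans a b c =
     (Tp\<langle>V Vtc\<rangle> := a;; Tl\<langle>V Vtc\<rangle> := b;; Td\<langle>V Vtc\<rangle> := c;; Vtc ::= Add (V Vtc) (N 1))"

abbreviation "state_in x \<equiv> Mul (N 2) (V x)"
abbreviation "state_out x \<equiv> Add (Mul (N 2) (V x)) (N 1)"

definition parse_Cat :: com where
  "parse_Cat =
     (add_trans (state_in Vi) (N 0) (state_in Vr1);;
      add_trans (state_out Vr1) (N 0) (state_in Vr2);;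
      add_trans (state_out Vr2) (N 0) (state_out Vi);;
      Nul\<langle>V Vi\<rangle> := Mul (Ar Nul (V Vr1)) (Ar Nul (V Vr2)))"

definition parse_Alt :: com where
  "parse_Alt =
     (add_trans (state_in Vi) (N 0) (state_in Vr1);;
      add_trans (state_in Vi) (N 0) (state_in Vr2);;
      add_trans (state_out Vr1) (N 0) (state_out Vi);;
      add_trans (state_out Vr2) (N 0) (state_out Vi);;
      Nul\<langle>V Vi\<rangle> := Sub (N 1) (Mul (Sub (N 1) (Ar Nul (V Vr1))) (Sub (N 1) (Ar Nul (V Vr2)))))"

definition parse_Plus :: com where
  "parse_Plus =
     (add_trans (state_in Vi) (N 0) (state_in Vr1);;
      add_trans (state_out Vr1) (N 0) (state_out Vi);;
      add_trans (state_out Vr1) (N 0) (state_in Vr1);;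
      Nul\<langle>V Vi\<rangle> := Ar Nul (V Vr1))"

text \<open>The prefix notation is read from right to left, so the operands of a symbol are complete
  before it. The stack holds the start positions of finished subexpressions, the left operand on
  top. The tests by truncated subtraction recognise letters (above 3), binary operators (below 3)
  and alternation (above 1).\<close>

definition parse_body :: com where
  "parse_body =
     (Vi ::= Sub (V Vi) (N 1);; Read Vw (Add (N 2) (V Vi));;
      If (Sub (V Vw) (N 3))
        (add_trans (state_in Vi) (Sub (V Vw) (N 3)) (state_out Vi);; Nul\<langle>V Vi\<rangle> := N 0)
        (If (V Vw)
           (Vsp ::= Sub (V Vsp) (N 1);; Vr1 ::= Ar Stk (V Vsp);;
            If (Sub (N 3) (V Vw))
              (Vsp ::= Sub (V Vsp) (N 1);; Vr2 ::= Ar Stk (V Vsp);;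
               If (Sub (V Vw) (N 1)) parse_Alt parse_Cat)
              parse_Plus)
           (add_trans (state_in Vi) (N 0) (state_out Vi);; Nul\<langle>V Vi\<rangle> := N 1));;
      Stk\<langle>V Vsp\<rangle> := V Vi;; Vsp ::= Add (V Vsp) (N 1))"

definition parse :: com where
  "parse = (Vi ::= V Vq;; Vsp ::= N 0;; Vtc ::= N 0;; While (V Vi) parse_body)"

definition trs_rep :: "(nat \<Rightarrow> nat) \<Rightarrow> (nat \<Rightarrow> nat) \<Rightarrow> (nat \<Rightarrow> nat) \<Rightarrow> (nat \<times> nat \<times> nat) list \<Rightarrow> bool" where
  "trs_rep f g h ts \<longleftrightarrow> (\<forall>t<length ts. (f t, g t, h t) = ts ! t)"

lemma trs_rep_snoc:
  "trs_rep f g h ts \<Longrightarrow> k = length ts \<Longrightarrow>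
   trs_rep (f(k := a)) (g(k := b)) (h(k := c)) (ts @ [(a, b, c)])"
  by (auto simp: trs_rep_def nth_append less_Suc_eq)

lemma trs_rep_snoc3:
  "trs_rep f g h ts \<Longrightarrow> k = length ts \<Longrightarrow>
   trs_rep (f(k := a, Suc k := a', Suc (Suc k) := a'')) (g(k := b, Suc k := b', Suc (Suc k) := b''))
     (h(k := c, Suc k := c', Suc (Suc k) := c'')) (ts @ [(a, b, c), (a', b', c'), (a'', b'', c'')])"
  using trs_rep_snoc[OF trs_rep_snoc[OF trs_rep_snoc]] by simp

lemma trs_rep_snoc4:
  "trs_rep f g h ts \<Longrightarrow> k = length ts \<Longrightarrow>
   trs_rep (f(k := a, Suc k := a', Suc (Suc k) := a'', Suc (Suc (Suc k)) := a'''))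
     (g(k := b, Suc k := b', Suc (Suc k) := b'', Suc (Suc (Suc k)) := b'''))
     (h(k := c, Suc k := c', Suc (Suc k) := c'', Suc (Suc (Suc k)) := c'''))
     (ts @ [(a, b, c), (a', b', c'), (a'', b'', c''), (a''', b''', c''')])"
  using trs_rep_snoc[OF trs_rep_snoc3] by simp

definition stk_rep :: "(nat \<Rightarrow> nat) \<Rightarrow> nat list \<Rightarrow> bool" where
  "stk_rep f st \<longleftrightarrow> (\<forall>j<length st. f j = rev st ! j)"

lemma stk_rep_push: "stk_rep f st \<Longrightarrow> k = length st \<Longrightarrow> stk_rep (f(k := i)) (i # st)"
  by (auto simp: stk_rep_def nth_append less_Suc_eq)

lemma stk_rep_pop: "stk_rep f (i # st) \<longleftrightarrow> f (length st) = i \<and> stk_rep f st"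
  by (auto simp: stk_rep_def nth_append less_Suc_eq)

lemma stk_rep_upd: "stk_rep f st \<Longrightarrow> k = length st \<Longrightarrow> stk_rep (f(k := i)) st"
  by (auto simp: stk_rep_def)

definition parsed :: "nat \<Rightarrow> nat list \<Rightarrow> (nat \<times> nat \<times> nat) list \<Rightarrow> state \<Rightarrow> bool" where
  "parsed i st ts s \<longleftrightarrow> vars s Vi = i \<and> vars s Vsp = length st \<and> stk_rep (arr s Stk) st \<and>
     vars s Vtc = length ts \<and> trs_rep (arr s Tp) (arr s Tl) (arr s Td) ts"

lemma parsed_clk [simp]: "parsed i st ts (s\<lparr>clk := k\<rparr>) \<longleftrightarrow> parsed i st ts s"
  by (simp add: parsed_def)

text \<open>One product bound from which all size bounds on codes, pointers and counters are
  obtained through \<open>mult_le_X\<close>.\<close>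

locale query_run = query_input +
  fixes X :: nat
  assumes X_big: "100 * (n + 1) * (q + 1) * (m + 1) * (A + 1) \<le> X"
begin

definition "xs = [n, q] @ rpq_words cd r @ offsets xss @ concat xss"

lemma length_xs: "length xs = 3 + q + n * A + m"
  by (simp add: xs_def length_rpq_words offsets_def m_def length_xss)

lemma xs_word: "i < q \<Longrightarrow> xs ! (2 + i) = rpq_words cd r ! i"
  by (simp add: xs_def nth_append length_rpq_words)

lemma xs_offset: "l \<le> n * A \<Longrightarrow> xs ! (2 + q + l) = length (concat (take l xss))"
  by (simp add: xs_def nth_append length_rpq_words offsets_def length_xss nth_map_upt
      del: upt_Suc)

lemma xs_arc: "e < m \<Longrightarrow> xs ! (3 + q + n * A + e) = concat xss ! e"
  by (simp add: xs_def nth_append length_rpq_words offsets_def length_xss m_def)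

lemma mult_le_X:
  assumes "a \<le> 100" "b \<le> n + 1" "c \<le> q + 1" "d \<le> m + 1" "e \<le> A + 1"
  shows "a * b * c * d * e \<le> X"
proof -
  have "a * b * c * d * e \<le> 100 * (n + 1) * (q + 1) * (m + 1) * (A + 1)"
    using assms by (intro mult_le_mono)
  then show ?thesis using X_big by linarith
qed

lemma X_q: "10 * q + A + 20 \<le> X"
  using mult_le_X[of 40 1 "q + 1" 1 1] mult_le_X[of 40 1 1 1 "A + 1"] by simp

text \<open>Truncated subtraction makes \<open>w - 3\<close> the right label in both cases: 0 for
  \<epsilon>, and \<open>Suc c\<close> for the letter with number \<open>c\<close>.\<close>

lemma parse_leaf:
  assumes "parsed (Suc i) st us s" "i < q" "length st \<le> q" "length us \<le> 4 * q"
    "rpq_words cd r ! i = w" "w = 0 \<or> w = 4 + c \<and> c < A" 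
  shows "wp xs X parse_body (\<lambda>s'.
    parsed i (i # st) (us @ [(2 * i, w - 3, 2 * i + 1)]) s' \<and>
    arr s' Nul = (arr s Nul)(i := if w = 0 then 1 else 0) \<and> clk s' \<le> clk s + 200) s"
  using assms xs_word[OF assms(2)] length_xs X_q
  by (auto simp: parse_body_def add_trans_def parsed_def
      intro!: trs_rep_snoc stk_rep_push)

lemma parse_Cat:
  assumes "parsed (Suc i) (j # k # st) us s" "i < q" "length st < q" "length us \<le> 4 * q" "j < q" "k < q"
    "rpq_words cd r ! i = 1" "arr s Nul j \<le> 1" "arr s Nul k \<le> 1"
  shows "wp xs X parse_body (\<lambda>s'. parsed i (i # st)
      (us @ [(2 * i, 0, 2 * j), (2 * j + 1, 0, 2 * k), (2 * k + 1, 0, 2 * i + 1)]) s' \<and>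
    arr s' Nul = (arr s Nul)(i := arr s Nul j * arr s Nul k) \<and> clk s' \<le> clk s + 300) s"
  using assms xs_word[OF assms(2)] length_xs X_q mult_le_mono[OF assms(8,9)]
  by (auto simp: parse_body_def add_trans_def parse_Cat_def parsed_def stk_rep_pop
      intro!: trs_rep_snoc3 stk_rep_push stk_rep_upd)

lemma parse_Alt:
  assumes "parsed (Suc i) (j # k # st) us s" "i < q" "length st < q" "length us \<le> 4 * q" "j < q" "k < q"
    "rpq_words cd r ! i = 2"
  shows "wp xs X parse_body (\<lambda>s'. parsed i (i # st)
      (us @ [(2 * i, 0, 2 * j), (2 * i, 0, 2 * k), (2 * j + 1, 0, 2 * i + 1),
        (2 * k + 1, 0, 2 * i + 1)]) s' \<and>
    arr s' Nul = (arr s Nul)(i := 1 - (1 - arr s Nul j) * (1 - arr s Nul k)) \<and> clk s' \<le> clk s + 300) s"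
  using assms xs_word[OF assms(2)] length_xs X_q
  by (auto simp: parse_body_def add_trans_def parse_Alt_def parsed_def stk_rep_pop
      intro!: trs_rep_snoc4 stk_rep_push stk_rep_upd)

lemma parse_Plus:
  assumes "parsed (Suc i) (j # st) us s" "i < q" "length st < q" "length us \<le> 4 * q" "j < q"
    "rpq_words cd r ! i = 3" "arr s Nul j \<le> 1"
  shows "wp xs X parse_body (\<lambda>s'. parsed i (i # st)
      (us @ [(2 * i, 0, 2 * j), (2 * j + 1, 0, 2 * i + 1), (2 * j + 1, 0, 2 * j)]) s' \<and>
    arr s' Nul = (arr s Nul)(i := arr s Nul j) \<and> clk s' \<le> clk s + 300) s"
  using assms xs_word[OF assms(2)] length_xs X_q
  by (auto simp: parse_body_def add_trans_def parse_Plus_def parsed_def stk_rep_pop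
      intro!: trs_rep_snoc3 stk_rep_push stk_rep_upd)

text \<open>The loop does not stop at the border of a subexpression, so the claim is put in
  continuation style: the last premise treats the rest of the loop. For a binary operator the
  hypothesis of the right operand is applied first, and that of the left operand inside its
  continuation.\<close>

lemma parse_expr:
  assumes "i + rpq_length p \<le> q" "\<And>j. j < rpq_length p \<Longrightarrow> rpq_words cd r ! (i + j) = rpq_words cd p ! j"
    "parsed (i + rpq_length p) st us s" "length st + i + rpq_length p \<le> q"
    "length us + 4 * (i + rpq_length p) \<le> 4 * q"
    "\<And>s'. parsed i (i # st) (us @ transitions cd p i) s' \<Longrightarrow> arr s' Nul i = of_bool (nullable p) \<Longrightarrow>
      (\<And>j. j < i \<or> i + rpq_length p \<le> j \<Longrightarrow> arr s' Nul j = arr s Nul j) \<Longrightarrow>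
      clk s' \<le> clk s + 400 * rpq_length p \<Longrightarrow> wp xs X (While (V Vi) parse_body) Q s'"
  shows "wp xs X (While (V Vi) parse_body) Q s"
  using assms
proof (induction p arbitrary: i st us s)
  case Eps
  have "wp xs X parse_body (\<lambda>s'. parsed i (i # st) (us @ [(2 * i, 0 - 3, 2 * i + 1)]) s' \<and>
    arr s' Nul = (arr s Nul)(i := 1) \<and> clk s' \<le> clk s + 203) (tick 3 s)"
    using Eps.prems(2)[of 0] Eps.prems by (intro wp_mono[OF parse_leaf[of i st us _ 0]]) auto
  then show ?case using Eps.prems(3)
    by (intro wp_WhileT) (auto simp: parsed_def[of _ _ _ s] elim!: wp_mono intro!: Eps.prems(6))
next
  case (Letter a)
  have "wp xs X parse_body (\<lambda>s'. parsed i (i # st) (us @ [(2 * i, Suc (cd a), 2 * i + 1)]) s' \<and>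
    arr s' Nul = (arr s Nul)(i := 0) \<and> clk s' \<le> clk s + 203) (tick 3 s)"
    using Letter.prems(2)[of 0] Letter.prems cd_less[of a]
    by (intro wp_mono[OF parse_leaf[of i st us _ "4 + cd a" "cd a"]]) auto
  then show ?case using Letter.prems(3)
    by (intro wp_WhileT) (auto simp: parsed_def[of _ _ _ s] elim!: wp_mono intro!: Letter.prems(6))
next
  case (Plus p)
  let ?j = "i + 1"
  have w: "rpq_words cd r ! i = 3" using Plus.prems(2)[of 0] by simp
  show ?case
  proof (rule Plus.IH[of ?j st us s])
    fix s1 assume 1: "parsed ?j (?j # st) (us @ transitions cd p ?j) s1"
      "arr s1 Nul ?j = of_bool (nullable p)"
      "\<And>j. j < ?j \<or> ?j + rpq_length p \<le> j \<Longrightarrow> arr s1 Nul j = arr s Nul j"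
      "clk s1 \<le> clk s + 400 * rpq_length p"
    have "wp xs X parse_body (\<lambda>s'. parsed i (i # st) (us @ transitions cd (Plus p) i) s' \<and>
      arr s' Nul = (arr s1 Nul)(i := of_bool (nullable p)) \<and> clk s' \<le> clk s1 + 303) (tick 3 s1)"
      using Plus.prems 1(1,2) w length_transitions[of cd p ?j] rpq_length_pos[of p]
      by (intro wp_mono[OF parse_Plus[of i ?j st "us @ transitions cd p ?j"]]) (auto simp: Let_def simp del: rpq_length_pos)
    then show "wp xs X (While (V Vi) parse_body) Q s1" using 1
      by (intro wp_WhileT)
        (auto simp: parsed_def[of _ _ _ s1] elim!: wp_mono intro!: Plus.prems(6))
  next
    show "rpq_words cd r ! (?j + j) = rpq_words cd p ! j" if "j < rpq_length p" for j
      using Plus.prems(2)[of "Suc j"] that by simp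
  qed (use Plus.prems in auto)
next
  case (Cat p p')
  let ?j = "i + 1" and ?k = "i + 1 + rpq_length p"
  have w: "rpq_words cd r ! i = 1" using Cat.prems(2)[of 0] by simp
  have T: "length (transitions cd p ?j) \<le> 4 * rpq_length p" "length (transitions cd p' ?k) \<le> 4 * rpq_length p'"
    by (rule length_transitions)+
  show ?case
  proof (rule Cat.IH(2)[of ?k st us s])
    fix s1 assume 1: "parsed ?k (?k # st) (us @ transitions cd p' ?k) s1"
      "arr s1 Nul ?k = of_bool (nullable p')"
      "\<And>j. j < ?k \<or> ?k + rpq_length p' \<le> j \<Longrightarrow> arr s1 Nul j = arr s Nul j"
      "clk s1 \<le> clk s + 400 * rpq_length p'"
    show "wp xs X (While (V Vi) parse_body) Q s1"
    proof (rule Cat.IH(1)[of ?j "?k # st" "us @ transitions cd p' ?k" s1])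
      fix s2 assume 2: "parsed ?j (?j # ?k # st) ((us @ transitions cd p' ?k) @ transitions cd p ?j) s2"
        "arr s2 Nul ?j = of_bool (nullable p)"
        "\<And>j. j < ?j \<or> ?j + rpq_length p \<le> j \<Longrightarrow> arr s2 Nul j = arr s1 Nul j"
        "clk s2 \<le> clk s1 + 400 * rpq_length p"
      have "arr s2 Nul ?k = of_bool (nullable p')" using 1(2) 2(3)[of ?k] by simp
      then have "wp xs X parse_body (\<lambda>s'. parsed i (i # st) (us @ transitions cd (Cat p p') i) s' \<and>
        arr s' Nul = (arr s2 Nul)(i := of_bool (nullable (Cat p p'))) \<and> clk s' \<le> clk s2 + 303) (tick 3 s2)"
        using Cat.prems(1,4,5) 2(1,2) w T rpq_length_pos[of p] rpq_length_pos[of p']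
        by (intro wp_mono[OF parse_Cat[of i ?j ?k st
            "(us @ transitions cd p' ?k) @ transitions cd p ?j"]]) (auto simp: Let_def simp del: rpq_length_pos)
      then show "wp xs X (While (V Vi) parse_body) Q s2" using 1(3,4) 2
        by (intro wp_WhileT)
          (auto simp: parsed_def[of _ _ _ s2] elim!: wp_mono intro!: Cat.prems(6))
    next
      show "rpq_words cd r ! (?j + j) = rpq_words cd p ! j" if "j < rpq_length p" for j
        using Cat.prems(2)[of "Suc j"] that by (simp add: nth_append length_rpq_words)
    qed (use Cat.prems 1(1) T rpq_length_pos[of p'] in \<open>auto simp del: rpq_length_pos\<close>)
  next
    show "rpq_words cd r ! (?k + j) = rpq_words cd p' ! j" if "j < rpq_length p'" for j
      using Cat.prems(2)[of "Suc (rpq_length p + j)"] that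
      by (simp add: nth_append length_rpq_words ac_simps)
  qed (use Cat.prems in \<open>auto simp: ac_simps\<close>)
next
  case (Alt p p')
  let ?j = "i + 1" and ?k = "i + 1 + rpq_length p"
  have w: "rpq_words cd r ! i = 2" using Alt.prems(2)[of 0] by simp
  have T: "length (transitions cd p ?j) \<le> 4 * rpq_length p" "length (transitions cd p' ?k) \<le> 4 * rpq_length p'"
    by (rule length_transitions)+
  show ?case
  proof (rule Alt.IH(2)[of ?k st us s])
    fix s1 assume 1: "parsed ?k (?k # st) (us @ transitions cd p' ?k) s1"
      "arr s1 Nul ?k = of_bool (nullable p')"
      "\<And>j. j < ?k \<or> ?k + rpq_length p' \<le> j \<Longrightarrow> arr s1 Nul j = arr s Nul j"
      "clk s1 \<le> clk s + 400 * rpq_length p'"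
    show "wp xs X (While (V Vi) parse_body) Q s1"
    proof (rule Alt.IH(1)[of ?j "?k # st" "us @ transitions cd p' ?k" s1])
      fix s2 assume 2: "parsed ?j (?j # ?k # st) ((us @ transitions cd p' ?k) @ transitions cd p ?j) s2"
        "arr s2 Nul ?j = of_bool (nullable p)"
        "\<And>j. j < ?j \<or> ?j + rpq_length p \<le> j \<Longrightarrow> arr s2 Nul j = arr s1 Nul j"
        "clk s2 \<le> clk s1 + 400 * rpq_length p"
      have "arr s2 Nul ?k = of_bool (nullable p')" using 1(2) 2(3)[of ?k] by simp
      then have "wp xs X parse_body (\<lambda>s'. parsed i (i # st) (us @ transitions cd (Alt p p') i) s' \<and>
        arr s' Nul = (arr s2 Nul)(i := of_bool (nullable (Alt p p'))) \<and> clk s' \<le> clk s2 + 303) (tick 3 s2)"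
        using Alt.prems(1,4,5) 2(1,2) w T rpq_length_pos[of p] rpq_length_pos[of p']
        by (intro wp_mono[OF parse_Alt[of i ?j ?k st
            "(us @ transitions cd p' ?k) @ transitions cd p ?j"]]) (auto simp: Let_def simp del: rpq_length_pos)
      then show "wp xs X (While (V Vi) parse_body) Q s2" using 1(3,4) 2
        by (intro wp_WhileT)
          (auto simp: parsed_def[of _ _ _ s2] elim!: wp_mono intro!: Alt.prems(6))
    next
      show "rpq_words cd r ! (?j + j) = rpq_words cd p ! j" if "j < rpq_length p" for j
        using Alt.prems(2)[of "Suc j"] that by (simp add: nth_append length_rpq_words)
    qed (use Alt.prems 1(1) T rpq_length_pos[of p'] in \<open>auto simp del: rpq_length_pos\<close>)
  next
    show "rpq_words cd r ! (?k + j) = rpq_words cd p' ! j" if "j < rpq_length p'" for j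
      using Alt.prems(2)[of "Suc (rpq_length p + j)"] that
      by (simp add: nth_append length_rpq_words ac_simps)
  qed (use Alt.prems in \<open>auto simp: ac_simps\<close>)
qed

lemma parse:
  assumes "vars s Vq = q"
  shows "wp xs X parse (\<lambda>s'. vars s' Vtc = length ts \<and> trs_rep (arr s' Tp) (arr s' Tl) (arr s' Td) ts \<and>
    arr s' Nul 0 = of_bool (nullable r) \<and> clk s' \<le> clk s + 500 * q) s"
proof -
  let ?s = "s\<lparr>vars := (vars s)(Vi := q, Vsp := 0, Vtc := 0), clk := 10 + clk s\<rparr>"
  have "wp xs X (While (V Vi) parse_body) (\<lambda>s'. vars s' Vtc = length ts \<and>
    trs_rep (arr s' Tp) (arr s' Tl) (arr s' Td) ts \<and>
    arr s' Nul 0 = of_bool (nullable r) \<and> clk s' \<le> clk s + 500 * q) ?s"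
  proof (rule parse_expr[where i = 0 and p = r and st = "[]" and us = "[]"])
    fix s' assume "parsed 0 [0] ([] @ transitions cd r 0) s'" "arr s' Nul 0 = of_bool (nullable r)"
      "clk s' \<le> clk ?s + 400 * q"
    then show "wp xs X (While (V Vi) parse_body) (\<lambda>s'. vars s' Vtc = length ts \<and>
      trs_rep (arr s' Tp) (arr s' Tl) (arr s' Td) ts \<and>
      arr s' Nul 0 = of_bool (nullable r) \<and> clk s' \<le> clk s + 500 * q) s'"
      using rpq_length_pos[of r] by (intro wp_WhileF) (auto simp: parsed_def ts_def simp del: rpq_length_pos)
  qed (auto simp: parsed_def stk_rep_def trs_rep_def)
  then show ?thesis using X_q assms by (simp add: parse_def split del: split_of_bool)
qed

end

section \<open>Building the product graph\<close>

definition add_edge :: com where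
  "add_edge =
     (Ft\<langle>V Vec\<rangle> := V Vy;; Fn\<langle>V Vec\<rangle> := Ar Fh (V Vx);; Fh\<langle>V Vx\<rangle> := Add (V Vec) (N 1);;
      Bt\<langle>V Vec\<rangle> := V Vx;; Bn\<langle>V Vec\<rangle> := Ar Bh (V Vy);; Bh\<langle>V Vy\<rangle> := Add (V Vec) (N 1);;
      Vec ::= Add (V Vec) (N 1))"

abbreviation neq :: "exp \<Rightarrow> exp \<Rightarrow> exp" where
  "neq a b \<equiv> Add (Sub a b) (Sub b a)"

text \<open>For an arc from \<open>Vv\<close> to \<open>Vu\<close> with label \<open>Vw\<close>, where label \<open>0\<close> again stands for \<open>\<epsilon>\<close>.\<close>

definition edge_loop :: com where
  "edge_loop = (Vt ::= N 0;; While (Sub (V Vtc) (V Vt))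
     (If (neq (Ar Tl (V Vt)) (V Vw)) Skip
        (Vx ::= Add (Mul (V Vv) (V Vs)) (Ar Tp (V Vt));;
         Vy ::= Add (Mul (V Vu) (V Vs)) (Ar Td (V Vt));; add_edge);;
      Vt ::= Add (V Vt) (N 1)))"

text \<open>The arcs follow two header words, \<open>q\<close> query words and
  \<open>n * A + 1\<close> offsets. \<open>Ve\<close> counts arcs over all lists and
  \<open>Vf\<close> is the end of the current list. Flagging both end points marks the non-isolated
  nodes.\<close>

definition arc_loop :: "nat \<Rightarrow> com" where
  "arc_loop A = While (Sub (V Vf) (V Ve))
     (Read Vu (Add (Add (Add (N 3) (V Vq)) (Mul (V Vn) (N A))) (V Ve));;
      Flg\<langle>V Vv\<rangle> := N 1;; Flg\<langle>V Vu\<rangle> := N 1;; edge_loop;; Ve ::= Add (V Ve) (N 1))"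

text \<open>Address \<open>3 + q + l\<close> holds offset \<open>l + 1\<close>, the end of list
  \<open>l\<close>; \<open>Ve\<close> already stands at its beginning.\<close>

definition scan :: "nat \<Rightarrow> com" where
  "scan A = (Vl ::= N 0;; Ve ::= N 0;; Vec ::= N 0;;
     While (Sub (Mul (V Vn) (N A)) (V Vl))
       (Vv ::= Div (V Vl) (N A);; Vw ::= Add (Sub (V Vl) (Mul (V Vv) (N A))) (N 1);;
        Read Vf (Add (Add (N 3) (V Vq)) (V Vl));; arc_loop A;; Vl ::= Add (V Vl) (N 1)))"

definition eps_loop :: com where
  "eps_loop = (Vv ::= N 0;; Vw ::= N 0;; While (Sub (V Vn) (V Vv))
     (If (Ar Flg (V Vv)) (Vu ::= V Vv;; edge_loop) Skip;; Vv ::= Add (V Vv) (N 1)))"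

definition erep ::
    "(nat \<times> nat) list \<Rightarrow> nat \<Rightarrow> (nat \<Rightarrow> nat) \<Rightarrow> (nat \<Rightarrow> nat) \<Rightarrow> (nat \<Rightarrow> nat) \<Rightarrow> (nat \<Rightarrow> nat) \<Rightarrow>
     (nat \<Rightarrow> nat) \<Rightarrow> (nat \<Rightarrow> nat) \<Rightarrow> bool" where
  "erep es c fh fn ft bh bn bt \<longleftrightarrow> c = length es \<and> (\<forall>x. adjl c fn ft (fh x) (nbr es x)) \<and>
     (\<forall>x. adjl c bn bt (bh x) (nbr (map prod.swap es) x))"

abbreviation edges_rep :: "(nat \<times> nat) list \<Rightarrow> state \<Rightarrow> bool" where
  "edges_rep es s \<equiv> erep es (vars s Vec) (arr s Fh) (arr s Fn) (arr s Ft) (arr s Bh) (arr s Bn) (arr s Bt)"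

lemma adjl_le: "adjl c nx tg h ys \<Longrightarrow> h \<le> c"
  by (cases ys) auto

lemma erep_le:
  assumes "erep es c fh fn ft bh bn bt"
  shows "fh x \<le> length es" "bh x \<le> length es" "c = length es"
  using assms adjl_le unfolding erep_def by blast+

lemma erep_snoc:
  assumes "erep es c fh fn ft bh bn bt"
  shows "erep (es @ [(x, y)]) (Suc c) (fh(x := Suc c)) (fn(c := fh x)) (ft(c := y))
    (bh(y := Suc c)) (bn(c := bh y)) (bt(c := x))"
  using assms unfolding erep_def by (auto simp: nbr_append adjl_Suc)

lemma add_edge:
  assumes "edges_rep es s" "length es < X" "vars s Vx \<le> X" "vars s Vy \<le> X"
  shows "wp xs X add_edge (\<lambda>s'. edges_rep (es @ [(vars s Vx, vars s Vy)]) s' \<and> clk s' \<le> clk s + 90) s"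
proof -
  have h: "arr s Fh (vars s Vx) \<le> X" "arr s Bh (vars s Vy) \<le> X" "vars s Vec = length es"
    using erep_le(1)[OF assms(1), of "vars s Vx"] erep_le(2)[OF assms(1), of "vars s Vy"]
      erep_le(3)[OF assms(1)] assms(2) by linarith+
  show ?thesis
    using erep_snoc[OF assms(1), of "vars s Vx" "vars s Vy"] assms(2-) h by (simp add: add_edge_def)
qed

definition sel :: "nat \<Rightarrow> nat \<Rightarrow> nat \<Rightarrow> nat \<Rightarrow> (nat \<times> nat \<times> nat) list \<Rightarrow> (nat \<times> nat) list" where
  "sel S v u l T = map (\<lambda>(p, l', p'). (v * S + p, u * S + p')) (filter (\<lambda>(p, l', p'). l' = l) T)"

context query_run
begin

definition "params s \<longleftrightarrow> vars s Vn = n \<and> vars s Vq = q \<and> vars s Vm = m \<and> vars s Vs = S \<and> vars s Vk = K"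

definition "trs_ok s \<longleftrightarrow> vars s Vtc = length ts \<and> trs_rep (arr s Tp) (arr s Tl) (arr s Td) ts"

lemma X_nS: "n * S + S \<le> X" and X_edges: "12 * q * m + q + 10 \<le> X" and X_n: "n + 10 \<le> X"
  and X_nA: "n * A + A + 10 \<le> X" and X_m: "m + 10 \<le> X" and X_K: "K \<le> X"
proof -
  show "n * S + S \<le> X" using mult_le_X[of 2 "n + 1" q 1 1] by (simp add: S_def algebra_simps)
  show "12 * q * m + q + 10 \<le> X"
    using mult_le_X[of 24 1 "q + 1" "m + 1" 1] by (simp add: algebra_simps)
  show "n + 10 \<le> X" using mult_le_X[of 10 "n + 1" 1 1 1] by simp
  show "n * A + A + 10 \<le> X" using mult_le_X[of 10 "n + 1" 1 1 "A + 1"] by (simp add: algebra_simps)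
  show "m + 10 \<le> X" using mult_le_X[of 10 1 1 "m + 1" 1] by simp
  have "K \<le> (m + 1) * q" unfolding K_def by (intro mult_le_mono) simp_all
  also have "\<dots> \<le> X" using mult_le_X[of 1 1 q "m + 1" 1] by (simp add: algebra_simps)
  finally show "K \<le> X" .
qed

lemma encode_le_X: "v < n \<Longrightarrow> p < S \<Longrightarrow> v * S + p \<le> X"
proof -
  assume "v < n" "p < S"
  then have "v * S + p < Suc v * S" by simp
  also have "\<dots> \<le> n * S" using \<open>v < n\<close> by (intro mult_le_mono) auto
  finally show ?thesis using X_nS by simp
qed

lemma edge_loop:
  assumes "edges_rep es s" "trs_ok s" "params s" "vars s Vv < n" "vars s Vu < n"
    "length es + length (sel S (vars s Vv) (vars s Vu) (vars s Vw) ts) \<le> 12 * q * m"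
  shows "wp xs X edge_loop (\<lambda>s'. edges_rep (es @ sel S (vars s Vv) (vars s Vu) (vars s Vw) ts) s' \<and>
    clk s' \<le> clk s + 20 + 250 * length ts) s"
proof -
  let ?v = "vars s Vv" and ?u = "vars s Vu" and ?w = "vars s Vw"
  let ?c = "If (neq (Ar Tl (V Vt)) (V Vw)) Skip
        (Vx ::= Add (Mul (V Vv) (V Vs)) (Ar Tp (V Vt));;
         Vy ::= Add (Mul (V Vu) (V Vs)) (Ar Td (V Vt));; add_edge);;
      Vt ::= Add (V Vt) (N 1)"
  let ?sel = "sel S ?v ?u ?w"
  define I where "I i s' \<longleftrightarrow> edges_rep (es @ ?sel (take i ts)) s' \<and> trs_ok s' \<and> params s' \<and>
    vars s' Vv = ?v \<and> vars s' Vu = ?u \<and> vars s' Vw = ?w \<and> vars s' Vt = i \<and>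
    clk s' \<le> clk s + 3 + 250 * i" for i and s' :: state
  have "wp xs X (While (Sub (V Vtc) (V Vt)) ?c)
    (\<lambda>s'. edges_rep (es @ ?sel ts) s' \<and> clk s' \<le> clk s + 20 + 250 * length ts) s0" if "I 0 s0" for s0
  proof (rule wp_for[where I = I and k = "length ts", OF that])
    fix i s' assume i: "i < length ts" and I: "I i s'"
    obtain p l p' where t: "ts ! i = (p, l, p')" by (cases "ts ! i") auto
    then have less: "p < S" "p' < S" using ts_less[of p l p'] nth_mem[OF i] by auto
    have rd: "arr s' Tp i = p" "arr s' Tl i = l" "arr s' Td i = p'"
      using I i t by (auto simp: I_def trs_ok_def trs_rep_def)
    have tk: "?sel (take (Suc i) ts) = ?sel (take i ts) @ (if l = ?w then [(?v * S + p, ?u * S + p')] else [])"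
      using i t by (simp add: sel_def take_Suc_conv_app_nth)
    have "length (?sel (take (Suc i) ts)) \<le> length (?sel ts)"
      unfolding sel_def length_map by (metis append_take_drop_id filter_append le_add1 length_append)
    then have len: "length es + length (?sel (take (Suc i) ts)) \<le> 12 * q * m" using assms(6) by simp
    have ne: "eval (Sub (V Vtc) (V Vt)) s' \<noteq> 0" using I i by (simp add: I_def trs_ok_def)
    have tX: "Suc i \<le> X" using i length_ts X_q by simp
    let ?a = "tick (ecost (Sub (V Vtc) (V Vt)) + 1) s'"
    have "wp xs X ?c (\<lambda>s'. I (Suc i) (tick 1 s')) ?a"
    proof (cases "l = ?w")
      case False
      then show ?thesis
        using I rd tk tX by (cases "l < ?w") (simp_all add: I_def trs_ok_def params_def)
    next
      case True
      have "length (es @ ?sel (take i ts)) < X" using len tk True X_edges by simp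
      then show ?thesis
        using True rd I encode_le_X[OF assms(4) less(1)] encode_le_X[OF assms(5) less(2)] tk tX
        apply (simp add: I_def params_def trs_ok_def)
        apply (rule wp_mono[OF wp_frame[OF add_edge[where es = "es @ ?sel (take i ts)"]]])
        by (simp_all add: frame_def add_edge_def)
    qed
    then show "eval (Sub (V Vtc) (V Vt)) s' \<noteq> 0 \<and> wp xs X ?c (\<lambda>s'. I (Suc i) (tick 1 s')) ?a" using ne by simp
  next
    fix s' assume "I (length ts) s'"
    then show "eval (Sub (V Vtc) (V Vt)) s' = 0 \<and> edges_rep (es @ ?sel ts) (tick (ecost (Sub (V Vtc) (V Vt)) + 1) s') \<and>
        clk (tick (ecost (Sub (V Vtc) (V Vt)) + 1) s') \<le> clk s + 20 + 250 * length ts"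
      by (simp add: I_def trs_ok_def)
  qed
  from this[unfolded I_def] show ?thesis
    using assms(1-3) by (simp add: edge_loop_def sel_def trs_ok_def params_def)
qed

section \<open>Progress of the scan through the concatenated lists\<close>

definition "offs l = length (concat (take l xss))"
definition "arcs_of l = map (\<lambda>y. (l div A, l mod A, y)) (xss ! l)"
definition "scanned l i = concat (map arcs_of [0..<l]) @ take i (arcs_of l)"
definition ends :: "(nat \<times> nat \<times> nat) list \<Rightarrow> nat set" where
  "ends as = fst ` set as \<union> (snd \<circ> snd) ` set as"

lemma offs_Suc: "l < n * A \<Longrightarrow> offs (Suc l) = offs l + length (xss ! l)"
  by (simp add: offs_def take_Suc_conv_app_nth length_xss)

lemma offs_le: "l \<le> n * A \<Longrightarrow> offs l \<le> m"
  unfolding offs_def m_def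
  by (metis append_take_drop_id concat_append le_add1 length_append)

lemma offs_end: "offs (n * A) = m"
  by (simp add: offs_def m_def length_xss)

lemma concat_nth_offs: "l < n * A \<Longrightarrow> i < length (xss ! l) \<Longrightarrow> concat xss ! (offs l + i) = xss ! l ! i"
proof -
  assume l: "l < n * A" and i: "i < length (xss ! l)"
  have "concat xss = concat (take l xss) @ xss ! l @ concat (drop (Suc l) xss)"
    using l by (metis Cons_nth_drop_Suc append_take_drop_id concat.simps(2) concat_append length_xss)
  then show ?thesis using i by (simp add: offs_def nth_append)
qed

lemma scanned_Suc: "i < length (xss ! l) \<Longrightarrow> scanned l (Suc i) = scanned l i @ [(l div A, l mod A, xss ! l ! i)]"
  by (simp add: scanned_def arcs_of_def take_Suc_conv_app_nth)

lemma scanned_next: "scanned (Suc l) 0 = scanned l (length (xss ! l))"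
  by (simp add: scanned_def arcs_of_def)

lemma scanned_end: "scanned (n * A) 0 = arc_list"
  by (simp add: scanned_def arc_list_def arcs_of_def[abs_def])

lemma length_scanned: "l \<le> n * A \<Longrightarrow> i \<le> (if l < n * A then length (xss ! l) else 0) \<Longrightarrow>
   length (scanned l i) = offs l + i"
proof (induction l arbitrary: i)
  case 0
  then show ?case by (auto simp: scanned_def offs_def arcs_of_def split: if_splits)
next
  case (Suc l)
  have "length (scanned (Suc l) 0) = offs (Suc l)"
    using Suc.IH[of "length (xss ! l)"] Suc.prems by (simp add: scanned_next offs_Suc)
  moreover have "length (scanned (Suc l) i) = length (scanned (Suc l) 0) + i"
    using Suc.prems(2) by (auto simp: scanned_def arcs_of_def split: if_splits)
  ultimately show ?case by simp
qed

lemma lab_edges_snoc: "lab_edges S ts (as @ [(v, a, y)]) = lab_edges S ts as @ sel S v y (Suc a) ts"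
  by (simp add: lab_edges_def sel_def)

lemma eps_edges_snoc: "eps_edges S ts (vs @ [v]) = eps_edges S ts vs @ sel S v v 0 ts"
  by (simp add: eps_edges_def sel_def)

lemma modifies_edge_loop:
  "mvars edge_loop = {Vt, Vx, Vy, Vec}" "marrs edge_loop = {Fh, Fn, Ft, Bh, Bn, Bt}" "silent edge_loop"
  by (auto simp: edge_loop_def add_edge_def)

lemma arc_loop:
  assumes "l < n * A" "edges_rep (lab_edges S ts (scanned l 0)) s" "supp (arr s Flg) = ends (scanned l 0)"
    "trs_ok s" "params s" "vars s Vv = l div A" "vars s Vw = Suc (l mod A)" "vars s Ve = offs l"
    "vars s Vf = offs (Suc l)"
  shows "wp xs X (arc_loop A) (\<lambda>s'. edges_rep (lab_edges S ts (scanned (Suc l) 0)) s' \<and>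
    supp (arr s' Flg) = ends (scanned (Suc l) 0) \<and> vars s' Ve = offs (Suc l) \<and>
    clk s' \<le> clk s + 20 + length (xss ! l) * (150 + 250 * length ts)) s"
proof -
  define ct where "ct = 150 + 250 * length ts"
  define I where "I i s' \<longleftrightarrow> edges_rep (lab_edges S ts (scanned l i)) s' \<and>
    supp (arr s' Flg) = ends (scanned l i) \<and> trs_ok s' \<and> params s' \<and> vars s' Vv = l div A \<and>
    vars s' Vw = Suc (l mod A) \<and> vars s' Ve = offs l + i \<and> vars s' Vf = offs (Suc l) \<and>
    clk s' \<le> clk s + i * ct" for i and s' :: state
  show ?thesis
    unfolding arc_loop_def
  proof (rule wp_for[where I = I and k = "length (xss ! l)"])
    show "I 0 s" using assms by (simp add: I_def)
  next
    fix i s' assume i: "i < length (xss ! l)" and I: "I i s'"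
    have off: "offs l + length (xss ! l) \<le> m" using offs_le[of "Suc l"] offs_Suc[OF assms(1)] assms(1) by simp
    have y: "xs ! (3 + q + n * A + (offs l + i)) = xss ! l ! i"
      using xs_arc[of "offs l + i"] concat_nth_offs[OF assms(1) i] off i by simp
    have less: "l div A < n" "xss ! l ! i < n"
      using assms(1) i xss_less[OF nth_mem nth_mem] A_pos length_xss by (simp_all add: less_mult_imp_div_less)
    have len: "length (lab_edges S ts (scanned l (Suc i))) \<le> 12 * q * m"
    proof -
      have "length (lab_edges S ts (scanned l (Suc i))) \<le> length ts * length (scanned l (Suc i))"
        by (rule length_lab_edges)
      also have "length (scanned l (Suc i)) = offs l + Suc i"
        using assms(1) i by (intro length_scanned) auto
      also have "length ts * (offs l + Suc i) \<le> (4 * q) * m"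
        using length_ts off i by (intro mult_le_mono) auto
      finally show ?thesis by simp
    qed
    have en: "ends (scanned l (Suc i)) = insert (l div A) (insert (xss ! l ! i) (ends (scanned l i)))"
      using i by (auto simp: scanned_Suc ends_def)
    have bX: "Suc (offs l + i) \<le> X" "1 \<le> X" using off i X_m by simp_all
    have lxs: "3 + q + n * A + (offs l + i) < length xs" using off i length_xs by simp
    show "eval (Sub (V Vf) (V Ve)) s' \<noteq> 0 \<and> wp xs X
      (Read Vu (Add (Add (Add (N 3) (V Vq)) (Mul (V Vn) (N A))) (V Ve));;
      Flg\<langle>V Vv\<rangle> := N 1;; Flg\<langle>V Vu\<rangle> := N 1;; edge_loop;; Ve ::= Add (V Ve) (N 1))
      (\<lambda>s'. I (Suc i) (tick 1 s')) (tick (ecost (Sub (V Vf) (V Ve)) + 1) s')"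
    proof
      show "eval (Sub (V Vf) (V Ve)) s' \<noteq> 0" using I i offs_Suc[OF assms(1)] by (simp add: I_def)
    next
      show "wp xs X
        (Read Vu (Add (Add (Add (N 3) (V Vq)) (Mul (V Vn) (N A))) (V Ve));;
        Flg\<langle>V Vv\<rangle> := N 1;; Flg\<langle>V Vu\<rangle> := N 1;; edge_loop;; Ve ::= Add (V Ve) (N 1))
        (\<lambda>s'. I (Suc i) (tick 1 s')) (tick (ecost (Sub (V Vf) (V Ve)) + 1) s')"
        using I y lxs bX
        apply (simp add: I_def params_def)
        apply (rule wp_mono[OF wp_frame[OF edge_loop[where es = "lab_edges S ts (scanned l i)"]]])
        subgoal by simp
        subgoal by (simp add: trs_ok_def)
        subgoal by (simp add: params_def)
        subgoal using less by simp
        subgoal using less by simp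
        subgoal using len by (simp add: scanned_Suc[OF i] lab_edges_snoc)
        subgoal using en by (simp add: frame_def modifies_edge_loop scanned_Suc[OF i] lab_edges_snoc trs_ok_def ct_def)
          (auto simp: en)
        done
    qed
  next
    fix s' assume "I (length (xss ! l)) s'"
    then show "eval (Sub (V Vf) (V Ve)) s' = 0 \<and>
        edges_rep (lab_edges S ts (scanned (Suc l) 0)) (tick (ecost (Sub (V Vf) (V Ve)) + 1) s') \<and>
        supp (arr (tick (ecost (Sub (V Vf) (V Ve)) + 1) s') Flg) = ends (scanned (Suc l) 0) \<and>
        vars (tick (ecost (Sub (V Vf) (V Ve)) + 1) s') Ve = offs (Suc l) \<and>
        clk (tick (ecost (Sub (V Vf) (V Ve)) + 1) s') \<le> clk s + 20 + length (xss ! l) * (150 + 250 * length ts)"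
      using offs_Suc[OF assms(1)] by (simp add: I_def scanned_next ct_def)
  qed
qed

lemma modifies_arc_loop:
  "mvars (arc_loop A) = {Vu, Ve, Vt, Vx, Vy, Vec}" "marrs (arc_loop A) = {Flg, Fh, Fn, Ft, Bh, Bn, Bt}"
  "silent (arc_loop A)"
  by (auto simp: arc_loop_def modifies_edge_loop)

definition "graph_ok s \<longleftrightarrow> edges_rep edges s \<and> supp (arr s Flg) = W"

lemma scan:
  assumes "trs_ok s" "params s" "arr s Flg = (\<lambda>_. 0)" "arr s Fh = (\<lambda>_. 0)" "arr s Bh = (\<lambda>_. 0)"
  shows "wp xs X (scan A) (\<lambda>s'. edges_rep (lab_edges S ts arc_list) s' \<and> supp (arr s' Flg) = W \<and>
    clk s' \<le> clk s + 30 + 100 * (n * A) + m * (150 + 250 * length ts)) s"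
proof -
  define ct where "ct = 150 + 250 * length ts"
  define I where "I l s' \<longleftrightarrow> edges_rep (lab_edges S ts (scanned l 0)) s' \<and>
    supp (arr s' Flg) = ends (scanned l 0) \<and> trs_ok s' \<and> params s' \<and>
    vars s' Vl = l \<and> vars s' Ve = offs l \<and> clk s' \<le> clk s + 10 + 100 * l + offs l * ct" for l and s' :: state
  have "wp xs X (While (Sub (Mul (V Vn) (N A)) (V Vl))
       (Vv ::= Div (V Vl) (N A);; Vw ::= Add (Sub (V Vl) (Mul (V Vv) (N A))) (N 1);;
        Read Vf (Add (Add (N 3) (V Vq)) (V Vl));; arc_loop A;; Vl ::= Add (V Vl) (N 1)))
    (\<lambda>s'. edges_rep (lab_edges S ts arc_list) s' \<and> supp (arr s' Flg) = W \<and>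
      clk s' \<le> clk s + 30 + 100 * (n * A) + m * (150 + 250 * length ts)) s0" if "I 0 s0" for s0
  proof (rule wp_for[where I = I and k = "n * A", OF that])
    fix l s' assume l: "l < n * A" and I: "I l s'"
    have f: "xs ! (3 + q + l) = offs (Suc l)"
      using xs_offset[of "Suc l"] l by (simp add: offs_def eval_nat_numeral)
    have lm: "l - l div A * A = l mod A" by (simp add: minus_div_mult_eq_mod)
    have "l div A \<le> l" "l mod A \<le> l" by simp_all
    then have bX: "l div A \<le> X" "Suc (l mod A) \<le> X" "Suc l \<le> X" "3 + q + l < length xs"
      using l X_nA length_xs by linarith+
    show "eval (Sub (Mul (V Vn) (N A)) (V Vl)) s' \<noteq> 0 \<and> wp xs X
       (Vv ::= Div (V Vl) (N A);; Vw ::= Add (Sub (V Vl) (Mul (V Vv) (N A))) (N 1);;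
        Read Vf (Add (Add (N 3) (V Vq)) (V Vl));; arc_loop A;; Vl ::= Add (V Vl) (N 1))
       (\<lambda>s'. I (Suc l) (tick 1 s')) (tick (ecost (Sub (Mul (V Vn) (N A)) (V Vl)) + 1) s')"
    proof
      show "eval (Sub (Mul (V Vn) (N A)) (V Vl)) s' \<noteq> 0" using I l by (simp add: I_def params_def)
    next
      show "wp xs X
       (Vv ::= Div (V Vl) (N A);; Vw ::= Add (Sub (V Vl) (Mul (V Vv) (N A))) (N 1);;
        Read Vf (Add (Add (N 3) (V Vq)) (V Vl));; arc_loop A;; Vl ::= Add (V Vl) (N 1))
       (\<lambda>s'. I (Suc l) (tick 1 s')) (tick (ecost (Sub (Mul (V Vn) (N A)) (V Vl)) + 1) s')"
        using I f bX
        apply (simp add: I_def params_def lm)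
        apply (rule wp_mono[OF wp_frame[OF arc_loop[OF l]]])
        subgoal by simp
        subgoal by simp
        subgoal by (simp add: trs_ok_def)
        subgoal by (simp add: params_def)
        subgoal by simp
        subgoal by simp
        subgoal by simp
        subgoal by simp
        subgoal by (simp add: frame_def modifies_arc_loop trs_ok_def ct_def offs_Suc[OF l] algebra_simps)
        done
    qed
  next
    fix s' assume "I (n * A) s'"
    then show "eval (Sub (Mul (V Vn) (N A)) (V Vl)) s' = 0 \<and>
        edges_rep (lab_edges S ts arc_list) (tick (ecost (Sub (Mul (V Vn) (N A)) (V Vl)) + 1) s') \<and>
        supp (arr (tick (ecost (Sub (Mul (V Vn) (N A)) (V Vl)) + 1) s') Flg) = W \<and>
        clk (tick (ecost (Sub (Mul (V Vn) (N A)) (V Vl)) + 1) s')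
          \<le> clk s + 30 + 100 * (n * A) + m * (150 + 250 * length ts)"
      by (simp add: I_def scanned_end params_def offs_end ct_def W_def ends_def)
  qed
  note loop = this
  have "edges_rep [] (s\<lparr>vars := (vars s)(Vl := 0, Ve := 0, Vec := 0)\<rparr>)"
    using assms(4,5) by (simp add: erep_def)
  then show ?thesis
    using assms(1-3) by (simp add: scan_def del: One_nat_def neq0_conv)
      (rule loop, simp add: I_def scanned_def trs_ok_def params_def lab_edges_def ends_def offs_def)
qed

lemma modifies_scan:
  "mvars (scan A) = {Vl, Vv, Vw, Vf, Vu, Ve, Vt, Vx, Vy, Vec}"
  "marrs (scan A) = {Flg, Fh, Fn, Ft, Bh, Bn, Bt}" "silent (scan A)"
  by (auto simp: scan_def modifies_arc_loop)

text \<open>\<open>edge_loop\<close> runs only for flagged nodes, of which there are at most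
  \<open>2 * m\<close>. The number of nodes thus enters with a constant factor, not multiplied by
  the query length.\<close>

lemma eps_loop:
  assumes "trs_ok s" "params s" "edges_rep (lab_edges S ts arc_list) s" "supp (arr s Flg) = W"
  shows "wp xs X eps_loop (\<lambda>s'. graph_ok s' \<and>
    clk s' \<le> clk s + 30 + 60 * n + 2 * m * (30 + 250 * length ts)) s"
proof -
  define ct where "ct = 30 + 250 * length ts"
  let ?W = "\<lambda>v. filter (\<lambda>v. v \<in> W) [0..<v]"
  define I where "I v s' \<longleftrightarrow> edges_rep (lab_edges S ts arc_list @ eps_edges S ts (?W v)) s' \<and>
    supp (arr s' Flg) = W \<and> trs_ok s' \<and> params s' \<and> vars s' Vv = v \<and> vars s' Vw = 0 \<and>
    clk s' \<le> clk s + 10 + 60 * v + length (?W v) * ct" for v and s' :: state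
  have "wp xs X (While (Sub (V Vn) (V Vv))
     (If (Ar Flg (V Vv)) (Vu ::= V Vv;; edge_loop) Skip;; Vv ::= Add (V Vv) (N 1)))
    (\<lambda>s'. graph_ok s' \<and> clk s' \<le> clk s + 30 + 60 * n + 2 * m * (30 + 250 * length ts)) s0"
    if "I 0 s0" for s0
  proof (rule wp_for[where I = I and k = n, OF that])
    fix v s' assume v: "v < n" and I: "I v s'"
    have flg: "arr s' Flg v \<noteq> 0 \<longleftrightarrow> v \<in> W" using I by (auto simp: I_def)
    have bX: "v \<le> X" "Suc v \<le> X" using v X_n by simp_all
    show "eval (Sub (V Vn) (V Vv)) s' \<noteq> 0 \<and> wp xs X
       (If (Ar Flg (V Vv)) (Vu ::= V Vv;; edge_loop) Skip;; Vv ::= Add (V Vv) (N 1))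
       (\<lambda>s'. I (Suc v) (tick 1 s')) (tick (ecost (Sub (V Vn) (V Vv)) + 1) s')"
    proof
      show "eval (Sub (V Vn) (V Vv)) s' \<noteq> 0" using I v by (simp add: I_def params_def)
    next
      show "wp xs X (If (Ar Flg (V Vv)) (Vu ::= V Vv;; edge_loop) Skip;; Vv ::= Add (V Vv) (N 1))
       (\<lambda>s'. I (Suc v) (tick 1 s')) (tick (ecost (Sub (V Vn) (V Vv)) + 1) s')"
      proof (cases "v \<in> W")
        case False
        then show ?thesis using I flg bX by (simp add: I_def trs_ok_def params_def)
      next
        case True
        then have "length (?W (Suc v)) \<le> card W" unfolding length_W_list[symmetric]
          using v by (metis Suc_leI filter_append le_add1 le_add_diff_inverse length_append upt_add_eq_append zero_le)
        then have "length (eps_edges S ts (?W (Suc v))) \<le> length ts * (2 * m)"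
          using length_eps_edges[of S ts "?W (Suc v)"] card_W by (meson le_trans mult_le_mono2)
        then have "length (lab_edges S ts arc_list) + length (eps_edges S ts (?W (Suc v))) \<le> length ts * (3 * m)"
          using length_lab_edges[of S ts arc_list] length_arc_list by simp
        also have "\<dots> \<le> (4 * q) * (3 * m)" using length_ts by (intro mult_le_mono) auto
        finally have len: "length (lab_edges S ts arc_list) + length (eps_edges S ts (?W (Suc v))) \<le> 12 * q * m"
          by simp
        have W: "?W (Suc v) = ?W v @ [v]" using True by simp
        show ?thesis
          using I flg True bX
          apply (simp add: I_def params_def)
          apply (rule wp_mono[OF wp_frame[OF edge_loop[where es = "lab_edges S ts arc_list @ eps_edges S ts (?W v)"]]])
          subgoal by simp
          subgoal by (simp add: trs_ok_def)
          subgoal by (simp add: params_def)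
          subgoal using v by simp
          subgoal using v by simp
          subgoal using len unfolding W by (simp add: eps_edges_snoc)
          subgoal by (simp add: frame_def modifies_edge_loop eps_edges_snoc trs_ok_def ct_def)
          done
      qed
    qed
  next
    fix s' assume I: "I n s'"
    have "length (?W n) * ct \<le> 2 * m * (30 + 250 * length ts)"
      using card_W unfolding length_W_list ct_def by (intro mult_le_mono) auto
    then show "eval (Sub (V Vn) (V Vv)) s' = 0 \<and> graph_ok (tick (ecost (Sub (V Vn) (V Vv)) + 1) s') \<and>
        clk (tick (ecost (Sub (V Vn) (V Vv)) + 1) s') \<le> clk s + 30 + 60 * n + 2 * m * (30 + 250 * length ts)"
      using I by (simp add: I_def params_def graph_ok_def edges_def)
  qed
  note loop = this
  show ?thesis
    using assms by (simp add: eps_loop_def del: One_nat_def)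
      (rule loop, simp add: I_def trs_ok_def params_def eps_edges_def)
qed

lemma modifies_eps_loop:
  "mvars eps_loop = {Vv, Vw, Vu, Vt, Vx, Vy, Vec}" "marrs eps_loop = {Fh, Fn, Ft, Bh, Bn, Bt}"
  "silent eps_loop"
  by (auto simp: eps_loop_def modifies_edge_loop)

end

section \<open>Computing the first answers of every node\<close>

text \<open>Counts are kept for all product nodes because they control pruning. The targets
  themselves are stored only at start states \<open>u * S\<close>, where answers are read off, in a
  row of \<open>K\<close> cells per node.\<close>

definition collect :: com where
  "collect = (Vj ::= N 0;; While (Sub (V Vqt) (V Vj))
     (Vx ::= Ar Que (V Vj);; Vc ::= Ar Cnt (V Vx);; Cnt\<langle>V Vx\<rangle> := Add (V Vc) (N 1);;
      If (Sub (V Vk) (Add (V Vc) (N 1))) Skip (Ful\<langle>V Vx\<rangle> := N 1);;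
      Vu ::= Div (V Vx) (V Vs);;
      If (Sub (V Vx) (Mul (V Vu) (V Vs))) Skip (Lst\<langle>Add (Mul (V Vu) (V Vk)) (V Vc)\<rangle> := V Vv);;
      Vj ::= Add (V Vj) (N 1)))"

definition search_loop :: "ar \<Rightarrow> ar \<Rightarrow> ar \<Rightarrow> ar \<Rightarrow> ar \<Rightarrow> com" where
  "search_loop H Nx T Mk Fu = While (Add (V Ve) (Sub (V Vqt) (V Vqh))) (search_unit H Nx T Mk Fu)"

definition process_target :: com where
  "process_target = (search_start Bmk Ful;; search_loop Bh Bn Bt Bmk Ful;; collect)"

definition backward :: com where
  "backward = (Vv ::= N 0;; While (Sub (V Vn) (V Vv))
     (If (Ar Flg (V Vv))
        (Vy ::= Add (Mul (V Vv) (V Vs)) (N 1);; process_target)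
        Skip;;
      Vv ::= Add (V Vv) (N 1)))"

lemma modifies_collect:
  "mvars collect = {Vj, Vx, Vc, Vu}" "marrs collect = {Cnt, Ful, Lst}" "silent collect"
  by (auto simp: collect_def)

lemma modifies_search_loop:
  "mvars (search_loop H Nx T Mk Fu) = {Vy, Ve, Vqt, Vx, Vqh}"
  "marrs (search_loop H Nx T Mk Fu) = {Mk, Que}" "silent (search_loop H Nx T Mk Fu)"
  by (simp_all add: search_loop_def modifies_search)

lemma modifies_process_target:
  "mvars process_target = {Vy, Vqt, Vqh, Ve, Vst, Vx, Vj, Vc, Vu}"
  "marrs process_target = {Bmk, Que, Cnt, Ful, Lst}" "silent process_target"
  by (auto simp: process_target_def modifies_search modifies_search_loop modifies_collect)

lemma modifies_backward:
  "mvars backward = {Vv, Vy, Vqt, Vqh, Ve, Vst, Vx, Vj, Vc, Vu}"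
  "marrs backward = {Bmk, Que, Cnt, Ful, Lst}" "silent backward"
  by (auto simp: backward_def modifies_process_target)

context query_run
begin

lemma words_le: "w \<in> set (rpq_words cd p) \<Longrightarrow> w \<le> 4 + A"
  by (induction p) (auto intro: less_imp_le[OF cd_less])

lemma xs_le_X: "x \<in> set xs \<Longrightarrow> x \<le> X"
proof -
  have c: "length (concat (take l xss)) \<le> m" for l
    unfolding m_def by (metis append_take_drop_id concat_append le_add1 length_append)
  assume "x \<in> set xs"
  then consider "x = n" | "x = q" | "x \<in> set (rpq_words cd r)" | "x \<in> set (offsets xss)"
    | "x \<in> set (concat xss)"
    by (auto simp: xs_def)
  then show ?thesis
  proof cases
    case 4
    then obtain l where "x = length (concat (take l xss))" by (auto simp: offsets_def simp del: upt_Suc)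
    then show ?thesis using c[of l] X_m by simp
  next
    case 5
    then show ?thesis using xss_less X_n by fastforce
  qed (use X_n X_q words_le[of x r] in auto)
qed

lemma wp_frame_bounded:
  "wp xs X c Q s \<Longrightarrow> bounded X s \<Longrightarrow> wp xs X c (\<lambda>s'. Q s' \<and> frame c s s' \<and> bounded X s') s"
  using wp_bounded[OF wp_frame] xs_le_X by fastforce

text \<open>The potential bounds the number of rounds: at most 110 steps are charged to each unit,
  including the loop test.\<close>

lemma search_loop:
  assumes "search_arrays H Nx T Mk Fu" "finite (reach nb (supp (arr s Fu)) r0)"
    "card (reach nb (supp (arr s Fu)) r0) < X"
    and "sinv H Nx T Mk Fu c nb r0 st \<phi> s" "bounded X s"
  shows "wp xs X (search_loop H Nx T Mk Fu) (\<lambda>s'. (\<exists>ql. marked Mk st s' ql \<and>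
    set ql = reach nb (supp (arr s Fu)) r0 \<and> distinct ql) \<and> clk s' \<le> clk s + 10 + 110 * \<phi>) s"
proof -
  interpret search_arrays H Nx T Mk Fu by fact
  define R where "R = reach nb (supp (arr s Fu)) r0"
  let ?e = "Add (V Ve) (Sub (V Vqt) (V Vqh))"
  have "wp xs X (While ?e (search_unit H Nx T Mk Fu)) (\<lambda>s'. (\<exists>ql. marked Mk st s' ql \<and>
      set ql = R \<and> distinct ql) \<and> clk s' \<le> clk s1 + 10 + 110 * \<phi>) s1"
    if "sinv H Nx T Mk Fu c nb r0 st \<phi> s1" "bounded X s1" "arr s1 Fu = arr s Fu" for s1
    using that
  proof (induction \<phi> arbitrary: s1)
    case 0
    then obtain ql where "marked Mk st s1 ql" "set ql = R" "distinct ql"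
      "vars s1 Ve + (vars s1 Vqt - vars s1 Vqh) = 0"
      using sinv_done[of c nb r0 st 0 s1] assms(2) by (auto simp: R_def)
    then show ?case by (intro wp_WhileF) (auto simp: marked_def)
  next
    case (Suc \<phi>)
    show ?case
    proof (cases "eval ?e s1 = 0")
      case True
      then obtain ql where "marked Mk st s1 ql" "set ql = R" "distinct ql"
        using sinv_done[of c nb r0 st "Suc \<phi>" s1] assms(2) Suc.prems by (auto simp: R_def)
      then show ?thesis using True by (intro wp_WhileF) (auto simp: marked_def)
    next
      case False
      let ?s = "tick (ecost ?e + 1) s1"
      have "wp xs X (search_unit H Nx T Mk Fu) (\<lambda>s'. sinv H Nx T Mk Fu c nb r0 st (Suc \<phi> - 1) s' \<and>
        clk s' \<le> clk ?s + 90) ?s"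
        using Suc.prems assms(2,3) by (intro unit) simp_all
      then have "wp xs X (search_unit H Nx T Mk Fu) (\<lambda>s'. (sinv H Nx T Mk Fu c nb r0 st (Suc \<phi> - 1) s' \<and>
        clk s' \<le> clk ?s + 90) \<and> frame (search_unit H Nx T Mk Fu) ?s s' \<and> bounded X s') ?s"
        using Suc.prems by (intro wp_frame_bounded) simp_all
      then show ?thesis
      proof (intro wp_WhileT[OF False], elim wp_mono, elim conjE)
        fix s' assume s': "sinv H Nx T Mk Fu c nb r0 st (Suc \<phi> - 1) s'" "clk s' \<le> clk ?s + 90"
          "frame (search_unit H Nx T Mk Fu) ?s s'" "bounded X s'"
        have "Fu \<notin> {Mk, Que}" using arrays by auto
        then have "arr s' Fu = arr s Fu" using s'(3) Suc.prems(3) by (simp add: frame_def modifies_search)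
        then have "wp xs X (While ?e (search_unit H Nx T Mk Fu)) (\<lambda>s2. (\<exists>ql. marked Mk st s2 ql \<and>
          set ql = R \<and> distinct ql) \<and> clk s2 \<le> clk (tick 1 s') + 10 + 110 * \<phi>) (tick 1 s')"
          using s'(1,4) by (intro Suc.IH) simp_all
        then show "wp xs X (While ?e (search_unit H Nx T Mk Fu)) (\<lambda>s'. (\<exists>ql. marked Mk st s' ql \<and>
          set ql = R \<and> distinct ql) \<and> clk s' \<le> clk s1 + 10 + 110 * Suc \<phi>) (tick 1 s')"
          by (rule wp_mono) (use s'(2) in auto)
      qed
    qed
  qed
  from this[of s] show ?thesis using assms(4,5) by (simp add: search_loop_def R_def)
qed

text \<open>The situation when all targets below \<open>v\<close> are processed. Increasing order of
  targets makes each row of \<open>Lst\<close> the list of the smallest answers.\<close>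

definition "tables v s \<longleftrightarrow> (\<forall>x\<in>U. arr s Cnt x = min K (length (tgts v x))) \<and>
  (\<forall>x. x \<notin> U \<longrightarrow> arr s Cnt x = 0) \<and> (\<forall>x. arr s Ful x \<noteq> 0 \<longleftrightarrow> K \<le> arr s Cnt x) \<and>
  (\<forall>u\<in>W. \<forall>j<arr s Cnt (u * S). arr s Lst (u * K + j) = tgts v (u * S) ! j)"

lemma tables_0: "arr s Cnt = (\<lambda>_. 0) \<Longrightarrow> arr s Ful = (\<lambda>_. 0) \<Longrightarrow> tables 0 s"
  using K_pos by (simp add: tables_def tgts_def)

lemma tables_isolated: "tables v s \<Longrightarrow> v \<notin> W \<Longrightarrow> tables (Suc v) s"
  unfolding tables_def using tgts_Suc_isolated U_iff[of 0] S_pos by simp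

text \<open>Amortisation of all backward searches: a node with \<open>c\<close> of its
  \<open>K\<close> targets can be visited \<open>K - c\<close> more times, each time at the cost of
  its weight.\<close>

definition "credit v = (\<Sum>x\<in>U. (K - min K (length (tgts v x))) * Suc (length (nbr (map prod.swap edges) x)))"

lemma credit_0: "credit 0 \<le> K * (16 * q * m)"
proof -
  have "credit 0 = K * weight (nbr (map prod.swap edges)) U"
    by (simp add: credit_def tgts_def weight_def sum_distrib_left)
  then show ?thesis using weight_swap_edges_le by simp
qed

text \<open>Each node visited for target \<open>v\<close> is not yet full and gains exactly this
  target, hence gives up one visit. The terms of all other nodes are unchanged.\<close>

lemma credit_Suc:
  assumes "R = {x \<in> U. length (tgts v x) < K \<and> (x, v * S + 1) \<in> (set edges)\<^sup>*}"
  shows "credit (Suc v) + weight (nbr (map prod.swap edges)) R = credit v"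
proof -
  let ?w = "\<lambda>x. Suc (length (nbr (map prod.swap edges) x))"
  have "(\<Sum>x\<in>U. if x \<in> R then ?w x else 0) = weight (nbr (map prod.swap edges)) R"
    using assms finite_U unfolding weight_def by (subst sum.inter_restrict[symmetric]) (auto intro: arg_cong2[where f = sum])
  then have "credit (Suc v) + weight (nbr (map prod.swap edges)) R =
    (\<Sum>x\<in>U. (K - min K (length (tgts (Suc v) x))) * ?w x + (if x \<in> R then ?w x else 0))"
    unfolding credit_def by (simp only: sum.distrib)
  also have "\<dots> = credit v"
    unfolding credit_def
  proof (rule sum.cong[OF refl])
    fix x assume x: "x \<in> U"
    show "(K - min K (length (tgts (Suc v) x))) * ?w x + (if x \<in> R then ?w x else 0) =
      (K - min K (length (tgts v x))) * ?w x"
    proof (cases "x \<in> R")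
      case True
      then have "K - min K (length (tgts v x)) = Suc (K - min K (length (tgts (Suc v) x)))"
        using assms by (auto simp: tgts_Suc min_def)
      moreover have "b * w + w = a * w" if "a = Suc b" for a b w :: nat using that by simp
      ultimately show ?thesis using True by (simp only: if_True)
    next
      case False
      then have "K - min K (length (tgts v x)) = K - min K (length (tgts (Suc v) x))"
        using assms x by (auto simp: tgts_Suc min_def)
      then show ?thesis using False by (simp only: if_False add_0_right)
    qed
  qed
  finally show ?thesis .
qed

lemma collect:
  assumes "tables v s" "params s" "vars s Vv = v" "v \<in> W" "vars s Vqt = length ql"
    "\<And>j. j < length ql \<Longrightarrow> arr s Que j = ql ! j" "distinct ql"
    "set ql = {x. arr s Cnt x < K \<and> (x, v * S + 1) \<in> (set edges)\<^sup>*}" "bounded X s"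
  shows "wp xs X collect (\<lambda>s'. tables (Suc v) s' \<and> clk s' \<le> clk s + 20 + 150 * length ql) s"
proof -
  define cnt where "cnt = arr s Cnt"
  have U: "set ql \<subseteq> U"
    using assms(4,8) rtrancl_edges_U U_iff[OF S_pos(1), of v] by auto
  have len: "length ql < X"
  proof -
    have "length ql = card (set ql)" using assms(7) by (simp add: distinct_card)
    also have "\<dots> \<le> card {..<n * S}" using U U_less by (intro card_mono) auto
    finally show ?thesis using X_nS S_pos by simp
  qed
  have c: "cnt x = (if x \<in> U then min K (length (tgts v x)) else 0)" for x
    using assms(1) by (simp add: tables_def cnt_def)
  have cl: "cnt x < K" if "x \<in> set ql" for x using that assms(8) by (simp add: cnt_def)
  have cK: "cnt x \<le> K" for x by (simp add: c)
  define I where "I j s' \<longleftrightarrow> params s' \<and> vars s' Vv = v \<and> vars s' Vqt = length ql \<and> vars s' Vj = j \<and>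
    arr s' Que = arr s Que \<and> arr s' Cnt = (\<lambda>x. cnt x + of_bool (x \<in> set (take j ql))) \<and>
    (\<forall>x. arr s' Ful x \<noteq> 0 \<longleftrightarrow> K \<le> arr s' Cnt x) \<and>
    (\<forall>u\<in>W. \<forall>i<arr s' Cnt (u * S). arr s' Lst (u * K + i) =
      (if i < cnt (u * S) then tgts v (u * S) ! i else v)) \<and>
    clk s' \<le> clk s + 10 + 150 * j" for j and s' :: state
  have "wp xs X (While (Sub (V Vqt) (V Vj))
     (Vx ::= Ar Que (V Vj);; Vc ::= Ar Cnt (V Vx);; Cnt\<langle>V Vx\<rangle> := Add (V Vc) (N 1);;
      If (Sub (V Vk) (Add (V Vc) (N 1))) Skip (Ful\<langle>V Vx\<rangle> := N 1);;
      Vu ::= Div (V Vx) (V Vs);;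
      If (Sub (V Vx) (Mul (V Vu) (V Vs))) Skip (Lst\<langle>Add (Mul (V Vu) (V Vk)) (V Vc)\<rangle> := V Vv);;
      Vj ::= Add (V Vj) (N 1)))
    (\<lambda>s'. tables (Suc v) s' \<and> clk s' \<le> clk s + 20 + 150 * length ql) s0" if "I 0 s0" for s0
  proof (rule wp_for[where I = I and k = "length ql", OF that])
    fix j s' assume j: "j < length ql" and I: "I j s'"
    define x where "x = ql ! j"
    have x: "x \<in> set ql" "x \<notin> set (take j ql)"
      using j assms(7) by (auto simp: x_def in_set_conv_nth nth_eq_iff_index_eq)
    then obtain u p where up: "x = u * S + p" "u \<in> W" "p < S" using U by (auto simp: U_def)
    have tk: "set (take (Suc j) ql) = insert x (set (take j ql))"
      using j by (simp add: take_Suc_conv_app_nth x_def)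
    have u: "x div S = u" "x - u * S = p" "x \<le> u * S \<longleftrightarrow> p = 0" using up by simp_all
    have cx: "arr s' Cnt x = cnt x" using I x by (simp add: I_def)
    have rd: "arr s' Que j = x" using I assms(6)[OF j] by (simp add: I_def x_def)
    let ?Cnt = "\<lambda>y. cnt y + of_bool (y \<in> set (take (Suc j) ql))"
    have f1: "(arr s' Cnt)(x := Suc (cnt x)) = ?Cnt" using I x by (auto simp: I_def tk)
    have f2: "\<forall>y. (if Suc (cnt x) < K then arr s' Ful else (arr s' Ful)(x := 1)) y \<noteq> 0 \<longleftrightarrow> K \<le> ?Cnt y"
      using I x cl[OF x(1)] by (auto simp: I_def tk)
    \<comment> \<open>All indices inside a row are below \<open>K\<close>, so rows do not overlap
      and the new entry disturbs no other one.\<close>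
    have f3: "\<forall>u'\<in>W. \<forall>i<?Cnt (u' * S).
      (if p = 0 then (arr s' Lst)(u * K + cnt x := v) else arr s' Lst) (u' * K + i) =
      (if i < cnt (u' * S) then tgts v (u' * S) ! i else v)"
    proof (intro ballI allI impI)
      fix u' i assume u': "u' \<in> W" and i: "i < ?Cnt (u' * S)"
      have L: "arr s' Lst (u' * K + i) = (if i < cnt (u' * S) then tgts v (u' * S) ! i else v)"
        if "i < cnt (u' * S) + of_bool (u' * S \<in> set (take j ql))"
        using I u' that by (simp add: I_def)
      have iK: "i < K"
        using i cK[of "u' * S"] cl[of "u' * S"] set_take_subset[of "Suc j" ql]
        by (cases "u' * S \<in> set (take (Suc j) ql)") auto
      show "(if p = 0 then (arr s' Lst)(u * K + cnt x := v) else arr s' Lst) (u' * K + i) =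
        (if i < cnt (u' * S) then tgts v (u' * S) ! i else v)"
      proof (cases "u' * S = x")
        case True
        then have "p = 0" "u' = u" using up encode_eq_iff[of 0 S p u' u] S_pos by auto
        then show ?thesis using True L i x(2) iK cl[OF x(1)] up by (auto simp: tk encode_eq_iff)
      next
        case False
        then have "p = 0 \<Longrightarrow> u' \<noteq> u" using up by auto
        then show ?thesis using L i False iK cl[OF x(1)] by (auto simp: tk encode_eq_iff)
      qed
    qed
    have bX: "x \<le> X" "Suc (cnt x) \<le> X" "1 \<le> X" "u \<le> X" "v \<le> X" "Suc j \<le> X" "cnt x \<le> X"
      using U_less[of x] U x(1) X_nS cl[OF x(1)] X_K W_less[OF up(2)] W_less[OF assms(4)] X_n j len by auto
    show "eval (Sub (V Vqt) (V Vj)) s' \<noteq> 0 \<and> wp xs X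
      (Vx ::= Ar Que (V Vj);; Vc ::= Ar Cnt (V Vx);; Cnt\<langle>V Vx\<rangle> := Add (V Vc) (N 1);;
      If (Sub (V Vk) (Add (V Vc) (N 1))) Skip (Ful\<langle>V Vx\<rangle> := N 1);;
      Vu ::= Div (V Vx) (V Vs);;
      If (Sub (V Vx) (Mul (V Vu) (V Vs))) Skip (Lst\<langle>Add (Mul (V Vu) (V Vk)) (V Vc)\<rangle> := V Vv);;
      Vj ::= Add (V Vj) (N 1))
      (\<lambda>s'. I (Suc j) (tick 1 s')) (tick (ecost (Sub (V Vqt) (V Vj)) + 1) s')"
      using I j f1 f2 f3 bX u cx rd unfolding I_def params_def
      by (cases "Suc (cnt x) < K"; cases "p = 0") (simp_all del: neq0_conv)
  next
    fix s' assume I: "I (length ql) s'"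
    have q: "x \<in> set ql \<longleftrightarrow> cnt x < K \<and> (x, v * S + 1) \<in> (set edges)\<^sup>*" for x
      using assms(8) by (simp add: cnt_def)
    have C: "arr s' Cnt x = cnt x + of_bool (x \<in> set ql)" for x using I by (simp add: I_def)
    have "tables (Suc v) s'"
      unfolding tables_def
    proof (intro conjI ballI allI impI)
      fix x assume x: "x \<in> U"
      show "arr s' Cnt x = min K (length (tgts (Suc v) x))"
        using x c[of x] by (auto simp: C q tgts_Suc)
    next
      fix x assume "x \<notin> U"
      then show "arr s' Cnt x = 0" using c[of x] U by (auto simp: C)
    next
      fix x show "arr s' Ful x \<noteq> 0 \<longleftrightarrow> K \<le> arr s' Cnt x" using I unfolding I_def by blast
    next
      fix u i assume u: "u \<in> W" and i: "i < arr s' Cnt (u * S)"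
      have uU: "u * S \<in> U" using u U_iff[of 0 u] S_pos by simp
      have L: "arr s' Lst (u * K + i) = (if i < cnt (u * S) then tgts v (u * S) ! i else v)"
        using I u i by (simp add: I_def)
      show "arr s' Lst (u * K + i) = tgts (Suc v) (u * S) ! i"
      proof (cases "i < cnt (u * S)")
        case True
        then show ?thesis using L c[of "u * S"] uU by (simp add: tgts_Suc nth_append)
      next
        case False
        then have "u * S \<in> set ql" "i = cnt (u * S)" using i C[of "u * S"] by (cases "u * S \<in> set ql"; auto)+
        then have "i = length (tgts v (u * S))" "(u * S, v * S + 1) \<in> (set edges)\<^sup>*"
          using q[of "u * S"] c[of "u * S"] uU by auto
        then show ?thesis using L False by (simp add: tgts_Suc)
      qed
    qed
    then show "eval (Sub (V Vqt) (V Vj)) s' = 0 \<and> tables (Suc v) (tick (ecost (Sub (V Vqt) (V Vj)) + 1) s') \<and>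
      clk (tick (ecost (Sub (V Vqt) (V Vj)) + 1) s') \<le> clk s + 20 + 150 * length ql"
      using I by (simp add: I_def tables_def)
  qed
  note loop = this
  have "\<forall>u\<in>W. \<forall>i<cnt (u * S). arr s Lst (u * K + i) = tgts v (u * S) ! i"
    using assms(1) by (simp add: tables_def cnt_def)
  then show ?thesis
    using assms(1-3,5) by (simp add: collect_def del: One_nat_def)
      (rule loop, simp add: I_def params_def tables_def cnt_def)
qed

lemma graph_rep_backward: "graph_ok s \<Longrightarrow> graph_rep Bh Bn Bt (length edges) (nbr (map prod.swap edges)) s"
  and graph_rep_forward: "graph_ok s \<Longrightarrow> graph_rep Fh Fn Ft (length edges) (nbr edges) s"
  by (auto simp: graph_ok_def graph_rep_def erep_def)

lemma card_U_less: "R \<subseteq> U \<Longrightarrow> finite R \<and> card R < X"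
proof
  assume R: "R \<subseteq> U"
  then show "finite R" using finite_U by (rule finite_subset)
  have "card R \<le> card {..<n * S}" using R U_less by (intro card_mono) auto
  then show "card R < X" using X_nS S_pos by simp
qed

text \<open>The search costs 110 per unit and \<open>collect\<close> 150 per visited node. Both
  numbers are bounded by the weight of the visited set, which is exactly the drop in
  \<open>credit\<close>; the rate 300 covers their sum.\<close>

lemma process_target:
  assumes "graph_ok s" "params s" "tables v s" "\<And>y. arr s Bmk y \<le> v" "vars s Vv = v" "v \<in> W"
    "vars s Vy = v * S + 1" "bounded X s"
  shows "wp xs X process_target
    (\<lambda>s'. tables (Suc v) s' \<and> (\<forall>y. arr s' Bmk y \<le> Suc v) \<and>
      clk s' + 300 * credit (Suc v) \<le> clk s + 150 + 300 * credit v) s"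
proof -
  interpret search_arrays Bh Bn Bt Bmk Ful by unfold_locales auto
  let ?nb = "nbr (map prod.swap edges)"
  define R where "R = reach ?nb (supp (arr s Ful)) (v * S + 1)"
  have F: "supp (arr s Ful) = {x. K \<le> arr s Cnt x}" using assms(3) by (simp add: tables_def)
  have R: "R = {x. arr s Cnt x < K \<and> (x, v * S + 1) \<in> (set edges)\<^sup>*}"
    unfolding R_def F using assms(3) by (intro reach_pruned) (simp_all add: tables_def)
  have RU: "R \<subseteq> U" using assms(6) rtrancl_edges_U U_iff[OF S_pos(1), of v] by (auto simp: R)
  have fin: "finite R" "card R < X" using card_U_less[OF RU] by auto
  have R': "R = {x \<in> U. length (tgts v x) < K \<and> (x, v * S + 1) \<in> (set edges)\<^sup>*}"
    using RU assms(3) by (auto simp: R tables_def)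
  have cr: "credit (Suc v) + weight ?nb R = credit v" by (rule credit_Suc[OF R'])
  have vX: "v < X" using W_less[OF assms(6)] X_n by simp
  have card: "card R \<le> weight ?nb R" using fin by (simp add: weight_def sum_Suc)
  define \<phi> where "\<phi> = weight ?nb R"
  let ?Q = "\<lambda>s'. tables (Suc v) s' \<and> (\<forall>y. arr s' Bmk y \<le> Suc v) \<and>
      clk s' + 300 * credit (Suc v) \<le> clk s + 150 + 300 * credit v"
  have "wp xs X (search_start Bmk Ful) (\<lambda>s'. sinv Bh Bn Bt Bmk Ful (length edges) ?nb (v * S + 1) (Suc v) \<phi> s' \<and>
    clk s' \<le> clk s + 90) s"
    using start[OF graph_rep_backward[OF assms(1)], where xs = xs and X = X] assms vX by (simp add: \<phi>_def R_def)
  then have "wp xs X (search_start Bmk Ful) (wp xs X (search_loop Bh Bn Bt Bmk Ful;; collect) ?Q) s"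
  proof (rule wp_mono[OF wp_frame_bounded[OF _ assms(8)]], elim conjE)
    fix s1 assume 1: "sinv Bh Bn Bt Bmk Ful (length edges) ?nb (v * S + 1) (Suc v) \<phi> s1"
      "clk s1 \<le> clk s + 90" "frame (search_start Bmk Ful) s s1" "bounded X s1"
    have F1: "arr s1 Ful = arr s Ful" using 1(3) by (simp add: frame_def modifies_search)
    have "wp xs X (search_loop Bh Bn Bt Bmk Ful) (\<lambda>s'. (\<exists>ql. marked Bmk (Suc v) s' ql \<and>
      set ql = R \<and> distinct ql) \<and> clk s' \<le> clk s1 + 10 + 110 * \<phi>) s1"
      using search_loop[OF search_arrays_axioms, of ?nb s1 "v * S + 1"] 1(1,4) fin by (simp add: F1 R_def)
    then have "wp xs X (search_loop Bh Bn Bt Bmk Ful) (wp xs X collect ?Q) s1"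
    proof (rule wp_mono[OF wp_frame_bounded[OF _ 1(4)]], elim conjE exE)
      fix s2 ql assume 2: "marked Bmk (Suc v) s2 ql" "set ql = R" "distinct ql"
        "clk s2 \<le> clk s1 + 10 + 110 * \<phi>" "frame (search_loop Bh Bn Bt Bmk Ful) s1 s2" "bounded X s2"
      have fr: "tables v s2" "params s2" "vars s2 Vv = v" "arr s2 Cnt = arr s Cnt"
        using assms(2,3,5) 1(3) 2(5)
        by (simp_all add: frame_def modifies_search modifies_search_loop tables_def params_def)
      have "wp xs X collect (\<lambda>s'. tables (Suc v) s' \<and> clk s' \<le> clk s2 + 20 + 150 * length ql) s2"
        using fr 2 assms(6) by (intro collect) (auto simp: marked_def R)
      then show "wp xs X collect ?Q s2"
      proof (rule wp_mono[OF wp_frame], elim conjE)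
        fix s3 assume 3: "tables (Suc v) s3" "clk s3 \<le> clk s2 + 20 + 150 * length ql" "frame collect s2 s3"
        have "length ql \<le> \<phi>" using card 2(2,3) by (simp add: \<phi>_def distinct_card[symmetric])
        moreover have "arr s3 Bmk y \<le> Suc v" for y
          using 2(1) 3(3) by (simp add: frame_def modifies_collect marked_def)
        ultimately show "?Q s3" using 1(2) 2(4) 3(1,2) cr by (simp add: \<phi>_def)
      qed
    qed
    then show "wp xs X (search_loop Bh Bn Bt Bmk Ful;; collect) ?Q s1" by simp
  qed
  then show ?thesis by (simp add: process_target_def)
qed

text \<open>The constant 4800 is the rate 300 times the factor 16 from \<open>credit_0\<close>; the
  400 per node pays for starting a search and for the loop.\<close>

lemma backward:
  assumes "graph_ok s" "params s" "arr s Cnt = (\<lambda>_. 0)" "arr s Ful = (\<lambda>_. 0)" "arr s Bmk = (\<lambda>_. 0)"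
    "bounded X s"
  shows "wp xs X backward (\<lambda>s'. tables n s' \<and> clk s' \<le> clk s + 30 + 400 * n + 4800 * (K * (q * m))) s"
proof -
  define I where "I v s' \<longleftrightarrow> graph_ok s' \<and> params s' \<and> tables v s' \<and> (\<forall>y. arr s' Bmk y \<le> v) \<and>
    vars s' Vv = v \<and> bounded X s' \<and> clk s' + 300 * credit v \<le> clk s + 10 + 400 * v + 300 * credit 0"
    for v and s' :: state
  let ?c = "If (Ar Flg (V Vv))
        (Vy ::= Add (Mul (V Vv) (V Vs)) (N 1);; process_target)
        Skip;;
      Vv ::= Add (V Vv) (N 1)"
  have loop: "wp xs X (While (Sub (V Vn) (V Vv)) ?c)
    (\<lambda>s'. tables n s' \<and> clk s' \<le> clk s + 30 + 400 * n + 4800 * (K * (q * m))) s0" if "I 0 s0" for s0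
  proof (rule wp_for[where I = I and k = n, OF that])
    fix v s' assume v: "v < n" and I: "I v s'"
    have flg: "arr s' Flg v \<noteq> 0 \<longleftrightarrow> v \<in> W" using I by (auto simp: I_def graph_ok_def)
    have bX: "Suc v \<le> X" using v X_n by simp
    have vX: "Suc (v * S) \<le> X" using encode_le_X[OF v S_pos(1)] by simp
    let ?e = "Sub (V Vn) (V Vv)"
    have "wp xs X ?c (\<lambda>s''. graph_ok s'' \<and> params s'' \<and> tables (Suc v) s'' \<and> (\<forall>y. arr s'' Bmk y \<le> Suc v) \<and>
      vars s'' Vv = Suc v \<and> clk (tick 1 s'') + 300 * credit (Suc v) \<le> clk s + 10 + 400 * Suc v + 300 * credit 0)
      (tick (ecost ?e + 1) s')"
    proof (cases "v \<in> W")
      case False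
      have "credit (Suc v) = credit v"
        using tgts_Suc_isolated[OF _ False] by (simp add: credit_def)
      moreover have "tables (Suc v) s'" using I tables_isolated[OF _ False, of s'] by (simp add: I_def)
      ultimately show ?thesis
        using I flg False bX by (simp add: I_def graph_ok_def params_def tables_def le_SucI)
    next
      case True
      then have A: "arr s' Flg v \<noteq> 0" using flg by simp
      show ?thesis
        using I A vX
        apply (simp add: I_def params_def)
        apply (rule wp_mono[OF wp_frame[OF process_target[where v = v]]])
        subgoal by (simp add: graph_ok_def)
        subgoal by (simp add: params_def)
        subgoal by (simp add: tables_def)
        subgoal by simp
        subgoal by simp
        subgoal using True .
        subgoal by simp
        subgoal by (simp add: bounded_def)
        subgoal using bX by (simp add: frame_def modifies_process_target graph_ok_def tables_def)
        done
    qed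
    from wp_frame_bounded[OF this] I
    show "eval ?e s' \<noteq> 0 \<and> wp xs X ?c (\<lambda>s''. I (Suc v) (tick 1 s'')) (tick (ecost ?e + 1) s')"
      using v by (auto simp: I_def graph_ok_def params_def tables_def elim!: wp_mono)
  next
    fix s' assume "I n s'"
    then show "eval (Sub (V Vn) (V Vv)) s' = 0 \<and> tables n (tick (ecost (Sub (V Vn) (V Vv)) + 1) s') \<and>
      clk (tick (ecost (Sub (V Vn) (V Vv)) + 1) s') \<le> clk s + 30 + 400 * n + 4800 * (K * (q * m))"
      using credit_0 by (simp add: I_def tables_def params_def algebra_simps)
  qed
  show ?thesis
    using assms by (simp add: backward_def del: One_nat_def)
      (rule loop, simp add: I_def params_def tables_0 graph_ok_def bounded_def)
qed

end

section \<open>Enumeration\<close>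

text \<open>With \<open>20 * n\<close> units each, \<open>K\<close> bursts exceed
  \<open>16 * q * m\<close>, the bound on the weight of the product graph.\<close>

definition burst :: com where
  "burst = (Vt ::= N 0;; While (Sub (Mul (N 20) (V Vn)) (V Vt))
     (search_unit Fh Fn Ft Fmk Zer;; Vt ::= Add (V Vt) (N 1)))"

definition emit_few :: com where
  "emit_few = (Vj ::= N 0;; While (Sub (V Vc) (V Vj))
     (Emit (V Vv) (Ar Lst (Add (Mul (V Vv) (V Vk)) (V Vj)));; Vj ::= Add (V Vj) (N 1)))"

definition emit_first :: com where
  "emit_first = (Vj ::= N 0;; While (Sub (V Vk) (V Vj))
     (burst;; Emit (V Vv) (Ar Lst (Add (Mul (V Vv) (V Vk)) (V Vj)));; Vj ::= Add (V Vj) (N 1)))"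

text \<open>Starts right after the last listed target. A node is an answer exactly if its exit state
  carries the stamp \<open>Vv + 1\<close> of the current forward search.\<close>

definition emit_rest :: com where
  "emit_rest = (Vu ::= Add (Ar Lst (Add (Mul (V Vv) (V Vk)) (Sub (V Vk) (N 1)))) (N 1);;
     While (Sub (V Vn) (V Vu))
       (If (neq (Ar Fmk (Add (Mul (V Vu) (V Vs)) (N 1))) (Add (V Vv) (N 1))) Skip (Emit (V Vv) (V Vu));;
        Vu ::= Add (V Vu) (N 1)))"

definition emit_many :: com where
  "emit_many = (Vy ::= Mul (V Vv) (V Vs);; search_start Fmk Zer;; emit_first;; emit_rest)"

text \<open>\<open>Cnt\<close> is capped at \<open>K\<close>, so a smaller value means that the
  stored row is complete.\<close>

definition enumerate :: com where
  "enumerate = (Vv ::= N 0;; While (Sub (V Vn) (V Vv))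
     (If (Ar Flg (V Vv))
        (Vc ::= Ar Cnt (Mul (V Vv) (V Vs));; If (Sub (V Vk) (V Vc)) emit_few emit_many)
        (If (Ar Nul (N 0)) (Emit (V Vv) (V Vv)) Skip);;
      Vv ::= Add (V Vv) (N 1)))"

lemma modifies_enumerate:
  "mvars burst = {Vt, Vy, Ve, Vqt, Vx, Vqh}" "marrs burst = {Fmk, Que}" "silent burst"
  "mvars emit_few = {Vj}" "marrs emit_few = {}"
  "mvars emit_first = {Vj, Vt, Vy, Ve, Vqt, Vx, Vqh}" "marrs emit_first = {Fmk, Que}"
  "mvars emit_rest = {Vu}" "marrs emit_rest = {}"
  "mvars emit_many = {Vj, Vt, Vy, Ve, Vqt, Vx, Vqh, Vst, Vu}" "marrs emit_many = {Fmk, Que}"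
  by (auto simp: burst_def emit_few_def emit_first_def emit_rest_def emit_many_def modifies_search)

definition emits :: "nat \<Rightarrow> (nat \<times> event) list \<Rightarrow> (nat \<times> event) list \<Rightarrow> (nat \<times> nat) list \<Rightarrow> bool" where
  "emits d lg l os \<longleftrightarrow> (\<exists>gs. length gs = length os \<and> (\<forall>g\<in>set gs. g \<le> d) \<and>
     l = lg @ map2 (\<lambda>g (i, j). (g, Output i j)) gs os)"

lemma emits_Nil: "emits d lg lg []"
  by (simp add: emits_def)

lemma emits_snoc: "emits d lg l os \<Longrightarrow> g \<le> d \<Longrightarrow> emits d lg (l @ [(g, Output i j)]) (os @ [(i, j)])"
proof -
  assume "emits d lg l os" "g \<le> d"
  then obtain gs where "length gs = length os" "\<forall>g\<in>set gs. g \<le> d"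
    "l = lg @ map2 (\<lambda>g (i, j). (g, Output i j)) gs os" by (auto simp: emits_def)
  then show ?thesis using \<open>g \<le> d\<close> unfolding emits_def by (intro exI[of _ "gs @ [g]"]) auto
qed

text \<open>Allows the output to switch from the stored list to a scan: what follows the entry at
  index \<open>i\<close> is found by restarting at the next larger number.\<close>

lemma filter_upt_nth:
  assumes "i < length (filter P [0..<n])"
  shows "filter P [0..<n] = take (Suc i) (filter P [0..<n]) @ filter P [Suc (filter P [0..<n] ! i)..<n]"
    "filter P [0..<n] ! i < n"
proof -
  let ?f = "filter P [0..<n]"
  define t where "t = ?f ! i"
  have "t \<in> set ?f" using assms by (simp add: t_def del: set_filter)
  then have t: "t < n" "P t" by auto
  then show "?f ! i < n" by (simp add: t_def)
  have "[0..<n] = [0..<t] @ [t..<n]" using t upt_add_eq_append[of 0 t "n - t"] by simp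
  also have "[t..<n] = t # [Suc t..<n]" using t by (simp add: upt_conv_Cons)
  finally have f: "?f = filter P [0..<t] @ t # filter P [Suc t..<n]" using t(2) by simp
  have "?f ! length (filter P [0..<t]) = t" by (subst f) simp
  moreover have "length (filter P [0..<t]) < length ?f" by (subst f) simp
  moreover have "distinct ?f" by simp
  ultimately have "i = length (filter P [0..<t])"
    using assms nth_eq_iff_index_eq[of ?f i "length (filter P [0..<t])"] by (simp add: t_def)
  then have "take (Suc i) ?f = filter P [0..<t] @ [t]" by (subst f) simp
  then show "?f = take (Suc i) ?f @ filter P [Suc (?f ! i)..<n]"
    using f unfolding t_def[symmetric] by simp
qed

context query_run
begin

interpretation fwd: search_arrays Fh Fn Ft Fmk Zer
  by unfold_locales auto

definition "fwd_inv u \<phi> s \<longleftrightarrow>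
  sinv Fh Fn Ft Fmk Zer (length edges) (nbr edges) (u * S) (Suc u) \<phi> s \<and> arr s Zer = (\<lambda>_. 0) \<and> bounded X s"

lemma fwd_inv_update:
  assumes "fwd_inv u \<phi> s" "vars s' = (vars s)(x := v)" "arr s' = arr s" "x \<notin> {Vst, Vqt, Vqh, Ve}" "v \<le> X"
  shows "fwd_inv u \<phi> s'"
proof -
  have "bounded X s'" using assms by (simp add: fwd_inv_def bounded_def)
  moreover have "vars s' Vst = vars s Vst" "vars s' Vqt = vars s Vqt" "vars s' Vqh = vars s Vqh"
    "vars s' Ve = vars s Ve" using assms(2,4) by auto
  ultimately show ?thesis
    using assms(1) unfolding fwd_inv_def sinv_def marked_def graph_rep_def assms(3) by (elim conjE) simp
qed

lemma fwd_reach: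
  assumes "u \<in> W"
  shows "reach (nbr edges) {} (u * S) \<subseteq> U" "finite (reach (nbr edges) {} (u * S))"
    "card (reach (nbr edges) {} (u * S)) < X"
    "weight (nbr edges) (reach (nbr edges) {} (u * S)) \<le> 20 * n * K"
proof -
  show R: "reach (nbr edges) {} (u * S) \<subseteq> U"
    using assms rtrancl_edges_U[of "u * S"] U_iff[of 0 u] S_pos by (auto simp: reach_forward)
  then show "finite (reach (nbr edges) {} (u * S))" "card (reach (nbr edges) {} (u * S)) < X"
    using card_U_less by auto
  \<comment> \<open>Here the rounding up in \<open>K\<close> is used; \<open>n\<close> is positive
    because \<open>u\<close> is a node.\<close>
  have "m \<le> n * (m div n + 1)"
    using W_less[OF assms] mult_div_mod_eq[of n m] mod_less_divisor[of n m] unfolding distrib_left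
    by linarith
  then have "16 * q * m \<le> 16 * q * (n * (m div n + 1))" by simp
  also have "\<dots> \<le> 20 * n * K" by (simp add: K_def algebra_simps)
  finally show "weight (nbr edges) (reach (nbr edges) {} (u * S)) \<le> 20 * n * K"
    using weight_mono[OF R finite_U, of "nbr edges"] weight_edges_le by linarith
qed

lemma burst:
  assumes "fwd_inv u \<phi> s" "u \<in> W" "vars s Vn = n"
  shows "wp xs X burst (\<lambda>s'. fwd_inv u (\<phi> - 20 * n) s' \<and> clk s' \<le> clk s + 20 + 2400 * n) s"
proof -
  define I where "I i s' \<longleftrightarrow> fwd_inv u (\<phi> - i) s' \<and> vars s' Vn = n \<and> vars s' Vt = i \<and>
    clk s' \<le> clk s + 5 + 120 * i" for i and s' :: state
  let ?e = "Sub (Mul (N 20) (V Vn)) (V Vt)"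
  have loop: "wp xs X (While ?e (search_unit Fh Fn Ft Fmk Zer;; Vt ::= Add (V Vt) (N 1)))
    (\<lambda>s'. fwd_inv u (\<phi> - 20 * n) s' \<and> clk s' \<le> clk s + 20 + 2400 * n) s0" if "I 0 s0" for s0
  proof (rule wp_for[where I = I and k = "20 * n", OF that])
    fix i s' assume i: "i < 20 * n" and I: "I i s'"
    let ?s = "tick (ecost ?e + 1) s'"
    have iX: "Suc i \<le> X" using i mult_le_X[of 20 "n + 1" 1 1 1] by simp
    have "wp xs X (search_unit Fh Fn Ft Fmk Zer) (\<lambda>s'. sinv Fh Fn Ft Fmk Zer (length edges) (nbr edges) (u * S)
      (Suc u) (\<phi> - i - 1) s' \<and> clk s' \<le> clk ?s + 90) ?s"
      using I fwd_reach[OF assms(2)] by (intro fwd.unit) (simp_all add: I_def fwd_inv_def)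
    then have "wp xs X (search_unit Fh Fn Ft Fmk Zer) (\<lambda>s'. wp xs X (Vt ::= Add (V Vt) (N 1))
      (\<lambda>s'. I (Suc i) (tick 1 s')) s') ?s"
    proof (rule wp_mono[OF wp_frame_bounded], goal_cases)
      case 1
      then show ?case using I by (simp add: I_def fwd_inv_def)
    next
      case (2 s2)
      then have "sinv Fh Fn Ft Fmk Zer (length edges) (nbr edges) (u * S) (Suc u) (\<phi> - Suc i)
        (s2\<lparr>vars := (vars s2)(Vt := Suc i)\<rparr>)" "bounded X (s2\<lparr>vars := (vars s2)(Vt := Suc i)\<rparr>)"
        using iX by (auto simp: sinv_def marked_def graph_rep_def bounded_def)
      then show ?case
        using 2 I iX by (simp add: I_def fwd_inv_def frame_def modifies_search sinv_def marked_def graph_rep_def bounded_def)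
    qed
    moreover have "eval ?e s' \<noteq> 0" using I i by (simp add: I_def)
    ultimately show "eval ?e s' \<noteq> 0 \<and> wp xs X (search_unit Fh Fn Ft Fmk Zer;; Vt ::= Add (V Vt) (N 1))
      (\<lambda>s'. I (Suc i) (tick 1 s')) ?s" unfolding wp_simps(5) by (rule conjI[rotated])
  next
    fix s' assume "I (20 * n) s'"
    then show "eval ?e s' = 0 \<and> fwd_inv u (\<phi> - 20 * n) (tick (ecost ?e + 1) s') \<and>
      clk (tick (ecost ?e + 1) s') \<le> clk s + 20 + 2400 * n"
      by (simp add: I_def fwd_inv_def)
  qed
  have "fwd_inv u \<phi> (s\<lparr>vars := (vars s)(Vt := 0), clk := k\<rparr>)" for k
    using assms(1) by (rule fwd_inv_update) auto
  then show ?thesis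
    using assms(3) by (simp add: burst_def del: One_nat_def) (rule loop, simp add: I_def)
qed

lemma row_less: "j < length (row u) \<Longrightarrow> row u ! j < n"
  unfolding row_def by (rule filter_upt_nth(2))

lemma emit_few:
  assumes "params s" "tables n s" "vars s Vv = u" "u \<in> W" "vars s Vc = arr s Cnt (u * S)"
    "arr s Cnt (u * S) < K" "emits d lg (trace s) os" "clk s + 100 \<le> d"
  shows "wp xs X emit_few (\<lambda>s'. emits d lg (trace s') (os @ map (Pair u) (row u)) \<and> clk s' \<le> clk s + 100) s"
proof -
  have U: "u * S \<in> U" using assms(4) U_iff[of 0 u] S_pos by simp
  have c: "arr s Cnt (u * S) = length (row u)"
    using assms(2,6) U row_W[OF assms(4)] by (auto simp: tables_def)
  have L: "arr s Lst (u * K + j) = row u ! j" if "j < length (row u)" for j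
    using assms(2,4) that c by (simp add: tables_def row_W)
  have cX: "length (row u) < X" using assms(6) c X_K by simp
  define I where "I j s' \<longleftrightarrow> vars s' Vv = u \<and> vars s' Vk = K \<and> vars s' Vc = length (row u) \<and> vars s' Vj = j \<and>
    arr s' Lst = arr s Lst \<and> emits d lg (trace s') (os @ map (Pair u) (take j (row u))) \<and> clk s' \<le> clk s + 20"
    for j and s' :: state
  let ?e = "Sub (V Vc) (V Vj)"
  have loop: "wp xs X (While ?e
     (Emit (V Vv) (Ar Lst (Add (Mul (V Vv) (V Vk)) (V Vj)));; Vj ::= Add (V Vj) (N 1)))
     (\<lambda>s'. emits d lg (trace s') (os @ map (Pair u) (row u)) \<and> clk s' \<le> clk s + 100) s0" if "I 0 s0" for s0
  proof (rule wp_for[where I = I and k = "length (row u)", OF that])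
    fix j s' assume j: "j < length (row u)" and I: "I j s'"
    then show "eval ?e s' \<noteq> 0 \<and> wp xs X
       (Emit (V Vv) (Ar Lst (Add (Mul (V Vv) (V Vk)) (V Vj)));; Vj ::= Add (V Vj) (N 1))
       (\<lambda>s'. I (Suc j) (tick 1 s')) (tick (ecost ?e + 1) s')"
      using emits_snoc[of d lg "trace s'" "os @ map (Pair u) (take j (row u))"] L[OF j] cX assms(8)
      by (simp add: I_def take_Suc_conv_app_nth)
  next
    fix s' assume "I (length (row u)) s'"
    then show "eval ?e s' = 0 \<and> emits d lg (trace (tick (ecost ?e + 1) s')) (os @ map (Pair u) (row u)) \<and>
      clk (tick (ecost ?e + 1) s') \<le> clk s + 100" by (simp add: I_def)
  qed
  show ?thesis
    using assms(1,3,5,7) c by (simp add: emit_few_def params_def del: One_nat_def) (rule loop, simp add: I_def)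
qed

lemma emit_first:
  assumes "params s" "tables n s" "vars s Vv = u" "u \<in> W" "arr s Cnt (u * S) = K"
    "fwd_inv u (20 * n * K) s" "emits d lg (trace s) os" "clk s + 2400 * n + 200 \<le> d"
  shows "wp xs X emit_first (\<lambda>s'. fwd_inv u 0 s' \<and>
    emits d lg (trace s') (os @ map (Pair u) (take K (row u))) \<and> clk s' \<le> 100) s"
proof -
  have U: "u * S \<in> U" using assms(4) U_iff[of 0 u] S_pos by simp
  have c: "K \<le> length (row u)"
    using assms(2,5) U row_W[OF assms(4)] by (auto simp: tables_def)
  have L: "arr s Lst (u * K + j) = row u ! j" if "j < K" for j
    using assms(2,4,5) that by (simp add: tables_def row_W)
  \<comment> \<open>Each output resets the clock, so only the first gap contains the time spent
    before the loop.\<close>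
  define I where "I j s' \<longleftrightarrow> params s' \<and> vars s' Vv = u \<and> vars s' Vj = j \<and>
    arr s' Lst = arr s Lst \<and> fwd_inv u (20 * n * K - 20 * n * j) s' \<and>
    emits d lg (trace s') (os @ map (Pair u) (take j (row u))) \<and> clk s' \<le> (if j = 0 then clk s + 20 else 20)"
    for j and s' :: state
  let ?e = "Sub (V Vk) (V Vj)"
  let ?c = "burst;; Emit (V Vv) (Ar Lst (Add (Mul (V Vv) (V Vk)) (V Vj)));; Vj ::= Add (V Vj) (N 1)"
  have loop: "wp xs X (While ?e ?c) (\<lambda>s'. fwd_inv u 0 s' \<and>
    emits d lg (trace s') (os @ map (Pair u) (take K (row u))) \<and> clk s' \<le> 100) s0" if "I 0 s0" for s0
  proof (rule wp_for[where I = I and k = K, OF that])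
    fix j s' assume j: "j < K" and I: "I j s'"
    let ?s = "tick (ecost ?e + 1) s'"
    have jX: "Suc j \<le> X" using j X_K by simp
    have ph: "20 * n * K - 20 * n * j - 20 * n = 20 * n * K - 20 * n * Suc j" by simp
    have tk: "take (Suc j) (row u) = take j (row u) @ [row u ! j]"
      using j c by (simp add: take_Suc_conv_app_nth)
    have "wp xs X burst (\<lambda>s'. fwd_inv u (20 * n * K - 20 * n * j - 20 * n) s' \<and>
      clk s' \<le> clk ?s + 20 + 2400 * n) ?s"
      using I assms(4) by (intro burst) (simp_all add: I_def fwd_inv_def params_def)
    then have "wp xs X burst (wp xs X (Emit (V Vv) (Ar Lst (Add (Mul (V Vv) (V Vk)) (V Vj)));;
      Vj ::= Add (V Vj) (N 1)) (\<lambda>s'. I (Suc j) (tick 1 s'))) ?s"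
    proof (rule wp_mono[OF wp_frame], elim conjE)
      fix s2 assume 2: "fwd_inv u (20 * n * K - 20 * n * j - 20 * n) s2"
        "clk s2 \<le> clk ?s + 20 + 2400 * n" "frame burst ?s s2"
      have fr: "params s2" "vars s2 Vv = u" "vars s2 Vj = j" "arr s2 Lst = arr s Lst" "trace s2 = trace s'"
        using 2(3) I by (simp_all add: I_def frame_def modifies_enumerate params_def)
      have t: "fwd_inv u (20 * n * K - 20 * n * Suc j) (s2\<lparr>trace := l, vars := (vars s2)(Vj := Suc j), clk := k\<rparr>)"
        for k l using 2(1) unfolding ph by (rule fwd_inv_update[where x = Vj and v = "Suc j"]) (simp_all add: jX)
      have em: "emits d lg (trace s' @ [(g, Output u (row u ! j))]) (os @ map (Pair u) (take (Suc j) (row u)))"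
        if "g \<le> d" for g
        using emits_snoc[of d lg "trace s'" "os @ map (Pair u) (take j (row u))" g] I that by (simp add: I_def tk)
      have "clk s2 + 50 \<le> d" using 2(2) I assms(8) by (simp add: I_def split: if_splits)
      then show "wp xs X (Emit (V Vv) (Ar Lst (Add (Mul (V Vv) (V Vk)) (V Vj)));;
        Vj ::= Add (V Vj) (N 1)) (\<lambda>s'. I (Suc j) (tick 1 s')) s2"
        using fr jX L[OF j] t em unfolding I_def params_def by simp
    qed
    moreover have "eval ?e s' \<noteq> 0" using I j by (simp add: I_def params_def)
    ultimately show "eval ?e s' \<noteq> 0 \<and> wp xs X ?c (\<lambda>s'. I (Suc j) (tick 1 s')) ?s"
      using wp_simps(5)[of xs X burst] by simp
  next
    fix s' assume "I K s'"
    then show "eval ?e s' = 0 \<and> fwd_inv u 0 (tick (ecost ?e + 1) s') \<and>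
      emits d lg (trace (tick (ecost ?e + 1) s')) (os @ map (Pair u) (take K (row u))) \<and>
      clk (tick (ecost ?e + 1) s') \<le> 100" using K_pos by (simp add: I_def params_def fwd_inv_def)
  qed
  have "fwd_inv u (20 * n * K) (s\<lparr>vars := (vars s)(Vj := 0), clk := k\<rparr>)" for k
    using assms(6) by (rule fwd_inv_update) auto
  then show ?thesis
    using assms(1,3,7) by (simp add: emit_first_def params_def del: One_nat_def)
      (rule loop, simp add: I_def params_def)
qed

text \<open>A gap may extend over a scan of all nodes, at 100 steps each, which is why the delay has
  to be linear in \<open>n\<close>.\<close>

lemma emit_rest:
  assumes "params s" "tables n s" "vars s Vv = u" "u \<in> W" "arr s Cnt (u * S) = K"
    "\<And>y. arr s Fmk y = Suc u \<longleftrightarrow> (u * S, y) \<in> (set edges)\<^sup>*" "\<And>y. arr s Fmk y \<le> Suc u"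
    "emits d lg (trace s) (os @ map (Pair u) (take K (row u)))" "clk s + 100 * n + 200 \<le> d"
  shows "wp xs X emit_rest (\<lambda>s'. emits d lg (trace s') (os @ map (Pair u) (row u)) \<and>
    clk s' \<le> clk s + 100 * n + 100) s"
proof -
  have U: "u * S \<in> U" using assms(4) U_iff[of 0 u] S_pos by simp
  have c: "K - 1 < length (row u)"
    using assms(2,5) U row_W[OF assms(4)] K_pos by (auto simp: tables_def)
  have L: "arr s Lst (u * K + (K - 1)) = row u ! (K - 1)"
    using assms(2,4,5) K_pos by (simp add: tables_def row_W del: add_diff_assoc)
  define v0 where "v0 = Suc (row u ! (K - 1))"
  have v0: "v0 \<le> n" using row_less[OF c] by (simp add: v0_def)
  define P where "P = (\<lambda>v. (u, v) \<in> Rel)"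
  have row: "row u = take K (row u) @ filter P [v0..<n]"
    using filter_upt_nth(1)[of "K - 1" P n] c K_pos by (simp add: row_def P_def v0_def)
  have mk: "arr s Fmk (Suc (v * S)) = Suc u \<longleftrightarrow> P v" for v
    using assms(6)[of "v * S + 1"] Rel_iff[OF assms(4), of v] by (simp add: P_def)
  define I where "I i s' \<longleftrightarrow> params s' \<and> vars s' Vv = u \<and> vars s' Vu = v0 + i \<and>
    arr s' Fmk = arr s Fmk \<and>
    emits d lg (trace s') (os @ map (Pair u) (take K (row u) @ filter P [v0..<v0 + i])) \<and>
    clk s' \<le> clk s + 30 + 100 * i" for i and s' :: state
  let ?e = "Sub (V Vn) (V Vu)"
  let ?c = "If (neq (Ar Fmk (Add (Mul (V Vu) (V Vs)) (N 1))) (Add (V Vv) (N 1))) Skip (Emit (V Vv) (V Vu));;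
        Vu ::= Add (V Vu) (N 1)"
  have loop: "wp xs X (While ?e ?c) (\<lambda>s'. emits d lg (trace s') (os @ map (Pair u) (row u)) \<and>
    clk s' \<le> clk s + 100 * n + 100) s0" if "I 0 s0" for s0
  proof (rule wp_for[where I = I and k = "n - v0", OF that])
    fix i s' assume i: "i < n - v0" and I: "I i s'"
    have v: "v0 + i < n" using i by simp
    have vX: "Suc (v0 + i) \<le> X" using v X_n by simp
    have cl: "clk s' \<le> clk s + 30 + 100 * i" "clk s + 130 + 100 * i \<le> d" using I v assms(9) by (simp_all add: I_def)
    show "eval ?e s' \<noteq> 0 \<and> wp xs X ?c (\<lambda>s'. I (Suc i) (tick 1 s')) (tick (ecost ?e + 1) s')"
    proof (cases "P (v0 + i)")
      case True
      then have m: "arr s Fmk (Suc ((v0 + i) * S)) = Suc u" using mk by simp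
      show ?thesis
        using I v vX m True cl
          emits_snoc[of d lg "trace s'" "os @ map (Pair u) (take K (row u) @ filter P [v0..<v0 + i])" _ u "v0 + i"]
        by (simp add: I_def params_def)
    next
      case False
      then have "arr s Fmk (Suc ((v0 + i) * S)) < Suc u"
        using mk[of "v0 + i"] assms(7)[of "Suc ((v0 + i) * S)"] by linarith
      then show ?thesis using I v vX False cl by (simp add: I_def params_def)
    qed
  next
    fix s' assume I: "I (n - v0) s'"
    have "clk s' \<le> clk s + 30 + 100 * (n - v0)" using I by (simp add: I_def)
    also have "\<dots> \<le> clk s + 30 + 100 * n" by (intro add_mono mult_le_mono) simp_all
    finally show "eval ?e s' = 0 \<and> emits d lg (trace (tick (ecost ?e + 1) s')) (os @ map (Pair u) (row u)) \<and>
      clk (tick (ecost ?e + 1) s') \<le> clk s + 100 * n + 100"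
      using I v0 row by (simp add: I_def params_def)
  qed
  have "v0 \<le> X" using v0 X_n by simp
  then show ?thesis
    using assms(1,3,8) L K_pos by (simp add: emit_rest_def params_def v0_def del: One_nat_def)
      (rule loop, simp add: I_def params_def v0_def)
qed

lemma emit_many:
  assumes "graph_ok s" "params s" "tables n s" "vars s Vv = u" "u \<in> W" "arr s Cnt (u * S) = K"
    "\<And>y. arr s Fmk y \<le> u" "arr s Zer = (\<lambda>_. 0)" "bounded X s" "emits d lg (trace s) os"
    "clk s + 2500 * n + 1000 \<le> d"
  shows "wp xs X emit_many (\<lambda>s'. emits d lg (trace s') (os @ map (Pair u) (row u)) \<and>
    (\<forall>y. arr s' Fmk y \<le> Suc u) \<and> clk s' \<le> 100 * n + 400) s"
proof -
  let ?R = "reach (nbr edges) {} (u * S)"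
  let ?Q = "\<lambda>s'. emits d lg (trace s') (os @ map (Pair u) (row u)) \<and>
    (\<forall>y. arr s' Fmk y \<le> Suc u) \<and> clk s' \<le> 100 * n + 400"
  have uX: "u < X" "u * S \<le> X" using W_less[OF assms(5)] X_n encode_le_X[of u 0] S_pos by simp_all
  let ?s = "tick 7 (s\<lparr>vars := (vars s)(Vy := u * S)\<rparr>)"
  have bs: "bounded X ?s" using assms(9) uX(2) by (simp add: bounded_def)
  have "wp xs X (search_start Fmk Zer) (\<lambda>s'. sinv Fh Fn Ft Fmk Zer (length edges) (nbr edges) (u * S) (Suc u)
      (weight (nbr edges) ?R) s' \<and> clk s' \<le> clk ?s + 90) ?s"
    using fwd.start[of "length edges" "nbr edges" ?s X xs] graph_rep_forward[OF assms(1)] assms(4,7,8) uX bs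
    by (simp add: graph_rep_def)
  then have "wp xs X (search_start Fmk Zer) (wp xs X (emit_first;; emit_rest) ?Q) ?s"
  proof (rule wp_mono[OF wp_frame_bounded[OF _ bs]], elim conjE)
    fix s1 assume 1: "sinv Fh Fn Ft Fmk Zer (length edges) (nbr edges) (u * S) (Suc u) (weight (nbr edges) ?R) s1"
      "clk s1 \<le> clk ?s + 90" "frame (search_start Fmk Zer) ?s s1" "bounded X s1"
    have fr1: "params s1" "tables n s1" "vars s1 Vv = u" "arr s1 Cnt (u * S) = K" "arr s1 Zer = (\<lambda>_. 0)" "trace s1 = trace s"
      using 1(3) assms(2,3,4,6,8) by (simp_all add: frame_def modifies_search params_def tables_def)
    \<comment> \<open>The invariant bounds the remaining work only from above, so the potential may
      be raised from the weight to \<open>20 * n * K\<close>.\<close>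
    have "fwd_inv u (20 * n * K) s1"
      using 1(1,4) fr1(5) fwd_reach(4)[OF assms(5)] unfolding fwd_inv_def sinv_def ainv_def
      by (elim conjE exE) (intro conjI exI, assumption+, simp_all)
    then have "wp xs X emit_first (\<lambda>s'. fwd_inv u 0 s' \<and>
      emits d lg (trace s') (os @ map (Pair u) (take K (row u))) \<and> clk s' \<le> 100) s1"
      using fr1 assms(5,10,11) 1(2) by (intro emit_first) simp_all
    then have "wp xs X emit_first (wp xs X emit_rest ?Q) s1"
    proof (rule wp_mono[OF wp_frame], elim conjE)
      fix s2 assume 2: "fwd_inv u 0 s2" "emits d lg (trace s2) (os @ map (Pair u) (take K (row u)))"
        "clk s2 \<le> 100" "frame emit_first s1 s2"
      have fr2: "params s2" "tables n s2" "vars s2 Vv = u" "arr s2 Cnt (u * S) = K"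
        using 2(4) fr1 by (simp_all add: frame_def modifies_enumerate params_def tables_def)
      obtain ql where ql: "marked Fmk (Suc u) s2 ql" "set ql = ?R"
        using 2(1) fwd.sinv_done[of "length edges" "nbr edges" "u * S" "Suc u" 0 s2] fwd_reach(2)[OF assms(5)]
        by (auto simp: fwd_inv_def)
      have "wp xs X emit_rest (\<lambda>s'. emits d lg (trace s') (os @ map (Pair u) (row u)) \<and>
        clk s' \<le> clk s2 + 100 * n + 100) s2"
        using fr2 2(2,3) assms(5,11) 1(2) ql by (intro emit_rest) (simp_all add: marked_def reach_forward)
      then show "wp xs X emit_rest ?Q s2"
      proof (rule wp_mono[OF wp_frame], elim conjE)
        fix s3 assume 3: "emits d lg (trace s3) (os @ map (Pair u) (row u))" "clk s3 \<le> clk s2 + 100 * n + 100"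
          "frame emit_rest s2 s3"
        then show "?Q s3" using ql(1) 1(2) 2(3) by (simp add: frame_def modifies_enumerate marked_def)
      qed
    qed
    then show "wp xs X (emit_first;; emit_rest) ?Q s1" by simp
  qed
  then show ?thesis using assms(2,4) uX(2) by (simp add: emit_many_def params_def)
qed

text \<open>A gap can run across many sources without answers. Each of them adds at most 200 to the
  clock, and a source with many answers leaves at most \<open>100 * n + 400\<close> behind; hence
  the shape of the clock bound in the invariant.\<close>

lemma enumerate:
  assumes "graph_ok s" "params s" "tables n s" "arr s Fmk = (\<lambda>_. 0)" "arr s Zer = (\<lambda>_. 0)"
    "arr s Nul 0 = of_bool (nullable r)" "bounded X s" "clk s + 4000 * (n + 1) \<le> d"
  shows "wp xs X enumerate (\<lambda>s'. emits d (trace s) (trace s') (concat (map (\<lambda>u. map (Pair u) (row u)) [0..<n])) \<and>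
    clk s' + 10 \<le> d) s"
proof -
  define os where "os u = concat (map (\<lambda>u. map (Pair u) (row u)) [0..<u])" for u
  have os: "os (Suc u) = os u @ map (Pair u) (row u)" for u by (simp add: os_def)
  define J where "J u s' \<longleftrightarrow> graph_ok s' \<and> params s' \<and> tables n s' \<and> arr s' Zer = (\<lambda>_. 0) \<and>
    arr s' Nul 0 = of_bool (nullable r) \<and> (\<forall>y. arr s' Fmk y \<le> u) \<and> vars s' Vv = u \<and>
    emits d (trace s) (trace s') (os u) \<and> clk s' \<le> clk s + 500 + 100 * n + 200 * u" for u and s' :: state
  define I where "I u s' \<longleftrightarrow> J u s' \<and> bounded X s'" for u s'
  let ?e = "Sub (V Vn) (V Vv)"
  let ?c = "If (Ar Flg (V Vv))
        (Vc ::= Ar Cnt (Mul (V Vv) (V Vs));; If (Sub (V Vk) (V Vc)) emit_few emit_many)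
        (If (Ar Nul (N 0)) (Emit (V Vv) (V Vv)) Skip);;
      Vv ::= Add (V Vv) (N 1)"
  have loop: "wp xs X (While ?e ?c) (\<lambda>s'. emits d (trace s) (trace s') (os n) \<and> clk s' + 10 \<le> d) s0" if "I 0 s0" for s0
  proof (rule wp_for[where I = I and k = n, OF that])
    fix u s' assume u: "u < n" and I: "I u s'"
    let ?s = "tick (ecost ?e + 1) s'"
    have flg: "arr s' Flg u \<noteq> 0 \<longleftrightarrow> u \<in> W" using I by (auto simp: I_def J_def graph_ok_def)
    have uX: "Suc u \<le> X" using u X_n by simp
    have d: "clk s' + 2500 * n + 2000 \<le> d" using I u assms(8) by (simp add: I_def J_def)
    have "wp xs X ?c (\<lambda>s'. J (Suc u) (tick 1 s')) ?s"
    proof (cases "u \<in> W")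
      case False
      then show ?thesis
        using I flg u uX d row_isolated[OF u False] emits_snoc[of d "trace s" "trace s'" "os u" _ u u]
        by (cases "nullable r") (simp_all add: I_def J_def graph_ok_def params_def tables_def os le_SucI)
    next
      case True
      have U: "u * S \<in> U" using True U_iff[of 0 u] S_pos by simp
      have c: "arr s' Cnt (u * S) \<le> K" "arr s' Cnt (u * S) \<le> X"
        using I U X_K by (auto simp: I_def J_def tables_def)
      show ?thesis
      proof (cases "arr s' Cnt (u * S) < K")
        case less: True
        show ?thesis
          using I flg True c less unfolding I_def J_def params_def
          apply (simp del: neq0_conv split del: split_of_bool)
          apply (rule wp_mono[OF wp_frame[OF emit_few[where u = u and d = d and lg = "trace s" and os = "os u"]]])
          subgoal by (simp add: params_def)
          subgoal by (simp add: tables_def)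
          subgoal by simp
          subgoal by simp
          subgoal by simp
          subgoal by simp
          subgoal by simp
          subgoal using d by simp
          subgoal using uX by (simp add: frame_def modifies_enumerate graph_ok_def tables_def os le_SucI)
          done
      next
        case False
        then have K: "arr s' Cnt (u * S) = K" using c by simp
        show ?thesis
          using I flg True c K unfolding I_def J_def params_def
          apply (simp del: neq0_conv split del: split_of_bool)
          apply (rule wp_mono[OF wp_frame[OF emit_many[where u = u and d = d and lg = "trace s" and os = "os u"]]])
          subgoal by (simp add: graph_ok_def)
          subgoal by (simp add: params_def)
          subgoal by (simp add: tables_def)
          subgoal by simp
          subgoal by simp
          subgoal by simp
          subgoal by simp
          subgoal by simp
          subgoal by (simp add: bounded_def)
          subgoal by simp
          subgoal using d by simp
          subgoal using uX by (simp add: frame_def modifies_enumerate graph_ok_def tables_def os)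
          done
      qed
    qed
    from wp_frame_bounded[OF this] I have "wp xs X ?c (\<lambda>s'. I (Suc u) (tick 1 s')) ?s"
      by (auto simp: I_def elim!: wp_mono)
    moreover have "eval ?e s' \<noteq> 0" using I u by (simp add: I_def J_def params_def)
    ultimately show "eval ?e s' \<noteq> 0 \<and> wp xs X ?c (\<lambda>s'. I (Suc u) (tick 1 s')) ?s" by blast
  next
    fix s' assume "I n s'"
    then show "eval ?e s' = 0 \<and> emits d (trace s) (trace (tick (ecost ?e + 1) s')) (os n) \<and>
      clk (tick (ecost ?e + 1) s') + 10 \<le> d"
      using assms(8) by (simp add: I_def J_def params_def)
  qed
  show ?thesis
    using assms unfolding os_def[symmetric] by (simp add: enumerate_def del: One_nat_def split del: split_of_bool)
      (rule loop, simp add: I_def J_def params_def tables_def graph_ok_def bounded_def os_def emits_Nil)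
qed

end

section \<open>The whole program\<close>

definition preprocess :: "nat \<Rightarrow> com" where
  "preprocess A = (Vs ::= Mul (N 2) (V Vq);; Vk ::= Mul (Add (Div (V Vm) (V Vn)) (N 1)) (V Vq);;
     scan A;; eps_loop;; backward)"

text \<open>Nonzero exactly if \<open>q * q * m < n\<close>. Otherwise \<open>n\<close> is at most
  \<open>K * (q * m)\<close>, and steps linear in \<open>n\<close> fit into the preprocessing
  time.\<close>

abbreviation early :: exp where
  "early \<equiv> Sub (V Vn) (Mul (Mul (V Vq) (V Vq)) (V Vm))"

text \<open>Scanning the nodes takes time linear in their number, which the preprocessing phase
  cannot afford if there are too few arcs. In this case the whole preprocessing after parsing
  takes linear time only and is charged to the delay of the first output.\<close>

definition main :: "nat \<Rightarrow> com" where
  "main A = (parse;; If early Rdy Skip;; preprocess A;; If early Skip Rdy;; enumerate)"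

context query_run
begin

definition "outputs = concat (map (\<lambda>u. map (Pair u) (row u)) [0..<n])"

definition "pre_cost = 300 + (100 * A + 460) * n + 8200 * (K * (q * m))"

lemma cost_le: "m * (150 + 250 * length ts) + 2 * m * (30 + 250 * length ts) \<le> 3400 * (K * (q * m))"
proof -
  have "m * (150 + 250 * length ts) + 2 * m * (30 + 250 * length ts) = m * (210 + 750 * length ts)"
    by (simp add: algebra_simps)
  also have "\<dots> \<le> m * (210 * q + 750 * (4 * q))"
    using length_ts rpq_length_pos[of r] by (intro mult_le_mono add_mono) (auto simp del: rpq_length_pos)
  also have "\<dots> \<le> 3400 * (q * m)" by (simp add: algebra_simps)
  also have "\<dots> \<le> 3400 * (K * (q * m))" using K_pos by simp
  finally show ?thesis .
qed

lemma preprocess: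
  assumes "trs_ok s" "vars s Vn = n" "vars s Vq = q" "vars s Vm = m" "bounded X s"
    "\<And>B. B \<in> {Flg, Fh, Bh, Cnt, Ful, Bmk} \<Longrightarrow> arr s B = (\<lambda>_. 0)"
  shows "wp xs X (preprocess A) (\<lambda>s'. graph_ok s' \<and> params s' \<and> tables n s' \<and> clk s' \<le> clk s + pre_cost) s"
proof -
  let ?Q = "\<lambda>s'. graph_ok s' \<and> params s' \<and> tables n s' \<and> clk s' \<le> clk s + pre_cost"
  have X: "2 * q \<le> X" "(m div n + 1) * q \<le> X" using X_q X_K by (simp_all add: K_def)
  let ?s = "s\<lparr>vars := (vars s)(Vs := S, Vk := K), clk := 18 + clk s\<rparr>"
  have bs: "bounded X ?s" using assms(5) X by (simp add: bounded_def S_def K_def)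
  have "wp xs X (scan A) (\<lambda>s'. edges_rep (lab_edges S ts arc_list) s' \<and> supp (arr s' Flg) = W \<and>
    clk s' \<le> clk ?s + 30 + 100 * (n * A) + m * (150 + 250 * length ts)) ?s"
    using assms by (intro scan) (simp_all add: trs_ok_def params_def)
  then have "wp xs X (scan A) (wp xs X (eps_loop;; backward) ?Q) ?s"
  proof (rule wp_mono[OF wp_frame_bounded[OF _ bs]], elim conjE)
    fix s1 assume 1: "edges_rep (lab_edges S ts arc_list) s1" "supp (arr s1 Flg) = W"
      "clk s1 \<le> clk ?s + 30 + 100 * (n * A) + m * (150 + 250 * length ts)" "frame (scan A) ?s s1" "bounded X s1"
    have f1: "trs_ok s1" "params s1" "arr s1 Cnt = (\<lambda>_. 0)" "arr s1 Ful = (\<lambda>_. 0)" "arr s1 Bmk = (\<lambda>_. 0)"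
      using 1(4) assms by (simp_all add: frame_def modifies_scan trs_ok_def params_def)
    have "wp xs X eps_loop (\<lambda>s'. graph_ok s' \<and>
      clk s' \<le> clk s1 + 30 + 60 * n + 2 * m * (30 + 250 * length ts)) s1"
      using f1 1(1,2) by (intro eps_loop)
    then have "wp xs X eps_loop (wp xs X backward ?Q) s1"
    proof (rule wp_mono[OF wp_frame_bounded[OF _ 1(5)]], elim conjE)
      fix s2 assume 2: "graph_ok s2" "clk s2 \<le> clk s1 + 30 + 60 * n + 2 * m * (30 + 250 * length ts)"
        "frame eps_loop s1 s2" "bounded X s2"
      have f2: "params s2" "arr s2 Cnt = (\<lambda>_. 0)" "arr s2 Ful = (\<lambda>_. 0)" "arr s2 Bmk = (\<lambda>_. 0)"
        using 2(3) f1 by (simp_all add: frame_def modifies_eps_loop params_def)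
      have "wp xs X backward (\<lambda>s'. tables n s' \<and> clk s' \<le> clk s2 + 30 + 400 * n + 4800 * (K * (q * m))) s2"
        using f2 2(1,4) by (intro backward)
      then show "wp xs X backward ?Q s2"
      proof (rule wp_mono[OF wp_frame], elim conjE)
        fix s3 assume 3: "tables n s3" "clk s3 \<le> clk s2 + 30 + 400 * n + 4800 * (K * (q * m))"
          "frame backward s2 s3"
        have "clk s3 \<le> clk s + pre_cost"
          using 3(2) 2(2) 1(3) cost_le by (simp add: pre_cost_def algebra_simps)
        then show "?Q s3" using 3(1,3) 2(1) f2(1)
          by (simp add: frame_def modifies_backward graph_ok_def params_def)
      qed
    qed
    then show "wp xs X (eps_loop;; backward) ?Q s1" by simp
  qed
  then show ?thesis using assms(2-4) X
    by (simp add: preprocess_def S_def K_def)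
qed

lemma modifies_preprocess:
  "marrs (preprocess A) = {Flg, Fh, Fn, Ft, Bh, Bn, Bt, Bmk, Que, Cnt, Ful, Lst}" "silent (preprocess A)"
  by (auto simp: preprocess_def modifies_scan modifies_eps_loop modifies_backward)

lemma modifies_parse:
  "mvars parse = {Vi, Vsp, Vtc, Vw, Vr1, Vr2}" "marrs parse = {Tp, Tl, Td, Nul, Stk}" "silent parse"
  by (auto simp: parse_def parse_body_def parse_Alt_def parse_Cat_def parse_Plus_def add_trans_def)

definition "delay = (100 * A + 20000) * (n + 1)"

lemma delay_ge: "4000 * (n + 1) \<le> delay"
  unfolding delay_def by (intro mult_le_mono) simp_all

text \<open>From \<open>q * q * m < n\<close> follows \<open>m < n\<close>, so
  \<open>m div n = 0\<close> and \<open>K = q\<close>. The term \<open>K * (q * m)\<close> is then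
  below \<open>n\<close>, and all of preprocessing is linear in \<open>n\<close>.\<close>

lemma early_cost: "q * q * m < n \<Longrightarrow> pre_cost + 4000 * (n + 1) + 200 \<le> delay"
proof -
  assume *: "q * q * m < n"
  have "m \<le> q * q * m" using rpq_length_pos[of r] by (simp add: Suc_le_eq del: rpq_length_pos)
  then have "m < n" using * by (rule le_less_trans)
  then have "m div n = 0" by simp
  then have "K * (q * m) \<le> n" using * by (simp add: K_def)
  then show ?thesis by (simp add: pre_cost_def delay_def algebra_simps)
qed

text \<open>The tested variables do not change between the two tests, so \<open>READY\<close> is
  executed exactly once: before the construction of the product if \<open>early\<close> holds, after
  it otherwise.\<close>

theorem main:
  assumes "vars s Vn = n" "vars s Vq = q" "vars s Vm = m" "arr s = (\<lambda>_ _. 0)" "bounded X s"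
    "trace s = []" "clk s \<le> 20"
  shows "wp xs X (main A) (\<lambda>s'. \<exists>p. emits delay [(p, Ready)] (trace s') outputs \<and> clk s' + 10 \<le> delay \<and>
    p + 1 \<le> 2000 * q + (100 * A + 9000) * (K * (q * m))) s"
proof -
  let ?Q = "\<lambda>s'. \<exists>p. emits delay [(p, Ready)] (trace s') outputs \<and> clk s' + 10 \<le> delay \<and>
    p + 1 \<le> 2000 * q + (100 * A + 9000) * (K * (q * m))"
  have q: "1 \<le> q" using rpq_length_pos[of r] by linarith
  have en: "wp xs X enumerate ?Q s2"
    if "graph_ok s2" "params s2" "tables n s2" "arr s2 Fmk = (\<lambda>_. 0)" "arr s2 Zer = (\<lambda>_. 0)"
      "arr s2 Nul 0 = of_bool (nullable r)" "bounded X s2" "clk s2 + 4000 * (n + 1) \<le> delay"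
      "trace s2 = [(g, Ready)]" "g + 1 \<le> 2000 * q + (100 * A + 9000) * (K * (q * m))" for s2 g
    by (rule wp_mono[OF enumerate[OF that(1-8)]]) (use that(9,10) in \<open>auto simp: outputs_def\<close>)
  have "wp xs X parse (\<lambda>s'. vars s' Vtc = length ts \<and> trs_rep (arr s' Tp) (arr s' Tl) (arr s' Td) ts \<and>
    arr s' Nul 0 = of_bool (nullable r) \<and> clk s' \<le> clk s + 500 * q) s"
    using assms(2) by (rule parse)
  then have "wp xs X parse (wp xs X (If early Rdy Skip;; preprocess A;; If early Skip Rdy;; enumerate) ?Q) s"
  proof (rule wp_mono[OF wp_frame_bounded[OF _ assms(5)]], elim conjE)
    fix s1 assume 1: "vars s1 Vtc = length ts" "trs_rep (arr s1 Tp) (arr s1 Tl) (arr s1 Td) ts"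
      "arr s1 Nul 0 = of_bool (nullable r)" "clk s1 \<le> clk s + 500 * q" "frame parse s s1" "bounded X s1"
    have f1: "vars s1 Vn = n" "vars s1 Vq = q" "vars s1 Vm = m" "trace s1 = []"
      "\<And>B. B \<notin> {Tp, Tl, Td, Nul, Stk} \<Longrightarrow> arr s1 B = (\<lambda>_. 0)"
      using 1(5) assms by (simp_all add: frame_def modifies_parse)
    have zero: "arr s1 B = (\<lambda>_. 0)" if "B \<in> {Flg, Fh, Bh, Cnt, Ful, Bmk}" for B
      using that by (intro f1(5)) auto
    have pre: "wp xs X (preprocess A) (\<lambda>s'. (graph_ok s' \<and> params s' \<and> tables n s' \<and> clk s' \<le> t + pre_cost) \<and>
        frame (preprocess A) s1' s' \<and> bounded X s') s1'"
      if "vars s1' = vars s1" "arr s1' = arr s1" "clk s1' = t" for s1' t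
      using 1(1,2,6) f1(1-3) zero that by (intro wp_frame_bounded preprocess[of s1', unfolded that(3)])
        (simp_all add: trs_ok_def bounded_def)
    have fr: "arr s2 Fmk = (\<lambda>_. 0)" "arr s2 Zer = (\<lambda>_. 0)" "arr s2 Nul 0 = of_bool (nullable r)" "trace s2 = trace s1'"
      if "frame (preprocess A) s1' s2" "arr s1' = arr s1" for s1' s2
      using that f1(5) 1(3) by (simp_all add: frame_def modifies_preprocess)
    show "wp xs X (If early Rdy Skip;; preprocess A;; If early Skip Rdy;; enumerate) ?Q s1"
    proof (cases "q * q * m < n")
      case True
      let ?t = "s1\<lparr>trace := [(clk s1 + 12, Ready)], clk := 1\<rparr>"
      have "wp xs X (preprocess A) (wp xs X (If early Skip Rdy;; enumerate) ?Q) ?t"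
      proof (rule wp_mono[OF pre[of ?t 1]], simp, simp, simp, elim conjE)
        fix s2 assume 2: "graph_ok s2" "params s2" "tables n s2" "clk s2 \<le> 1 + pre_cost"
          "frame (preprocess A) ?t s2" "bounded X s2"
        have "wp xs X enumerate ?Q (s2\<lparr>clk := clk s2 + 13\<rparr>)"
          using 2 fr[OF 2(5)] True early_cost[OF True] 1(4) assms(7) q
          by (intro en[of _ "clk s1 + 12"])
            (simp_all add: graph_ok_def params_def tables_def)
        then show "wp xs X (If early Skip Rdy;; enumerate) ?Q s2"
          using 2(2) True by (simp add: params_def ac_simps)
      qed
      then show ?thesis using True f1 by simp
    next
      case False
      let ?t = "s1\<lparr>clk := clk s1 + 12\<rparr>"
      have "wp xs X (preprocess A) (wp xs X (If early Skip Rdy;; enumerate) ?Q) ?t"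
      proof (rule wp_mono[OF pre[of ?t "clk s1 + 12"]], simp, simp, simp, elim conjE)
        fix s2 assume 2: "graph_ok s2" "params s2" "tables n s2" "clk s2 \<le> clk s1 + 12 + pre_cost"
          "frame (preprocess A) ?t s2" "bounded X s2"
        have "n \<le> K * (q * m)"
        proof -
          have "n \<le> q * (q * m)" using False by simp
          also have "\<dots> \<le> K * (q * m)" unfolding K_def by (intro mult_le_mono) simp_all
          finally show ?thesis .
        qed
        then have "(100 * A + 460) * n \<le> (100 * A + 460) * (K * (q * m))" by (intro mult_le_mono) simp_all
        then have "pre_cost \<le> 300 + (100 * A + 8660) * (K * (q * m))"
          by (simp add: pre_cost_def algebra_simps)
        moreover have "(100 * A + 8660) * (K * (q * m)) \<le> (100 * A + 9000) * (K * (q * m))"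
          by (intro mult_le_mono) simp_all
        ultimately have "clk s2 + 13 + 1 \<le> 2000 * q + (100 * A + 9000) * (K * (q * m))"
          using 2(4) 1(4) assms(7) q by linarith
        then have "wp xs X enumerate ?Q (s2\<lparr>clk := 0, trace := [(clk s2 + 12, Ready)]\<rparr>)"
          using 2 fr[OF 2(5)] f1(4) delay_ge
          by (intro en[of _ "clk s2 + 12"])
            (simp_all add: graph_ok_def params_def tables_def bounded_def)
        then show "wp xs X (If early Skip Rdy;; enumerate) ?Q s2"
          using 2(2) fr(4)[OF 2(5)] False f1(4) by (simp add: params_def ac_simps)
      qed
      then show ?thesis using False f1 by simp
    qed
  qed
  then show ?thesis by (simp add: main_def)
qed

end

text \<open>The final offset, at address \<open>2 + q + n * A\<close>, is the number
  \<open>m\<close> of arcs. One more than this address, plus \<open>m\<close>, is the input length,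
  which goes to register 0.\<close>

definition prelude :: "nat \<Rightarrow> instr list" where
  "prelude A = [SETC 30 0, LOAD (vreg Vn) 30, SETC 30 1, LOAD (vreg Vq) 30, SETC 30 A,
     MUL 31 (vreg Vn) 30, ADD 31 31 (vreg Vq), SETC 30 2, ADD 31 31 30, LOAD (vreg Vm) 31,
     SETC 30 1, ADD 31 31 30, ADD 0 31 (vreg Vm)]"

definition program :: "nat \<Rightarrow> instr list" where
  "program A = prelude A @ code_at (main A) 13 @ [HALT]"

lemma length_prelude: "length (prelude A) = 13"
  by (simp add: prelude_def)

lemma sits_program: "sits (program A) 0 (prelude A)" "sits (program A) 13 (code_at (main A) 13)"
  "sits (program A) (13 + clen (main A)) [HALT]"
proof -
  have "sits (program A) 0 (program A)" by (simp add: sits_def)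
  then show "sits (program A) 0 (prelude A)" "sits (program A) 13 (code_at (main A) 13)"
    "sits (program A) (13 + clen (main A)) [HALT]"
    unfolding program_def by (simp_all add: sits_append length_prelude)
qed

text \<open>Partial evaluation of jump-free silent code, so that the simplifier can run the prelude
  symbolically.\<close>

fun straight :: "nat \<Rightarrow> instr list \<Rightarrow> config \<Rightarrow> config option" where
  "straight w [] c = Some c"
| "straight w (i # is) c = (case exec_instr w i c of
     Some (Silent, c') \<Rightarrow> if pc c' = Suc (pc c) then straight w is c' else None
   | _ \<Rightarrow> None)"

lemma (in machine) straight_reaches:
  "sits P (pc c) is \<Longrightarrow> straight w is c = Some c' \<Longrightarrow> reaches c (replicate (length is) Silent) c'"
proof (induction "is" arbitrary: c)
  case (Cons i "is")
  from Cons.prems(2) obtain c1 where c1: "exec_instr w i c = Some (Silent, c1)" "pc c1 = Suc (pc c)"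
    "straight w is c1 = Some c'"
    by (auto split: option.splits event.splits if_splits)
  have "pc c < length P" "P ! pc c = i" "sits P (pc c1) is" using Cons.prems(1) c1(2) by (auto simp: sits_Cons)
  then show ?case using Cons.IH[of c1] c1 by (auto intro: reaches_step)
qed simp

lemma straight_prelude:
  assumes "reg c = (\<lambda>_. 0)" "pc c = 0" "mem c 0 = n" "mem c (Suc 0) = q" "mem c (n * A + q + 2) = m"
    "n * A + q + 3 + m < 2 ^ w" "n < 2 ^ w" "A < 2 ^ w"
  shows "\<exists>c'. straight w (prelude A) c = Some c' \<and> pc c' = 13 \<and> mem c' = mem c \<and>
    reg c' 0 = n * A + q + 3 + m \<and> reg c' 1 = n \<and> reg c' 2 = q \<and> reg c' 3 = m \<and>
    (\<forall>x. 3 < x \<and> x < 30 \<longrightarrow> reg c' x = 0)"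
proof -
  have "n * A < 2 ^ w" "n * A + q < 2 ^ w" "n * A + q + 2 < 2 ^ w" "n * A + q + 3 < 2 ^ w"
    "q < 2 ^ w" "m < 2 ^ w" "2 < (2 :: nat) ^ w" "Suc 0 < (2 :: nat) ^ w"
    using assms(6) by linarith+
  then show ?thesis
    using assms by (simp add: prelude_def set_reg_def)
qed

lemma concat_map2_outputs:
  "length gs = length os \<Longrightarrow>
   concat (map (\<lambda>(k, e). replicate k Silent @ [e]) (map2 (\<lambda>g (i, j). (g, Output i j)) gs os)) =
   concat (map2 (\<lambda>k (i, j). replicate k Silent @ [Output i j]) gs os)"
  by (induction gs os rule: list_induct2) auto

context query_run
begin

lemma run_program:
  assumes "X ^ csize (main A) < 2 ^ w" "X < 2 ^ w"
    "real (2000 * q + (100 * A + 9000) * (K * (q * m))) \<le> TP" "real (delay + 1) \<le> TD"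
  shows "\<exists>es. run w (program A) (init_config xs) es \<and> enumeration es TP TD outputs"
proof -
  have X2: "2 \<le> X" using X_n by simp
  have length_le: "length xs \<le> X"
    using length_xs mult_le_X[of 10 "n + 1" 1 1 "A + 1"] mult_le_X[of 10 1 1 "m + 1" 1] X_q
    by (simp add: algebra_simps)
  interpret machine w "program A" xs X
    using X2 length_le xs_le_X by unfold_locales
  \<comment> \<open>The clock starts at 13 because the steps of the prelude have already passed and
    belong to preprocessing.\<close>
  define s0 where "s0 = \<lparr>vars = (\<lambda>_. 0)(Vn := n, Vq := q, Vm := m), arr = \<lambda>_ _. 0, clk = 13, trace = []\<rparr>"
  let ?c0 = "init_config xs"
  have mem: "mem ?c0 0 = n" "mem ?c0 (Suc 0) = q" "mem ?c0 (2 + q + n * A) = m"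
    using length_xs xs_offset[of "n * A"] by (simp_all add: init_config_def xs_def m_def length_xss)
  have "\<exists>c1. straight w (prelude A) ?c0 = Some c1 \<and> pc c1 = 13 \<and> mem c1 = mem ?c0 \<and>
    reg c1 0 = n * A + q + 3 + m \<and> reg c1 1 = n \<and> reg c1 2 = q \<and> reg c1 3 = m \<and>
    (\<forall>x. 3 < x \<and> x < 30 \<longrightarrow> reg c1 x = 0)"
    using mem assms(2) length_le length_xs X_n X_q
    by (intro straight_prelude) (simp_all add: init_config_def ac_simps)
  then obtain c1 where c1: "straight w (prelude A) ?c0 = Some c1" "pc c1 = 13" "mem c1 = mem ?c0"
    "reg c1 0 = n * A + q + 3 + m" "reg c1 1 = n" "reg c1 2 = q" "reg c1 3 = m"
    "\<And>x. 3 < x \<Longrightarrow> x < 30 \<Longrightarrow> reg c1 x = 0" by blast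
  have r1: "reaches ?c0 (replicate 13 Silent) c1"
    using straight_reaches[OF _ c1(1)] sits_program(1)[of A] length_prelude[of A] by (simp add: init_config_def)
  have "reg c1 (vreg x) = vars s0 x" for x
    using c1(5-8) by (cases x) (simp_all add: s0_def)
  then have sim: "sim s0 c1"
    using c1(3,4) length_xs by (simp add: sim_def s0_def init_config_def)
  have b: "bounded X s0" using X_n X_q X_m by (simp add: bounded_def s0_def)
  obtain s' p where s': "exec xs X (main A) s0 s'" "emits delay [(p, Ready)] (trace s') outputs"
    "clk s' + 10 \<le> delay" "p + 1 \<le> 2000 * q + (100 * A + 9000) * (K * (q * m))"
    using main[of s0] b unfolding wp_def by (auto simp: s0_def)
  obtain g es where g: "reaches c1 es g" "pc g = 13 + clen (main A)" "hist s' = hist s0 @ es"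
    using compile[OF s'(1) b sim] sits_program(2)[of A] assms(1) c1(2) by auto
  have "run w (program A) g []"
    using sits_program(3)[of A] g(2) by (intro run.halt) (simp_all add: sits_single)
  then have "run w (program A) ?c0 (replicate 13 Silent @ es)"
    using reaches_trans[OF r1 g(1)] unfolding reaches_def by fastforce
  moreover have "hist s0 = replicate 13 Silent" by (simp add: hist_def s0_def)
  ultimately have run: "run w (program A) ?c0 (hist s')" using g(3) by simp
  obtain gs where gs: "length gs = length outputs" "\<forall>g\<in>set gs. g \<le> delay"
    "trace s' = [(p, Ready)] @ map2 (\<lambda>g (i, j). (g, Output i j)) gs outputs"
    using s'(2) by (auto simp: emits_def)
  have "enumeration (hist s') TP TD outputs"
    unfolding enumeration_def
  proof (intro exI conjI ballI)
    show "length gs = length outputs" by fact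
    show "hist s' = replicate p Silent @ [Ready] @
        concat (map2 (\<lambda>k (i, j). replicate k Silent @ [Output i j]) gs outputs) @ replicate (clk s') Silent"
      using concat_map2_outputs[OF gs(1)] by (simp add: hist_def gs(3))
    show "real (Suc p) \<le> TP" using s'(4) assms(3) by linarith
    fix k' assume "k' \<in> set (gs @ [clk s'])"
    then have "k' \<le> delay" using gs(2) s'(3) by auto
    then show "real (Suc k') \<le> TD" using assms(4) by linarith
  qed
  then show ?thesis using run by blast
qed

section \<open>Completeness and order of the output list\<close>

lemma set_outputs: "set outputs = Rel"
proof -
  have "Rel \<subseteq> {..<n} \<times> {..<n}" unfolding Rel_def using G_subset by (rule rel_subset)
  then show ?thesis by (force simp: outputs_def row_def)
qed

lemma sorted_outputs: "sorted_wrt (\<lambda>(i, j) (i', j'). i < i' \<or> i = i' \<and> j < j') outputs"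
proof -
  have "sorted_wrt (\<lambda>(i, j) (i', j'). i < i' \<or> i = i' \<and> j < j')
    (concat (map (\<lambda>u. map (Pair u) (row u)) [0..<k]))" for k
  proof (induction k)
    case (Suc k)
    have "sorted_wrt (<) (row k)" unfolding row_def by (rule sorted_wrt_filter) simp
    then show ?case using Suc by (auto simp: sorted_wrt_append sorted_wrt_map)
  qed simp
  then show ?thesis by (simp add: outputs_def)
qed

end

section \<open>The input representation\<close>

lemma nth_concat_map_upt:
  "l < length us * A \<Longrightarrow> concat (map (\<lambda>u. map (f u) [0..<A]) us) ! l = f (us ! (l div A)) (l mod A)"
proof (induction us arbitrary: l)
  case (Cons u us)
  show ?case
  proof (cases "l < A")
    case True
    then show ?thesis by (simp add: nth_append)
  next
    case False
    moreover have "0 < A" using Cons.prems by (cases A) auto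
    ultimately show ?thesis using Cons.IH[of "l - A"] Cons.prems
      by (simp add: nth_append le_div_geq le_mod_geq)
  qed
qed simp

lemma position_nth: "distinct vs \<Longrightarrow> i < length vs \<Longrightarrow> position vs (vs ! i) = i"
  unfolding position_def by (rule Least_equality) (auto simp: nth_eq_iff_index_eq)

lemma position_in: "distinct vs \<Longrightarrow> v \<in> set vs \<Longrightarrow> position vs v < length vs \<and> vs ! position vs v = v"
  by (auto simp: in_set_conv_nth position_nth)

text \<open>The degree ignores letters, and each pair of nodes carries at most one arc per
  letter.\<close>

lemma card_arcs_le:
  fixes D :: "('v, 'a :: finite) graph_db"
  assumes "wf_db D"
  shows "card (arcs D) \<le> CARD('a) * (\<Sum>u\<in>nodes D. degree D u)"
proof -
  have fin: "finite (nodes D)" "finite (arcs D)" using assms by (auto simp: wf_db_def)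
  let ?N = "\<lambda>u. {v. \<exists>x. (u, x, v) \<in> arcs D}"
  have fN: "finite (?N u)" for u
  proof (rule finite_subset)
    show "?N u \<subseteq> (snd \<circ> snd) ` arcs D" by force
  qed (use fin in simp)
  have "arcs D \<subseteq> (\<lambda>((u, v), x). (u, x, v)) ` (Sigma (nodes D) ?N \<times> UNIV)"
    using assms by (force simp: wf_db_def)
  then have "card (arcs D) \<le> card (Sigma (nodes D) ?N \<times> (UNIV :: 'a set))"
    using fin fN by (intro surj_card_le) (auto intro!: finite_SigmaI)
  also have "\<dots> = (\<Sum>u\<in>nodes D. degree D u) * CARD('a)"
    using fin fN by (simp add: card_cartesian_product card_SigmaI degree_def)
  finally show ?thesis by (simp add: mult.commute)
qed

locale db_input =
  fixes code :: "'a::finite \<Rightarrow> nat" and D :: "('v, 'a) graph_db" and vs :: "'v list"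
    and succs :: "'v \<Rightarrow> 'a \<Rightarrow> 'v list" and q :: "'a rpq"
  assumes code: "bij_betw code UNIV {..<CARD('a)}" and wf: "wf_db D" and rep: "represents vs succs D"
begin

abbreviation "n \<equiv> length vs"
abbreviation "xss \<equiv> succ_lists code vs succs"

lemma vs: "distinct vs" "set vs = nodes D"
  and succs: "u \<in> nodes D \<Longrightarrow> distinct (succs u x) \<and> set (succs u x) = {v. (u, x, v) \<in> arcs D}"
  using rep by (auto simp: represents_def)

lemma code_inv: "inv code (code a) = a" and code_less: "code a < CARD('a)"
  and inv_code: "j < CARD('a) \<Longrightarrow> code (inv code j) = j"
proof -
  have inj: "inj code" and im: "range code = {..<CARD('a)}" using code by (auto simp: bij_betw_def)
  show "inv code (code a) = a" using inj by simp
  show "code a < CARD('a)" using im by auto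
  show "code (inv code j) = j" if "j < CARD('a)" using im that by (intro f_inv_into_f) auto
qed

lemma length_xss: "length xss = n * CARD('a)"
  by (simp add: succ_lists_def length_concat comp_def sum_list_triv)

lemma nth_xss: "l < n * CARD('a) \<Longrightarrow>
   xss ! l = map (position vs) (succs (vs ! (l div CARD('a))) (inv code (l mod CARD('a))))"
  unfolding succ_lists_def by (rule nth_concat_map_upt)

lemma in_xss:
  assumes "l < n * CARD('a)"
  shows "y \<in> set (xss ! l) \<longleftrightarrow>
    y < n \<and> (vs ! (l div CARD('a)), inv code (l mod CARD('a)), vs ! y) \<in> arcs D"
proof -
  let ?u = "vs ! (l div CARD('a))" and ?a = "inv code (l mod CARD('a))"
  have "?u \<in> nodes D" using assms vs by (metis less_mult_imp_div_less nth_mem)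
  then have "set (xss ! l) = position vs ` {v. (?u, ?a, v) \<in> arcs D}"
    using nth_xss[OF assms] succs by simp
  moreover have "(?u, ?a, v) \<in> arcs D \<Longrightarrow> v \<in> set vs" for v
    using wf vs by (auto simp: wf_db_def)
  ultimately show ?thesis
    using position_in[OF vs(1)] position_nth[OF vs(1)] by (force simp: image_iff)
qed

sublocale query_input code q n "CARD('a)" xss
proof
  show "length xss = n * CARD('a)" by (rule length_xss)
  show "code a < CARD('a)" for a by (rule code_less)
  show "y < n" if "ys \<in> set xss" "y \<in> set ys" for ys y
    using that in_xss length_xss by (metis in_set_conv_nth)
qed

lemma arc_list_iff: "(i, c, j) \<in> set arc_list \<longleftrightarrow>
  i < n \<and> c < CARD('a) \<and> j < n \<and> (vs ! i, inv code c, vs ! j) \<in> arcs D"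
proof
  assume "(i, c, j) \<in> set arc_list"
  moreover then obtain l where "l < n * CARD('a)" "i = l div CARD('a)" "c = l mod CARD('a)" "j \<in> set (xss ! l)"
    by (auto simp: arc_list_def)
  ultimately show "i < n \<and> c < CARD('a) \<and> j < n \<and> (vs ! i, inv code c, vs ! j) \<in> arcs D"
    using arc_list_less[of i c j] in_xss[of l j] by simp
next
  assume *: "i < n \<and> c < CARD('a) \<and> j < n \<and> (vs ! i, inv code c, vs ! j) \<in> arcs D"
  have "i * CARD('a) + c < Suc i * CARD('a)" using * by simp
  also have "\<dots> \<le> n * CARD('a)" using * by (intro mult_le_mono) auto
  finally have l: "i * CARD('a) + c < n * CARD('a)" .
  have "j \<in> set (xss ! (i * CARD('a) + c))" using in_xss[OF l] * by simp
  then show "(i, c, j) \<in> set arc_list"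
    using l * unfolding arc_list_def by (auto intro!: bexI[of _ "i * CARD('a) + c"])
qed

lemma G_code: "G (code a) = {(i, j). i < n \<and> j < n \<and> (vs ! i, a, vs ! j) \<in> arcs D}"
  by (auto simp: G_def arc_list_iff code_inv code_less)

lemma answers_eq: "answers q D = map_prod ((!) vs) ((!) vs) ` Rel"
  unfolding Rel_def using G_code G_subset by (intro answers_eq_rel[OF wf vs(2,1)])

text \<open>An index \<open>l\<close> is determined by its quotient and remainder modulo the
  alphabet size, so different lists give different triples; inside one list the successors are
  distinct.\<close>

lemma distinct_arc_list: "distinct arc_list"
proof -
  let ?g = "\<lambda>l. map (\<lambda>y. (l div CARD('a), l mod CARD('a), y)) (xss ! l)"
  have d: "distinct (?g l)" if "l < n * CARD('a)" for l
  proof -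
    have u: "vs ! (l div CARD('a)) \<in> nodes D" using that vs by (metis less_mult_imp_div_less nth_mem)
    have "inj_on (position vs) (set vs)" using position_in[OF vs(1)] by (metis inj_onI)
    moreover have "set (succs (vs ! (l div CARD('a))) x) \<subseteq> set vs" for x
      using succs[OF u] wf vs(2) by (auto simp: wf_db_def)
    ultimately have "distinct (xss ! l)"
      using succs[OF u] unfolding nth_xss[OF that] by (simp add: distinct_map inj_on_subset)
    then show ?thesis by (simp add: distinct_map inj_on_def)
  qed
  have e: "l = l'" if "l div CARD('a) = l' div CARD('a)" "l mod CARD('a) = l' mod CARD('a)" for l l'
    using that by (metis div_mult_mod_eq)
  have "k \<le> n * CARD('a) \<Longrightarrow> distinct (concat (map ?g [0..<k]))" for k
  proof (induction k)
    case (Suc k)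
    have "p \<notin> set (?g l)" if "p \<in> set (?g k)" "l < k" for p l
      using that e[of l k] by auto
    then have "set (concat (map ?g [0..<k])) \<inter> set (?g k) = {}" by fastforce
    then show ?case using Suc d[of k] by simp
  qed simp
  then show ?thesis unfolding arc_list_def by simp
qed

lemma m_le: "m \<le> card (arcs D)"
proof -
  have "m = card (set arc_list)" using distinct_arc_list by (simp add: distinct_card length_arc_list)
  also have "\<dots> \<le> card (arcs D)"
  proof (rule card_inj_on_le)
    show "inj_on (\<lambda>(i, c, j). (vs ! i, inv code c, vs ! j)) (set arc_list)"
      using vs(1) inv_code by (auto simp: inj_on_def arc_list_iff nth_eq_iff_index_eq) metis+
    show "(\<lambda>(i, c, j). (vs ! i, inv code c, vs ! j)) ` set arc_list \<subseteq> arcs D"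
      by (auto simp: arc_list_iff)
    show "finite (arcs D)" using wf by (simp add: wf_db_def)
  qed
  finally show ?thesis .
qed

lemma length_input: "length (input_words code vs succs q) = 3 + rpq_length q + n * CARD('a) + m"
  by (simp add: input_words_def length_rpq_words offsets_def m_def length_xss)

section \<open>Comparison with the required time bounds and word size\<close>

lemma avg_degree_nonneg: "0 \<le> avg_degree D"
  by (simp add: avg_degree_def sum_nonneg)

text \<open>\<open>m div n + 1\<close> is at most \<open>(m + n) / n\<close>, and \<open>m\<close>
  is at most the alphabet size times \<open>avg_degree D * n\<close>. The factor \<open>n\<close>
  cancels, and \<open>m + n\<close> is at most twice the database size.\<close>

lemma arcs_bound: "real ((m div n + 1) * m) \<le> 2 * CARD('a) * (avg_degree D * db_size D)"
proof (cases "m = 0")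
  case True
  then show ?thesis using avg_degree_nonneg by simp
next
  case False
  then have "arcs D \<noteq> {}" using m_le by auto
  then have "nodes D \<noteq> {}" using wf by (auto simp: wf_db_def)
  then have n: "0 < n" using vs by auto
  have card: "card (nodes D) = n" using distinct_card[OF vs(1)] vs(2) by simp
  have deg: "avg_degree D * n = (\<Sum>u\<in>nodes D. real (degree D u))" using n by (simp add: avg_degree_def card)
  have "real m \<le> real (CARD('a) * (\<Sum>u\<in>nodes D. degree D u))"
    using m_le card_arcs_le[OF wf] by (simp only: of_nat_le_iff)
  then have m: "real m \<le> CARD('a) * (avg_degree D * n)" by (simp add: deg)
  have db: "real (m + n) \<le> 2 * db_size D" using m_le by (simp add: db_size_def card)
  have "real ((m div n + 1) * m) \<le> real (m + n) / n * real m"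
  proof -
    have "real (m div n) \<le> real m / n" by (rule of_nat_div_le_of_nat)
    then have "real (m div n + 1) \<le> real (m + n) / n" using n by (simp add: add_divide_distrib)
    then show ?thesis unfolding of_nat_mult by (rule mult_right_mono) simp
  qed
  also have "\<dots> \<le> real (m + n) / n * (CARD('a) * (avg_degree D * n))"
    using m by (rule mult_left_mono) simp
  also have "\<dots> = real (m + n) * (CARD('a) * avg_degree D)" using n by simp
  also have "\<dots> \<le> (2 * db_size D) * (CARD('a) * avg_degree D)"
    using db avg_degree_nonneg by (intro mult_right_mono) auto
  finally show ?thesis by (simp add: ac_simps)
qed

text \<open>The logarithmic factor of \<open>pre_bound\<close> is at least 1, so a bound without the
  logarithm suffices.\<close>

lemma preprocessing_bound:
  fixes a b :: nat
  shows "real (a * rpq_length q + b * (K * (rpq_length q * m))) \<le> (a + 2 * CARD('a) * b) * pre_bound D q"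
proof -
  define l where "l = real (rpq_length q)"
  define e where "e = avg_degree D * db_size D"
  have e0: "0 \<le> e" using avg_degree_nonneg by (simp add: e_def)
  have l0: "0 \<le> l" by (simp add: l_def)
  have "l\<^sup>2 * 1 * e \<le> l\<^sup>2 * max 1 (log 2 (avg_degree D * l)) * e"
    using e0 by (intro mult_right_mono mult_left_mono) auto
  then have pb: "l + l\<^sup>2 * e \<le> pre_bound D q"
    unfolding pre_bound_def l_def[symmetric] e_def by (simp add: ac_simps)
  have "real (K * (rpq_length q * m)) = l\<^sup>2 * real ((m div n + 1) * m)"
    by (simp add: K_def l_def power2_eq_square algebra_simps)
  also have "\<dots> \<le> l\<^sup>2 * (2 * CARD('a) * e)"
    using arcs_bound by (intro mult_left_mono) (simp_all add: e_def)
  finally have "real (a * rpq_length q + b * (K * (rpq_length q * m))) \<le> a * l + b * (l\<^sup>2 * (2 * CARD('a) * e))"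
    unfolding of_nat_add of_nat_mult by (intro add_mono mult_left_mono) (simp_all add: l_def)
  also have "\<dots> \<le> (a + 2 * CARD('a) * b) * (l + l\<^sup>2 * e)"
    using e0 l0 by (simp add: algebra_simps)
  also have "\<dots> \<le> (a + 2 * CARD('a) * b) * pre_bound D q"
    using pb by (intro mult_left_mono) auto
  finally show ?thesis .
qed

text \<open>Multiplying the word length by \<open>k\<close> makes room for the \<open>k\<close>-th
  power of the input length; this turns the fixed exponents of the compiler into a constant word
  factor.\<close>

lemma word_size_ge:
  assumes "0 < length ws"
  shows "length ws ^ k \<le> 2 ^ word_size k ws"
proof -
  let ?c = "nat \<lceil>log 2 (real (length ws))\<rceil>"
  have "real (length ws) = 2 powr log 2 (real (length ws))" using assms by simp
  also have "\<dots> \<le> 2 powr real ?c" by (intro powr_mono) linarith+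
  also have "\<dots> = real (2 ^ ?c)" by (simp add: powr_realpow)
  finally have "length ws \<le> 2 ^ ?c" by (simp only: of_nat_le_iff)
  then have "length ws ^ k \<le> (2 ^ ?c) ^ k" by (rule power_mono) simp
  then show ?thesis by (simp add: word_size_def power_mult[symmetric] mult.commute)
qed

lemma res_correct:
  "(let res = map (\<lambda>(i, j). (vs ! i, vs ! j)) os in
     set res = answers q D \<and> distinct res \<and> sorted_wrt (lex_le vs) res)"
  if "set os = Rel" and srt: "sorted_wrt (\<lambda>(i, j) (i', j'). i < i' \<or> i = i' \<and> j < j') os"
proof -
  have less: "i < n \<and> j < n" if "(i, j) \<in> set os" for i j
    using that \<open>set os = Rel\<close> rel_subset[of G n code q, OF G_subset] by (auto simp: Rel_def)
  have "inj_on (\<lambda>(i, j). (vs ! i, vs ! j)) (set os)"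
    using less vs(1) by (auto simp: inj_on_def nth_eq_iff_index_eq)
  moreover have "distinct os"
    using srt by (induction os) auto
  moreover have "sorted_wrt (\<lambda>x y. lex_le vs (case x of (i, j) \<Rightarrow> (vs ! i, vs ! j)) (case y of (i, j) \<Rightarrow> (vs ! i, vs ! j))) os"
  proof (rule sorted_wrt_mono_rel[OF _ srt])
    fix x y assume xy: "x \<in> set os" "y \<in> set os" "(case x of (i, j) \<Rightarrow> \<lambda>(i', j'). i < i' \<or> i = i' \<and> j < j') y"
    obtain i j i' j' where [simp]: "x = (i, j)" "y = (i', j')" by (cases x; cases y)
    have l: "i < n" "j < n" "i' < n" "j' < n" using less xy(1,2) by auto
    show "lex_le vs (case x of (i, j) \<Rightarrow> (vs ! i, vs ! j)) (case y of (i, j) \<Rightarrow> (vs ! i, vs ! j))"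
    proof (cases "i < i'")
      case True
      then have "vs ! i \<noteq> vs ! i'" using l vs(1) by (simp add: nth_eq_iff_index_eq)
      moreover have "node_le vs (vs ! i) (vs ! i')" unfolding node_le_def using True l by (intro exI[of _ i] exI[of _ i']) simp
      ultimately show ?thesis by (simp add: lex_le_def)
    next
      case False
      then have "i = i'" "j < j'" using xy(3) by auto
      moreover then have "node_le vs (vs ! j) (vs ! j')" unfolding node_le_def using l by (intro exI[of _ j] exI[of _ j']) simp
      ultimately show ?thesis by (simp add: lex_le_def)
    qed
  qed
  ultimately show ?thesis
    using answers_eq \<open>set os = Rel\<close> by (simp add: Let_def distinct_map sorted_wrt_map map_prod_def)
qed

end

theorem theorem7p1:
  fixes code :: "'a::finite \<Rightarrow> nat"
  assumes "bij_betw code UNIV {..<CARD('a)}"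
  shows "\<exists>(P :: instr list) (wc :: nat) (c1 :: real) (c2 :: real).
    \<forall>(D :: (nat, 'a) graph_db) (vs :: nat list) (succs :: nat \<Rightarrow> 'a \<Rightarrow> nat list) (q :: 'a rpq).
      wf_db D \<longrightarrow> represents vs succs D \<longrightarrow>
      sorted_enum code wc P D vs succs q (c1 * pre_bound D q) (c2 * delay_bound D)"
proof -
  define A where "A = CARD('a)"
  \<comment> \<open>With input length L, the exponent \<open>A + 8\<close> makes up X: L^4 covers
    the factor 100 since L is at least 4, three factors L cover \<open>n + 1\<close>,
    \<open>q + 1\<close> and \<open>m + 1\<close>, and L^(A + 1) covers \<open>A + 1\<close>. The 2
    added to \<open>csize\<close> makes the required inequalities strict.\<close>
  define wc where "wc = (A + 8) * (csize (main A) + 2)"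
  define c1 where "c1 = real 2000 + 2 * real A * real (100 * A + 9000)"
  \<comment> \<open>The factor 2 turns \<open>n + 1\<close> into \<open>max 1 n\<close>; the last
    digit of 20001 counts the step that outputs or halts.\<close>
  define c2 where "c2 = 2 * real (100 * A + 20001)"
  have "sorted_enum code wc (program A) D vs succs q (c1 * pre_bound D q) (c2 * delay_bound D)"
    if "wf_db D" "represents vs succs D"
    for D :: "(nat, 'a) graph_db" and vs succs and q :: "'a rpq"
  proof -
    interpret db_input code D vs succs q
      using assms that by unfold_locales
    let ?ws = "input_words code vs succs q"
    define L where "L = length ?ws"
    define X where "X = L ^ (A + 8)"
    have A: "0 < A" by (simp add: A_def)
    have L: "L = 3 + rpq_length q + n * A + m" by (simp add: L_def length_input A_def)
    have "n * 1 \<le> n * A" using A by (intro mult_le_mono) auto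
    then have nqm: "n + 1 \<le> L" "rpq_length q + 1 \<le> L" "m + 1 \<le> L" "4 \<le> L"
      using rpq_length_pos[of q] unfolding L by linarith+
    have "A + 1 \<le> 2 ^ (A + 1)" using less_exp[of "A + 1"] by linarith
    also have "(2 :: nat) ^ (A + 1) \<le> L ^ (A + 1)" using nqm(4) by (intro power_mono) auto
    finally have AL: "A + 1 \<le> L ^ (A + 1)" .
    have "(4 :: nat) ^ 4 \<le> L ^ 4" using nqm(4) by (rule power_mono) simp
    then have "100 * (n + 1) * (rpq_length q + 1) * (m + 1) * (A + 1) \<le> L ^ 4 * L * L * L * L ^ (A + 1)"
      using nqm AL by (intro mult_le_mono) auto
    also have "\<dots> = X" by (simp add: X_def power_add eval_nat_numeral)
    finally have X: "100 * (n + 1) * (rpq_length q + 1) * (m + 1) * (A + 1) \<le> X" .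
    interpret query_run code q n "CARD('a)" xss X
      using X by unfold_locales (simp add: A_def)
    have xs: "xs = ?ws" by (simp add: xs_def input_words_def)
    have X2: "2 \<le> X" using X_n by simp
    have "X ^ (csize (main A) + 2) = L ^ wc" unfolding X_def wc_def by (rule power_mult[symmetric])
    also have "\<dots> \<le> 2 ^ word_size wc ?ws"
      unfolding L_def by (rule word_size_ge) (use nqm(4) in \<open>unfold L_def, linarith\<close>)
    finally have w: "X ^ (csize (main A) + 2) \<le> 2 ^ word_size wc ?ws" .
    have "X ^ csize (main A) < X ^ (csize (main A) + 2)" "X ^ 1 < X ^ (csize (main A) + 2)"
      using X2 by (intro power_strict_increasing; simp)+
    then have fits: "X ^ csize (main A) < 2 ^ word_size wc ?ws" "X < 2 ^ word_size wc ?ws"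
      using w unfolding power_one_right by linarith+
    have "real (delay + 1) \<le> real ((100 * A + 20001) * (n + 1))"
      unfolding delay_def A_def of_nat_le_iff by simp
    also have "\<dots> \<le> real ((100 * A + 20001) * (2 * max 1 n))"
      unfolding of_nat_le_iff by (intro mult_le_mono) auto
    also have "\<dots> = c2 * delay_bound D"
      using distinct_card[OF vs(1)] vs(2) by (simp add: c2_def delay_bound_def)
    finally have d: "real (delay + 1) \<le> c2 * delay_bound D" .
    have "real (2000 * rpq_length q + (100 * A + 9000) * (K * (rpq_length q * m))) \<le> c1 * pre_bound D q"
      using preprocessing_bound[of 2000 "100 * A + 9000"] by (simp add: c1_def A_def)
    note bound = this
    obtain es where es: "run (word_size wc ?ws) (program A) (init_config ?ws) es"
      "enumeration es (c1 * pre_bound D q) (c2 * delay_bound D) outputs"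
      using run_program[OF fits[unfolded A_def] bound[unfolded A_def] d] unfolding xs A_def by blast
    have "\<forall>(i, j)\<in>set outputs. i < n \<and> j < n"
      using set_outputs rel_subset[of G n code q, OF G_subset] by (auto simp: Rel_def)
    then show ?thesis
      unfolding sorted_enum_def Let_def[of ?ws]
      using es res_correct[OF set_outputs sorted_outputs] by blast
  qed
  then show ?thesis by blast
qed

end
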